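(* Let $\mathcal{S}$ be a Boolean topos, let $\mathcal{E}$ be a topos and let $p : \mathcal{E} \to \mathcal{S}$ be a stably pre-cohesive geometric morphism. Then the direct image $p_* : \mathcal{E} \to \mathcal{S}$ is a Unity and Identity for the full subcategories $\mathrm{Dec}(\mathcal{E}) \to \mathcal{E}$ and $\mathcal{E}_{\neg\neg} \to \mathcal{E}$, making them Adjointly Opposite. That is: the fully faithful left adjoint $p^* : \mathcal{S} \to \mathcal{E}$ of $p_*$ coincides, up to an equivalence $\mathcal{S} \simeq \mathrm{Dec}(\mathcal{E})$ over $\mathcal{E}$, with the inclusion $\mathrm{Dec}(\mathcal{E}) \to \mathcal{E}$ (its essential image consists exactly of the decidable objects), and the fully faithful right adjoint $p^! : \mathcal{S} \to \mathcal{E}$ of $p_*$ coincides, up to an equivalence $\mathcal{S} \simeq \mathcal{E}_{\neg\neg}$ over $\mathcal{E}$, with the inclusion $\mathcal{E}_{\neg\neg} \to \mathcal{E}$ (its essential image consists exactly of the $\neg\neg$-sheaves).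
   Context: "Topos" means elementary topos. An object $X$ of $\mathcal{E}$ is decidable if its diagonal $\Delta : X \to X\times X$ is a complemented subobject; $\mathrm{Dec}(\mathcal{E}) \to \mathcal{E}$ is the full subcategory of decidable objects. $\mathcal{E}_{\neg\neg} \to \mathcal{E}$ is the full subcategory of sheaves for the double-negation topology. A Unity and Identity (UI) of two maps with common codomain is a map out of that codomain whose composites with both are isomorphisms (for functors: equivalences). Two parallel functors are Adjointly Opposite via a third one if the third is right adjoint to one of them and left adjoint to the other. A UIAO is thus a functor having a left and a right adjoint that are both fully faithful. Let $p : \mathcal{E} \to \mathcal{S}$ be a geometric morphism ($p^* \dashv p_*$, $p^*$ preserving finite limits). It is connected if $p^*$ is fully faithful; hyperconnected if it is connected and the counit $\beta : p^* p_* \to \mathrm{Id}_{\mathcal{E}}$ is monic; local if $p_*$ has a fully faithful right adjoint $p^!$ (equivalently, $p$ is connected and $p_*$ has a right adjoint $p^!$); essential if $p^*$ has a left adjoint $p_!$; pressential if it is essential and $p_!$ preserves finite products; pre-cohesive if it is local, hyperconnected and pressential. For each object $B$ of $\mathcal{S}$, $p/B : \mathcal{E}/p^*B \to \mathcal{S}/B$ is the geometric morphism whose inverse image $(p/B)^* : \mathcal{S}/B \to \mathcal{E}/p^*B$ is $p^*$ applied to morphisms with codomain $B$. If $p$ is essential so is $p/B$, with $(p/B)_!$ sending $x : X \to p^*B$ to $p_! X \xrightarrow{p_! x} p_! p^* B \xrightarrow{\tau} B$, where $\tau$ is the counit of $p_! \dashv p^*$. The morphism $p$ is stably pre-cohesive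 if $p/B$ is pre-cohesive for every $B$ in $\mathcal{S}$. *)

theory Defs
  imports Main
begin

section \<open>Categories, functors, adjunctions\<close>

record ('o, 'a) category =
  Obj :: "'o set"
  Arr :: "'a set"
  Dom :: "'a \<Rightarrow> 'o"
  Cod :: "'a \<Rightarrow> 'o"
  Ide :: "'o \<Rightarrow> 'a"
  Comp :: "'a \<Rightarrow> 'a \<Rightarrow> 'a"  (infixr \<open>\<cdot>\<index>\<close> 70)

definition Hom :: "('o, 'a) category \<Rightarrow> 'o \<Rightarrow> 'o \<Rightarrow> 'a set" where
  "Hom C X Y = {f \<in> Arr C. Dom C f = X \<and> Cod C f = Y}"

definition is_category :: "('o, 'a) category \<Rightarrow> bool" where
  "is_category C \<longleftrightarrow>
     (\<forall>f\<in>Arr C. Dom C f \<in> Obj C \<and> Cod C f \<in> Obj C) \<and>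
     (\<forall>X\<in>Obj C. Ide C X \<in> Hom C X X) \<and>
     (\<forall>f\<in>Arr C. \<forall>g\<in>Arr C. Cod C f = Dom C g \<longrightarrow>
        g \<cdot>\<^bsub>C\<^esub> f \<in> Hom C (Dom C f) (Cod C g)) \<and>
     (\<forall>f\<in>Arr C. f \<cdot>\<^bsub>C\<^esub> Ide C (Dom C f) = f \<and> Ide C (Cod C f) \<cdot>\<^bsub>C\<^esub> f = f) \<and>
     (\<forall>f\<in>Arr C. \<forall>g\<in>Arr C. \<forall>h\<in>Arr C. Cod C f = Dom C g \<and> Cod C g = Dom C h \<longrightarrow>
        h \<cdot>\<^bsub>C\<^esub> (g \<cdot>\<^bsub>C\<^esub> f) = (h \<cdot>\<^bsub>C\<^esub> g) \<cdot>\<^bsub>C\<^esub> f)"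

record ('o, 'a, 'p, 'b) functor_data =
  fobj :: "'o \<Rightarrow> 'p"
  farr :: "'a \<Rightarrow> 'b"

definition is_functor ::
  "('o, 'a) category \<Rightarrow> ('p, 'b) category \<Rightarrow> ('o, 'a, 'p, 'b) functor_data \<Rightarrow> bool" where
  "is_functor C D F \<longleftrightarrow>
     (\<forall>X\<in>Obj C. fobj F X \<in> Obj D) \<and>
     (\<forall>f\<in>Arr C. farr F f \<in> Hom D (fobj F (Dom C f)) (fobj F (Cod C f))) \<and>
     (\<forall>X\<in>Obj C. farr F (Ide C X) = Ide D (fobj F X)) \<and>
     (\<forall>f\<in>Arr C. \<forall>g\<in>Arr C. Cod C f = Dom C g \<longrightarrow>
        farr F (g \<cdot>\<^bsub>C\<^esub> f) = farr F g \<cdot>\<^bsub>D\<^esub> farr F f)"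

definition id_functor :: "('o, 'a, 'o, 'a) functor_data" where
  "id_functor = \<lparr>fobj = \<lambda>X. X, farr = \<lambda>f. f\<rparr>"

definition comp_functor ::
  "('p, 'b, 'q, 'c) functor_data \<Rightarrow> ('o, 'a, 'p, 'b) functor_data \<Rightarrow> ('o, 'a, 'q, 'c) functor_data"
  (infixr \<open>\<odot>\<close> 70) where
  "G \<odot> F = \<lparr>fobj = \<lambda>X. fobj G (fobj F X), farr = \<lambda>f. farr G (farr F f)\<rparr>"

definition isomorphism :: "('o, 'a) category \<Rightarrow> 'a \<Rightarrow> bool" where
  "isomorphism C f \<longleftrightarrow> f \<in> Arr C \<and>
     (\<exists>g\<in>Hom C (Cod C f) (Dom C f).
        g \<cdot>\<^bsub>C\<^esub> f = Ide C (Dom C f) \<and> f \<cdot>\<^bsub>C\<^esub> g = Ide C (Cod C f))"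

definition isomorphic :: "('o, 'a) category \<Rightarrow> 'o \<Rightarrow> 'o \<Rightarrow> bool" where
  "isomorphic C X Y \<longleftrightarrow> (\<exists>f\<in>Hom C X Y. isomorphism C f)"

definition nat_trans ::
  "('o, 'a) category \<Rightarrow> ('p, 'b) category \<Rightarrow> ('o, 'a, 'p, 'b) functor_data
   \<Rightarrow> ('o, 'a, 'p, 'b) functor_data \<Rightarrow> ('o \<Rightarrow> 'b) \<Rightarrow> bool" where
  "nat_trans C D F G \<tau> \<longleftrightarrow>
     (\<forall>X\<in>Obj C. \<tau> X \<in> Hom D (fobj F X) (fobj G X)) \<and>
     (\<forall>f\<in>Arr C. farr G f \<cdot>\<^bsub>D\<^esub> \<tau> (Dom C f) = \<tau> (Cod C f) \<cdot>\<^bsub>D\<^esub> farr F f)"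

definition nat_isomorphic ::
  "('o, 'a) category \<Rightarrow> ('p, 'b) category \<Rightarrow> ('o, 'a, 'p, 'b) functor_data
   \<Rightarrow> ('o, 'a, 'p, 'b) functor_data \<Rightarrow> bool" where
  "nat_isomorphic C D F G \<longleftrightarrow>
     (\<exists>\<tau>. nat_trans C D F G \<tau> \<and> (\<forall>X\<in>Obj C. isomorphism D (\<tau> X)))"

definition quasi_inverse ::
  "('o, 'a) category \<Rightarrow> ('p, 'b) category \<Rightarrow> ('o, 'a, 'p, 'b) functor_data
   \<Rightarrow> ('p, 'b, 'o, 'a) functor_data \<Rightarrow> bool" where
  "quasi_inverse C D F G \<longleftrightarrow>
     is_functor C D F \<and> is_functor D C G \<and>
     nat_isomorphic C C id_functor (G \<odot> F) \<and> nat_isomorphic D D (F \<odot> G) id_functor"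

definition is_equivalence ::
  "('o, 'a) category \<Rightarrow> ('p, 'b) category \<Rightarrow> ('o, 'a, 'p, 'b) functor_data \<Rightarrow> bool" where
  "is_equivalence C D F \<longleftrightarrow> (\<exists>G. quasi_inverse C D F G)"

definition fully_faithful ::
  "('o, 'a) category \<Rightarrow> ('p, 'b) category \<Rightarrow> ('o, 'a, 'p, 'b) functor_data \<Rightarrow> bool" where
  "fully_faithful C D F \<longleftrightarrow> is_functor C D F \<and>
     (\<forall>X\<in>Obj C. \<forall>Y\<in>Obj C. bij_betw (farr F) (Hom C X Y) (Hom D (fobj F X) (fobj F Y)))"

definition essential_image ::
  "('o, 'a) category \<Rightarrow> ('p, 'b) category \<Rightarrow> ('o, 'a, 'p, 'b) functor_data \<Rightarrow> 'p set" where
  "essential_image C D F = {Y \<in> Obj D. \<exists>X\<in>Obj C. isomorphic D (fobj F X) Y}"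

definition full_subcategory :: "('o, 'a) category \<Rightarrow> ('o \<Rightarrow> bool) \<Rightarrow> ('o, 'a) category" where
  "full_subcategory C P = \<lparr>Obj = {X \<in> Obj C. P X},
     Arr = {f \<in> Arr C. P (Dom C f) \<and> P (Cod C f)},
     Dom = Dom C, Cod = Cod C, Ide = Ide C, Comp = Comp C\<rparr>"

text \<open>A full subcategory has the same underlying types as the ambient category, so that its
  inclusion functor has the same underlying data as the identity functor.\<close>

abbreviation inclusion :: "('o, 'a, 'o, 'a) functor_data" where
  "inclusion \<equiv> id_functor"

text \<open>\<open>adjunction C D F G \<eta> \<epsilon>\<close>: the functor \<open>F : C \<rightarrow> D\<close> is left adjoint to \<open>G : D \<rightarrow> C\<close>, with unit
  \<open>\<eta>\<close> and counit \<open>\<epsilon>\<close>.\<close>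

definition adjunction ::
  "('o, 'a) category \<Rightarrow> ('p, 'b) category \<Rightarrow> ('o, 'a, 'p, 'b) functor_data
   \<Rightarrow> ('p, 'b, 'o, 'a) functor_data \<Rightarrow> ('o \<Rightarrow> 'a) \<Rightarrow> ('p \<Rightarrow> 'b) \<Rightarrow> bool" where
  "adjunction C D F G \<eta> \<epsilon> \<longleftrightarrow>
     is_functor C D F \<and> is_functor D C G \<and>
     nat_trans C C id_functor (G \<odot> F) \<eta> \<and> nat_trans D D (F \<odot> G) id_functor \<epsilon> \<and>
     (\<forall>X\<in>Obj C. \<epsilon> (fobj F X) \<cdot>\<^bsub>D\<^esub> farr F (\<eta> X) = Ide D (fobj F X)) \<and>
     (\<forall>Y\<in>Obj D. farr G (\<epsilon> Y) \<cdot>\<^bsub>C\<^esub> \<eta> (fobj G Y) = Ide C (fobj G Y))"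

definition left_adjoint ::
  "('o, 'a) category \<Rightarrow> ('p, 'b) category \<Rightarrow> ('o, 'a, 'p, 'b) functor_data
   \<Rightarrow> ('p, 'b, 'o, 'a) functor_data \<Rightarrow> bool" where
  "left_adjoint C D F G \<longleftrightarrow> (\<exists>\<eta> \<epsilon>. adjunction C D F G \<eta> \<epsilon>)"

section \<open>Limits\<close>

definition is_cone ::
  "('i, 'u) category \<Rightarrow> ('o, 'a) category \<Rightarrow> ('i, 'u, 'o, 'a) functor_data
   \<Rightarrow> 'o \<Rightarrow> ('i \<Rightarrow> 'a) \<Rightarrow> bool" where
  "is_cone J C D L \<pi> \<longleftrightarrow> L \<in> Obj C \<and>
     (\<forall>j\<in>Obj J. \<pi> j \<in> Hom C L (fobj D j)) \<and>
     (\<forall>u\<in>Arr J. farr D u \<cdot>\<^bsub>C\<^esub> \<pi> (Dom J u) = \<pi> (Cod J u))"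

definition is_limit ::
  "('i, 'u) category \<Rightarrow> ('o, 'a) category \<Rightarrow> ('i, 'u, 'o, 'a) functor_data
   \<Rightarrow> 'o \<Rightarrow> ('i \<Rightarrow> 'a) \<Rightarrow> bool" where
  "is_limit J C D L \<pi> \<longleftrightarrow> is_cone J C D L \<pi> \<and>
     (\<forall>M \<mu>. is_cone J C D M \<mu> \<longrightarrow>
        (\<exists>!h. h \<in> Hom C M L \<and> (\<forall>j\<in>Obj J. \<pi> j \<cdot>\<^bsub>C\<^esub> h = \<mu> j)))"

text \<open>Shapes of finite limits are finite categories; up to isomorphism their objects and arrows
  may be taken to be natural numbers.\<close>

definition finite_shape :: "(nat, nat) category \<Rightarrow> bool" where
  "finite_shape J \<longleftrightarrow> is_category J \<and> finite (Obj J) \<and> finite (Arr J)"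

definition discrete_shape :: "(nat, nat) category \<Rightarrow> bool" where
  "discrete_shape J \<longleftrightarrow> (\<forall>u\<in>Arr J. u = Ide J (Dom J u))"

definition has_finite_limits :: "('o, 'a) category \<Rightarrow> bool" where
  "has_finite_limits C \<longleftrightarrow>
     (\<forall>J D. finite_shape J \<and> is_functor J C D \<longrightarrow> (\<exists>L \<pi>. is_limit J C D L \<pi>))"

definition preserves_limits_of_shape ::
  "('i, 'u) category \<Rightarrow> ('o, 'a) category \<Rightarrow> ('p, 'b) category
   \<Rightarrow> ('o, 'a, 'p, 'b) functor_data \<Rightarrow> bool" where
  "preserves_limits_of_shape J C C' F \<longleftrightarrow>
     (\<forall>D L \<pi>. is_functor J C D \<and> is_limit J C D L \<pi> \<longrightarrow>
        is_limit J C' (F \<odot> D) (fobj F L) (\<lambda>j. farr F (\<pi> j)))"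

definition preserves_finite_limits ::
  "('o, 'a) category \<Rightarrow> ('p, 'b) category \<Rightarrow> ('o, 'a, 'p, 'b) functor_data \<Rightarrow> bool" where
  "preserves_finite_limits C D F \<longleftrightarrow>
     (\<forall>J. finite_shape J \<longrightarrow> preserves_limits_of_shape J C D F)"

definition preserves_finite_products ::
  "('o, 'a) category \<Rightarrow> ('p, 'b) category \<Rightarrow> ('o, 'a, 'p, 'b) functor_data \<Rightarrow> bool" where
  "preserves_finite_products C D F \<longleftrightarrow>
     (\<forall>J. finite_shape J \<and> discrete_shape J \<longrightarrow> preserves_limits_of_shape J C D F)"

definition is_terminal :: "('o, 'a) category \<Rightarrow> 'o \<Rightarrow> bool" where
  "is_terminal C T \<longleftrightarrow> T \<in> Obj C \<and> (\<forall>X\<in>Obj C. \<exists>!f. f \<in> Hom C X T)"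

definition is_initial :: "('o, 'a) category \<Rightarrow> 'o \<Rightarrow> bool" where
  "is_initial C Z \<longleftrightarrow> Z \<in> Obj C \<and> (\<forall>X\<in>Obj C. \<exists>!f. f \<in> Hom C Z X)"

definition is_product :: "('o, 'a) category \<Rightarrow> 'o \<Rightarrow> 'o \<Rightarrow> 'o \<Rightarrow> 'a \<Rightarrow> 'a \<Rightarrow> bool" where
  "is_product C X Y P p q \<longleftrightarrow> p \<in> Hom C P X \<and> q \<in> Hom C P Y \<and>
     (\<forall>W. \<forall>f\<in>Hom C W X. \<forall>g\<in>Hom C W Y.
        \<exists>!h. h \<in> Hom C W P \<and> p \<cdot>\<^bsub>C\<^esub> h = f \<and> q \<cdot>\<^bsub>C\<^esub> h = g)"

text \<open>\<open>is_pullback C p q f g\<close>: the square \<open>f p = g q\<close> is a pullback of \<open>f\<close> and \<open>g\<close>.\<close>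

definition is_pullback :: "('o, 'a) category \<Rightarrow> 'a \<Rightarrow> 'a \<Rightarrow> 'a \<Rightarrow> 'a \<Rightarrow> bool" where
  "is_pullback C p q f g \<longleftrightarrow>
     f \<in> Arr C \<and> g \<in> Arr C \<and> Cod C f = Cod C g \<and>
     p \<in> Hom C (Dom C p) (Dom C f) \<and> q \<in> Hom C (Dom C p) (Dom C g) \<and>
     f \<cdot>\<^bsub>C\<^esub> p = g \<cdot>\<^bsub>C\<^esub> q \<and>
     (\<forall>W. \<forall>a\<in>Hom C W (Dom C f). \<forall>b\<in>Hom C W (Dom C g). f \<cdot>\<^bsub>C\<^esub> a = g \<cdot>\<^bsub>C\<^esub> b \<longrightarrow>
        (\<exists>!h. h \<in> Hom C W (Dom C p) \<and> p \<cdot>\<^bsub>C\<^esub> h = a \<and> q \<cdot>\<^bsub>C\<^esub> h = b))"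

section \<open>Elementary toposes\<close>

text \<open>In the universal property of the exponential, \<open>k\<close> is the arrow \<open>h \<times> A : Q = W \<times> A \<rightarrow> P = H \<times> A\<close>.\<close>

definition cartesian_closed :: "('o, 'a) category \<Rightarrow> bool" where
  "cartesian_closed C \<longleftrightarrow>
     (\<exists>T. is_terminal C T) \<and>
     (\<forall>X\<in>Obj C. \<forall>Y\<in>Obj C. \<exists>P p q. is_product C X Y P p q) \<and>
     (\<forall>A\<in>Obj C. \<forall>B\<in>Obj C. \<exists>H P p q e. is_product C H A P p q \<and> e \<in> Hom C P B \<and>
        (\<forall>W Q r s. is_product C W A Q r s \<longrightarrow>
           (\<forall>f\<in>Hom C Q B. \<exists>!h. h \<in> Hom C W H \<and>
              (\<exists>k\<in>Hom C Q P. p \<cdot>\<^bsub>C\<^esub> k = h \<cdot>\<^bsub>C\<^esub> r \<and> q \<cdot>\<^bsub>C\<^esub> k = s \<and> e \<cdot>\<^bsub>C\<^esub> k = f))))"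

definition monic :: "('o, 'a) category \<Rightarrow> 'a \<Rightarrow> bool" where
  "monic C m \<longleftrightarrow> m \<in> Arr C \<and>
     (\<forall>W. \<forall>f\<in>Hom C W (Dom C m). \<forall>g\<in>Hom C W (Dom C m). m \<cdot>\<^bsub>C\<^esub> f = m \<cdot>\<^bsub>C\<^esub> g \<longrightarrow> f = g)"

text \<open>\<open>classifies C t m \<chi>\<close>: \<open>\<chi>\<close> is a characteristic arrow of \<open>m\<close>, i.e. \<open>m\<close> is a pullback of
  \<open>t : 1 \<rightarrow> \<Omega>\<close> along \<open>\<chi>\<close>.\<close>

definition classifies :: "('o, 'a) category \<Rightarrow> 'a \<Rightarrow> 'a \<Rightarrow> 'a \<Rightarrow> bool" where
  "classifies C t m \<chi> \<longleftrightarrow> \<chi> \<in> Hom C (Cod C m) (Cod C t) \<and> (\<exists>u. is_pullback C m u \<chi> t)"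

definition subobject_classifier :: "('o, 'a) category \<Rightarrow> 'a \<Rightarrow> bool" where
  "subobject_classifier C t \<longleftrightarrow> t \<in> Arr C \<and> is_terminal C (Dom C t) \<and>
     (\<forall>m. monic C m \<longrightarrow> (\<exists>!\<chi>. classifies C t m \<chi>))"

definition elementary_topos :: "('o, 'a) category \<Rightarrow> bool" where
  "elementary_topos C \<longleftrightarrow> is_category C \<and> has_finite_limits C \<and> cartesian_closed C \<and>
     (\<exists>t. subobject_classifier C t)"

section \<open>Complemented subobjects, decidable objects, double-negation sheaves\<close>

definition subobject :: "('o, 'a) category \<Rightarrow> 'o \<Rightarrow> 'a \<Rightarrow> bool" where
  "subobject C X m \<longleftrightarrow> monic C m \<and> Cod C m = X"

definition sub_le :: "('o, 'a) category \<Rightarrow> 'a \<Rightarrow> 'a \<Rightarrow> bool" where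
  "sub_le C m n \<longleftrightarrow> (\<exists>h\<in>Hom C (Dom C m) (Dom C n). n \<cdot>\<^bsub>C\<^esub> h = m)"

text \<open>Complements in the lattice of subobjects of \<open>X\<close>: the meet of \<open>m\<close> and \<open>n\<close> is the least subobject
  (every common lower bound lies below every subobject), and their join is the greatest one.\<close>

definition complement_of :: "('o, 'a) category \<Rightarrow> 'o \<Rightarrow> 'a \<Rightarrow> 'a \<Rightarrow> bool" where
  "complement_of C X m n \<longleftrightarrow> subobject C X m \<and> subobject C X n \<and>
     (\<forall>w. subobject C X w \<and> sub_le C w m \<and> sub_le C w n \<longrightarrow>
        (\<forall>v. subobject C X v \<longrightarrow> sub_le C w v)) \<and>
     (\<forall>w. subobject C X w \<and> sub_le C m w \<and> sub_le C n w \<longrightarrow>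
        (\<forall>v. subobject C X v \<longrightarrow> sub_le C v w))"

definition complemented :: "('o, 'a) category \<Rightarrow> 'a \<Rightarrow> bool" where
  "complemented C m \<longleftrightarrow> (\<exists>n. complement_of C (Cod C m) m n)"

definition boolean_topos :: "('o, 'a) category \<Rightarrow> bool" where
  "boolean_topos C \<longleftrightarrow> elementary_topos C \<and> (\<forall>m. monic C m \<longrightarrow> complemented C m)"

definition decidable :: "('o, 'a) category \<Rightarrow> 'o \<Rightarrow> bool" where
  "decidable C X \<longleftrightarrow> X \<in> Obj C \<and>
     (\<exists>P p q d. is_product C X X P p q \<and> d \<in> Hom C X P \<and>
        p \<cdot>\<^bsub>C\<^esub> d = Ide C X \<and> q \<cdot>\<^bsub>C\<^esub> d = Ide C X \<and> complemented C d)"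

definition Dec :: "('o, 'a) category \<Rightarrow> ('o, 'a) category" where
  "Dec C = full_subcategory C (decidable C)"

text \<open>The double-negation topology \<open>j = \<not> \<circ> \<not> : \<Omega> \<rightarrow> \<Omega>\<close>: here \<open>false : 1 \<rightarrow> \<Omega>\<close> is the
  characteristic arrow of \<open>0 \<rightarrow> 1\<close>, and \<open>\<not> : \<Omega> \<rightarrow> \<Omega>\<close> that of \<open>false\<close>.\<close>

definition double_negation :: "('o, 'a) category \<Rightarrow> 'a \<Rightarrow> 'a \<Rightarrow> bool" where
  "double_negation C t j \<longleftrightarrow>
     (\<exists>Z z false neg. is_initial C Z \<and> z \<in> Hom C Z (Dom C t) \<and>
        classifies C t z false \<and> classifies C t false neg \<and> j = neg \<cdot>\<^bsub>C\<^esub> neg)"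

text \<open>For a topology \<open>j\<close>, the closure of a subobject with characteristic arrow \<open>\<chi>\<close> is the subobject
  classified by \<open>j \<chi>\<close>; a subobject is dense if its closure is the whole object.\<close>

definition is_closure :: "('o, 'a) category \<Rightarrow> 'a \<Rightarrow> 'a \<Rightarrow> 'a \<Rightarrow> 'a \<Rightarrow> bool" where
  "is_closure C t j m c \<longleftrightarrow> monic C m \<and> monic C c \<and>
     (\<exists>\<chi>. classifies C t m \<chi> \<and> classifies C t c (j \<cdot>\<^bsub>C\<^esub> \<chi>))"

definition dense :: "('o, 'a) category \<Rightarrow> 'a \<Rightarrow> 'a \<Rightarrow> 'a \<Rightarrow> bool" where
  "dense C t j m \<longleftrightarrow> is_closure C t j m (Ide C (Cod C m))"

definition is_sheaf :: "('o, 'a) category \<Rightarrow> 'a \<Rightarrow> 'a \<Rightarrow> 'o \<Rightarrow> bool" where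
  "is_sheaf C t j F \<longleftrightarrow> F \<in> Obj C \<and>
     (\<forall>m. dense C t j m \<longrightarrow>
        (\<forall>f\<in>Hom C (Dom C m) F. \<exists>!g. g \<in> Hom C (Cod C m) F \<and> g \<cdot>\<^bsub>C\<^esub> m = f))"

definition dn_sheaf :: "('o, 'a) category \<Rightarrow> 'o \<Rightarrow> bool" where
  "dn_sheaf C F \<longleftrightarrow>
     (\<exists>t j. subobject_classifier C t \<and> double_negation C t j \<and> is_sheaf C t j F)"

definition Sh_dn :: "('o, 'a) category \<Rightarrow> ('o, 'a) category" where
  "Sh_dn C = full_subcategory C (dn_sheaf C)"

section \<open>Geometric morphisms\<close>

text \<open>A geometric morphism \<open>p : E \<rightarrow> S\<close> consists of the inverse image \<open>p\<^sup>* : S \<rightarrow> E\<close>, the direct image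
  \<open>p\<^sub>* : E \<rightarrow> S\<close>, and the unit and counit of \<open>p\<^sup>* \<stileturn> p\<^sub>*\<close>. The type parameters are the
  objects and arrows of \<open>E\<close>, then those of \<open>S\<close>.\<close>

record ('eo, 'ea, 'so, 'sa) geom =
  inv_im :: "('so, 'sa, 'eo, 'ea) functor_data"
  dir_im :: "('eo, 'ea, 'so, 'sa) functor_data"
  gunit :: "'so \<Rightarrow> 'sa"
  gcounit :: "'eo \<Rightarrow> 'ea"

definition geometric_morphism ::
  "('eo, 'ea) category \<Rightarrow> ('so, 'sa) category \<Rightarrow> ('eo, 'ea, 'so, 'sa) geom \<Rightarrow> bool" where
  "geometric_morphism E S p \<longleftrightarrow>
     adjunction S E (inv_im p) (dir_im p) (gunit p) (gcounit p) \<and>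
     preserves_finite_limits S E (inv_im p)"

definition is_connected ::
  "('eo, 'ea) category \<Rightarrow> ('so, 'sa) category \<Rightarrow> ('eo, 'ea, 'so, 'sa) geom \<Rightarrow> bool" where
  "is_connected E S p \<longleftrightarrow> fully_faithful S E (inv_im p)"

definition hyperconnected ::
  "('eo, 'ea) category \<Rightarrow> ('so, 'sa) category \<Rightarrow> ('eo, 'ea, 'so, 'sa) geom \<Rightarrow> bool" where
  "hyperconnected E S p \<longleftrightarrow> is_connected E S p \<and> (\<forall>X\<in>Obj E. monic E (gcounit p X))"

definition is_local ::
  "('eo, 'ea) category \<Rightarrow> ('so, 'sa) category \<Rightarrow> ('eo, 'ea, 'so, 'sa) geom \<Rightarrow> bool" where
  "is_local E S p \<longleftrightarrow> (\<exists>R. left_adjoint E S (dir_im p) R \<and> fully_faithful S E R)"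

definition pressential ::
  "('eo, 'ea) category \<Rightarrow> ('so, 'sa) category \<Rightarrow> ('eo, 'ea, 'so, 'sa) geom \<Rightarrow> bool" where
  "pressential E S p \<longleftrightarrow>
     (\<exists>L. left_adjoint E S L (inv_im p) \<and> preserves_finite_products E S L)"

definition pre_cohesive ::
  "('eo, 'ea) category \<Rightarrow> ('so, 'sa) category \<Rightarrow> ('eo, 'ea, 'so, 'sa) geom \<Rightarrow> bool" where
  "pre_cohesive E S p \<longleftrightarrow> is_local E S p \<and> hyperconnected E S p \<and> pressential E S p"

text \<open>The slice category \<open>C/B\<close>. An arrow from \<open>f\<close> to \<open>g\<close> is a triple \<open>(f, h, g)\<close> with \<open>g h = f\<close>, as the
  arrow \<open>h\<close> alone does not determine \<open>f\<close> and \<open>g\<close>.\<close>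

definition slice :: "('o, 'a) category \<Rightarrow> 'o \<Rightarrow> ('a, 'a \<times> 'a \<times> 'a) category" where
  "slice C B = \<lparr>
     Obj = {f \<in> Arr C. Cod C f = B},
     Arr = {(f, h, g). f \<in> Arr C \<and> Cod C f = B \<and> g \<in> Arr C \<and> Cod C g = B \<and>
              h \<in> Hom C (Dom C f) (Dom C g) \<and> g \<cdot>\<^bsub>C\<^esub> h = f},
     Dom = \<lambda>(f, h, g). f,
     Cod = \<lambda>(f, h, g). g,
     Ide = \<lambda>f. (f, Ide C (Dom C f), f),
     Comp = \<lambda>(g, k, l) (f, h, g'). (f, k \<cdot>\<^bsub>C\<^esub> h, l)\<rparr>"

definition slice_functor ::
  "('o, 'a, 'p, 'b) functor_data \<Rightarrow> ('a, 'a \<times> 'a \<times> 'a, 'b, 'b \<times> 'b \<times> 'b) functor_data" where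
  "slice_functor F = \<lparr>fobj = farr F, farr = \<lambda>(f, h, g). (farr F f, farr F h, farr F g)\<rparr>"

text \<open>\<open>p/B\<close> is determined, up to the choice of the right adjoint, by its inverse image
  \<open>(p/B)\<^sup>* = slice_functor p\<^sup>*\<close>; such a right adjoint exists as \<open>S\<close> has pullbacks.\<close>

definition is_slice_geom ::
  "('eo, 'ea) category \<Rightarrow> ('so, 'sa) category \<Rightarrow> ('eo, 'ea, 'so, 'sa) geom \<Rightarrow> 'so
   \<Rightarrow> ('ea, 'ea \<times> 'ea \<times> 'ea, 'sa, 'sa \<times> 'sa \<times> 'sa) geom \<Rightarrow> bool" where
  "is_slice_geom E S p B q \<longleftrightarrow>
     geometric_morphism (slice E (fobj (inv_im p) B)) (slice S B) q \<and>
     inv_im q = slice_functor (inv_im p)"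

definition stably_pre_cohesive ::
  "('eo, 'ea) category \<Rightarrow> ('so, 'sa) category \<Rightarrow> ('eo, 'ea, 'so, 'sa) geom \<Rightarrow> bool" where
  "stably_pre_cohesive E S p \<longleftrightarrow>
     (\<forall>B\<in>Obj S. \<exists>q. is_slice_geom E S p B q \<and>
        pre_cohesive (slice E (fobj (inv_im p) B)) (slice S B) q)"

section \<open>Unity and identity of adjoint opposites\<close>

definition unity_and_identity ::
  "('o, 'a) category \<Rightarrow> ('p, 'b) category \<Rightarrow> ('eo, 'ea) category \<Rightarrow> ('so, 'sa) category
   \<Rightarrow> ('o, 'a, 'eo, 'ea) functor_data \<Rightarrow> ('p, 'b, 'eo, 'ea) functor_data
   \<Rightarrow> ('eo, 'ea, 'so, 'sa) functor_data \<Rightarrow> bool" where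
  "unity_and_identity A B E S a b T \<longleftrightarrow>
     is_functor A E a \<and> is_functor B E b \<and> is_functor E S T \<and>
     is_equivalence A S (T \<odot> a) \<and> is_equivalence B S (T \<odot> b)"

definition adjointly_opposite_via ::
  "('so, 'sa) category \<Rightarrow> ('eo, 'ea) category \<Rightarrow> ('so, 'sa, 'eo, 'ea) functor_data
   \<Rightarrow> ('so, 'sa, 'eo, 'ea) functor_data \<Rightarrow> ('eo, 'ea, 'so, 'sa) functor_data \<Rightarrow> bool" where
  "adjointly_opposite_via S E F G T \<longleftrightarrow>
     (left_adjoint S E F T \<and> left_adjoint E S T G) \<or>
     (left_adjoint S E G T \<and> left_adjoint E S T F)"

end

theory Submission
  imports Defs
begin

text \<open>
Write \<open>F \<stileturn> G\<close> for the inverse and direct image of \<open>p\<close>, \<open>\<beta>\<close> for its counit, and call the objects \<open>X\<close> with \<open>\<beta> X\<close>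
invertible discrete. Since \<open>\<beta>\<close> is monic, characteristic arrows on \<open>F A\<close> come from \<open>S\<close>, so every subobject of
\<open>F A\<close> is \<open>F\<close> of a subobject of \<open>A\<close>; as \<open>S\<close> is Boolean, \<open>F A\<close> is decidable. Conversely let \<open>X\<close> be decidable and
\<open>s : X \<rightarrow> F B\<close> its reflection. In \<open>E/F B\<close> the object \<open>s\<close> is connected, hence so is its square, the kernel pair
of \<open>s\<close>, because the left adjoint of the slice preserves products. The diagonal is a complemented part of it
that is not empty over \<open>B\<close>, so it is everything: \<open>s\<close> is monic and \<open>X\<close> is a subobject of a discrete object.

As \<open>s\<close> is epic and \<open>G\<close> has a right adjoint \<open>R\<close>, \<open>G X = 0\<close> implies \<open>X = 0\<close>. It follows that a monic \<open>m\<close> is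
\<open>\<not>\<not>\<close>-dense exactly when \<open>G m\<close> is invertible. So the objects \<open>R Z\<close> are \<open>\<not>\<not>\<close>-sheaves, and the unit
\<open>X \<rightarrow> R (G X)\<close> at a sheaf \<open>X\<close>, being inverted by \<open>G\<close>, is invertible.
\<close>

section \<open>Categories and limits\<close>

text \<open>The hypothesis speaks only of the slices \<open>p/B\<close>, each given by its inverse
  image and some right adjoint. Properties of \<open>p\<close> itself have to be brought back from
  \<open>p/1\<close>, where objects are arrows into \<open>F 1\<close> and the right adjoint agrees
  with \<open>G\<close> only up to isomorphism. General slices enter at one point: the kernel pair
  of \<open>s\<close> is a product over \<open>F B\<close>, not over \<open>1\<close>, so only
  \<open>p/B\<close> can show that it is connected.

  The definition of a topos provides no colimits. A strict initial object is built from exponentials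
  and the classifier, coproducts are avoided, and "empty" means that the domain of a generalized
  element is initial.

  The bridge to double negation is that the discrete part \<open>\<beta> X\<close> is the least
  dense subobject of \<open>X\<close>. It is dense because a nonempty \<open>W\<close> over
  \<open>X\<close> has a nonempty discrete part, which lands in that of \<open>X\<close>. It is
  least because a complement in the Boolean \<open>S\<close> of what a dense \<open>m\<close> covers
  in \<open>G X\<close> would give a part of \<open>X\<close> disjoint from \<open>m\<close>. By
  transposition, \<open>m\<close> contains \<open>\<beta> X\<close> exactly when \<open>G m\<close>
  is invertible.\<close>

lemma in_Hom [simp]: "f \<in> Hom C X Y \<longleftrightarrow> f \<in> Arr C \<and> Dom C f = X \<and> Cod C f = Y"
  by (simp add: Hom_def)

locale cat =
  fixes C :: "('o, 'a) category" (structure)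
  assumes cat: "is_category C"
begin

lemma dom_obj [simp]: "f \<in> Arr C \<Longrightarrow> Dom C f \<in> Obj C"
  and cod_obj [simp]: "f \<in> Arr C \<Longrightarrow> Cod C f \<in> Obj C"
  using cat unfolding is_category_def by blast+

lemma
  assumes "X \<in> Obj C"
  shows ide_arr [simp]: "Ide C X \<in> Arr C"
    and dom_ide [simp]: "Dom C (Ide C X) = X"
    and cod_ide [simp]: "Cod C (Ide C X) = X"
  using cat assms unfolding is_category_def by auto

lemma
  assumes "f \<in> Arr C" "g \<in> Arr C" "Cod C f = Dom C g"
  shows comp_arr [simp]: "g \<cdot> f \<in> Arr C"
    and dom_comp [simp]: "Dom C (g \<cdot> f) = Dom C f"
    and cod_comp [simp]: "Cod C (g \<cdot> f) = Cod C g"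
  using cat assms unfolding is_category_def by auto

lemma comp_ide_right [simp]: "f \<in> Arr C \<Longrightarrow> Dom C f = X \<Longrightarrow> f \<cdot> Ide C X = f"
  and comp_ide_left [simp]: "f \<in> Arr C \<Longrightarrow> Cod C f = X \<Longrightarrow> Ide C X \<cdot> f = f"
  using cat unfolding is_category_def by auto

lemma assoc [simp]:
  assumes "f \<in> Arr C" "g \<in> Arr C" "h \<in> Arr C" "Cod C f = Dom C g" "Cod C g = Dom C h"
  shows "(h \<cdot> g) \<cdot> f = h \<cdot> g \<cdot> f"
  using cat assms unfolding is_category_def by auto

text \<open>The simplifier nests composites to the right, so an equation
  \<open>h \<cdot> g = k\<close> no longer matches inside \<open>h \<cdot> g \<cdot> f\<close>. This
  puts the equation into the form in which it applies there.\<close>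

lemma reduce:
  assumes "h \<cdot> g = k" "g \<in> Arr C" "h \<in> Arr C" "Cod C g = Dom C h"
    and "f \<in> Arr C" "Cod C f = Dom C g"
  shows "h \<cdot> g \<cdot> f = k \<cdot> f"
  using assms assoc by metis

lemma monicI:
  assumes "m \<in> Arr C"
    and "\<And>f g. f \<in> Arr C \<Longrightarrow> g \<in> Arr C \<Longrightarrow> Dom C f = Dom C g \<Longrightarrow> Cod C f = Dom C m \<Longrightarrow>
      Cod C g = Dom C m \<Longrightarrow> m \<cdot> f = m \<cdot> g \<Longrightarrow> f = g"
  shows "monic C m"
  using assms unfolding monic_def by simp

lemma monicD:
  assumes "monic C m" "m \<cdot> f = m \<cdot> g" "f \<in> Arr C" "g \<in> Arr C" "Dom C f = Dom C g"
    "Cod C f = Dom C m" "Cod C g = Dom C m"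
  shows "f = g"
  using assms unfolding monic_def by simp

lemma monic_arr [simp]: "monic C m \<Longrightarrow> m \<in> Arr C"
  by (simp add: monic_def)

lemma monic_cancel_right:
  assumes "monic C (g \<cdot> f)" "f \<in> Arr C" "g \<in> Arr C" "Cod C f = Dom C g"
  shows "monic C f"
proof (rule monicI)
  fix h k assume *: "h \<in> Arr C" "k \<in> Arr C" "Dom C h = Dom C k" "Cod C h = Dom C f"
    "Cod C k = Dom C f" "f \<cdot> h = f \<cdot> k"
  then have "(g \<cdot> f) \<cdot> h = (g \<cdot> f) \<cdot> k" using assms by simp
  then show "h = k" using monicD[OF assms(1)] * assms by simp
qed (use assms in simp)

lemma monic_comp:
  assumes "monic C f" "monic C g" "Cod C f = Dom C g"
  shows "monic C (g \<cdot> f)"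
proof (rule monicI)
  fix h k assume "h \<in> Arr C" "k \<in> Arr C" "Dom C h = Dom C k" "Cod C h = Dom C (g \<cdot> f)"
    "Cod C k = Dom C (g \<cdot> f)" "(g \<cdot> f) \<cdot> h = (g \<cdot> f) \<cdot> k"
  then show "h = k" using assms monicD[OF assms(1), of h k] monicD[OF assms(2), of "f \<cdot> h" "f \<cdot> k"]
    by simp
qed (use assms in simp)

lemma monic_ide [simp]: "X \<in> Obj C \<Longrightarrow> monic C (Ide C X)"
  by (rule monicI) simp_all

lemma split_monic:
  assumes "g \<cdot> f = Ide C (Dom C f)" "f \<in> Arr C" "g \<in> Arr C" "Cod C f = Dom C g"
  shows "monic C f"
  using monic_cancel_right[of g f] assms by simp

lemma isomorphismI:
  assumes "f \<in> Arr C" "g \<in> Arr C" "Dom C g = Cod C f" "Cod C g = Dom C f"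
    "g \<cdot> f = Ide C (Dom C f)" "f \<cdot> g = Ide C (Cod C f)"
  shows "isomorphism C f"
  using assms unfolding isomorphism_def by auto

lemma isomorphismE:
  assumes "isomorphism C f"
  obtains g where "f \<in> Arr C" "g \<in> Arr C" "Dom C g = Cod C f" "Cod C g = Dom C f"
    "g \<cdot> f = Ide C (Dom C f)" "f \<cdot> g = Ide C (Cod C f)"
  using assms unfolding isomorphism_def by auto

text \<open>From \<open>m s m = m\<close> and monicity, a section of a monic is a two-sided inverse.
  Several isomorphisms below are obtained from a section alone in this way.\<close>

lemma monic_section_isomorphism:
  assumes "monic C m" "s \<in> Arr C" "Cod C s = Dom C m" "m \<cdot> s = Ide C (Cod C m)"
  shows "isomorphism C m" "s \<cdot> m = Ide C (Dom C m)"
proof -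
  have m [simp]: "m \<in> Arr C" using assms by simp
  have "Dom C s = Cod C m"
    using assms dom_comp[of s m] by simp
  moreover have "s \<cdot> m = Ide C (Dom C m)"
    using assms calculation reduce[OF assms(4), of m] by - (rule monicD[OF assms(1)], simp_all)
  ultimately show "isomorphism C m" "s \<cdot> m = Ide C (Dom C m)"
    using assms by (auto intro!: isomorphismI[of _ s])
qed

lemma isomorphism_monic: "isomorphism C f \<Longrightarrow> monic C f"
  by (metis isomorphismE split_monic)

lemma isomorphism_comp:
  assumes "isomorphism C f" "isomorphism C g" "Cod C f = Dom C g"
  shows "isomorphism C (g \<cdot> f)"
proof -
  obtain f' where f: "f \<in> Arr C" "f' \<in> Arr C" "Dom C f' = Cod C f" "Cod C f' = Dom C f"
    "f' \<cdot> f = Ide C (Dom C f)" "f \<cdot> f' = Ide C (Cod C f)" using assms isomorphismE by metis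
  obtain g' where g: "g \<in> Arr C" "g' \<in> Arr C" "Dom C g' = Cod C g" "Cod C g' = Dom C g"
    "g' \<cdot> g = Ide C (Dom C g)" "g \<cdot> g' = Ide C (Cod C g)" using assms isomorphismE by metis
  show ?thesis
    using f g assms(3) by (intro isomorphismI[of _ "f' \<cdot> g'"])
      (simp_all add: reduce[OF f(6)] reduce[OF g(5)])
qed

lemma sub_leI: "h \<in> Arr C \<Longrightarrow> Dom C h = Dom C m \<Longrightarrow> Cod C h = Dom C n \<Longrightarrow> n \<cdot> h = m \<Longrightarrow> sub_le C m n"
  unfolding sub_le_def by auto

lemma sub_leE:
  assumes "sub_le C m n"
  obtains h where "h \<in> Arr C" "Dom C h = Dom C m" "Cod C h = Dom C n" "n \<cdot> h = m"
  using assms unfolding sub_le_def by auto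

lemma sub_le_trans:
  assumes "sub_le C m n" "sub_le C n l" "l \<in> Arr C"
  shows "sub_le C m l"
proof -
  obtain h where h: "h \<in> Arr C" "Dom C h = Dom C m" "Cod C h = Dom C n" "n \<cdot> h = m"
    using assms sub_leE by metis
  obtain k where k: "k \<in> Arr C" "Dom C k = Dom C n" "Cod C k = Dom C l" "l \<cdot> k = n"
    using assms sub_leE by metis
  show ?thesis using h k assms(3) by (intro sub_leI[of "k \<cdot> h"]) (simp_all add: reduce[OF k(4)])
qed

lemma is_initialD:
  assumes "is_initial C Z" "f \<in> Arr C" "g \<in> Arr C" "Dom C f = Z" "Dom C g = Z" "Cod C f = Cod C g"
  shows "f = g"
  using assms unfolding is_initial_def in_Hom by (metis cod_obj)

lemma is_initial_obj: "is_initial C Z \<Longrightarrow> Z \<in> Obj C"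
  by (simp add: is_initial_def)

lemma is_initialE:
  assumes "is_initial C Z" "X \<in> Obj C"
  obtains f where "f \<in> Arr C" "Dom C f = Z" "Cod C f = X"
  using assms unfolding is_initial_def in_Hom by metis

lemma is_initialI:
  assumes "Z \<in> Obj C" "\<And>X. X \<in> Obj C \<Longrightarrow> \<exists>f\<in>Arr C. Dom C f = Z \<and> Cod C f = X"
    "\<And>f g. f \<in> Arr C \<Longrightarrow> g \<in> Arr C \<Longrightarrow> Dom C f = Z \<Longrightarrow> Dom C g = Z \<Longrightarrow> Cod C f = Cod C g \<Longrightarrow> f = g"
  shows "is_initial C Z"
  using assms unfolding is_initial_def in_Hom by metis

lemma is_productD:
  assumes "is_product C X Y P p q"
  shows "p \<in> Arr C" "q \<in> Arr C" "Dom C p = P" "Dom C q = P" "Cod C p = X" "Cod C q = Y"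
    "P \<in> Obj C" "X \<in> Obj C" "Y \<in> Obj C"
  using assms unfolding is_product_def by auto

lemma is_product_pair:
  assumes "is_product C X Y P p q" "f \<in> Arr C" "g \<in> Arr C" "Dom C f = Dom C g"
    "Cod C f = X" "Cod C g = Y"
  obtains h where "h \<in> Arr C" "Dom C h = Dom C f" "Cod C h = P" "p \<cdot> h = f" "q \<cdot> h = g"
proof -
  have "f \<in> Hom C (Dom C f) X" "g \<in> Hom C (Dom C f) Y" using assms by simp_all
  then have "\<exists>h. h \<in> Hom C (Dom C f) P \<and> p \<cdot> h = f \<and> q \<cdot> h = g"
    using assms(1) unfolding is_product_def by blast
  then show ?thesis using that by auto
qed

lemma is_product_eqI:
  assumes "is_product C X Y P p q" "h \<in> Arr C" "k \<in> Arr C" "Dom C h = Dom C k"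
    "Cod C h = P" "Cod C k = P" "p \<cdot> h = p \<cdot> k" "q \<cdot> h = q \<cdot> k"
  shows "h = k"
proof -
  have "p \<cdot> h \<in> Hom C (Dom C h) X" "q \<cdot> h \<in> Hom C (Dom C h) Y"
    using is_productD[OF assms(1)] assms by simp_all
  then have "\<exists>!l. l \<in> Hom C (Dom C h) P \<and> p \<cdot> l = p \<cdot> h \<and> q \<cdot> l = q \<cdot> h"
    using assms(1) unfolding is_product_def by blast
  then show ?thesis using assms by (metis in_Hom)
qed

lemma is_pullbackD:
  assumes "is_pullback C p q f g"
  shows "f \<in> Arr C" "g \<in> Arr C" "p \<in> Arr C" "q \<in> Arr C" "Cod C f = Cod C g" "Dom C q = Dom C p"
    "Cod C p = Dom C f" "Cod C q = Dom C g" "f \<cdot> p = g \<cdot> q"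
  using assms unfolding is_pullback_def by auto

lemma is_pullback_pair:
  assumes "is_pullback C p q f g" "a \<in> Arr C" "b \<in> Arr C" "Dom C a = Dom C b"
    "Cod C a = Dom C f" "Cod C b = Dom C g" "f \<cdot> a = g \<cdot> b"
  obtains h where "h \<in> Arr C" "Dom C h = Dom C a" "Cod C h = Dom C p" "p \<cdot> h = a" "q \<cdot> h = b"
proof -
  have "a \<in> Hom C (Dom C a) (Dom C f)" "b \<in> Hom C (Dom C a) (Dom C g)" using assms by simp_all
  moreover have "\<forall>W. \<forall>a\<in>Hom C W (Dom C f). \<forall>b\<in>Hom C W (Dom C g). f \<cdot> a = g \<cdot> b \<longrightarrow>
        (\<exists>!h. h \<in> Hom C W (Dom C p) \<and> p \<cdot> h = a \<and> q \<cdot> h = b)"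
    using assms(1) unfolding is_pullback_def by (elim conjE)
  ultimately have "\<exists>h. h \<in> Hom C (Dom C a) (Dom C p) \<and> p \<cdot> h = a \<and> q \<cdot> h = b"
    using assms(7) by blast
  then show ?thesis using that by auto
qed

lemma is_pullback_eqI:
  assumes "is_pullback C p q f g" "h \<in> Arr C" "k \<in> Arr C" "Dom C h = Dom C k"
    "Cod C h = Dom C p" "Cod C k = Dom C p" "p \<cdot> h = p \<cdot> k" "q \<cdot> h = q \<cdot> k"
  shows "h = k"
proof -
  note D = is_pullbackD[OF assms(1)]
  have "f \<cdot> (p \<cdot> h) = g \<cdot> (q \<cdot> h)"
    using D assms by (simp add: reduce[OF D(9)])
  moreover have "p \<cdot> h \<in> Hom C (Dom C h) (Dom C f)" "q \<cdot> h \<in> Hom C (Dom C h) (Dom C g)"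
    using D assms by simp_all
  moreover have "\<forall>W. \<forall>a\<in>Hom C W (Dom C f). \<forall>b\<in>Hom C W (Dom C g). f \<cdot> a = g \<cdot> b \<longrightarrow>
        (\<exists>!h. h \<in> Hom C W (Dom C p) \<and> p \<cdot> h = a \<and> q \<cdot> h = b)"
    using assms(1) unfolding is_pullback_def by (elim conjE)
  ultimately have "\<exists>!l. l \<in> Hom C (Dom C h) (Dom C p) \<and> p \<cdot> l = p \<cdot> h \<and> q \<cdot> l = q \<cdot> h"
    by blast
  then show ?thesis using assms by (metis in_Hom)
qed

lemma is_pullback_ex1I:
  assumes "f \<in> Arr C" "g \<in> Arr C" "p \<in> Arr C" "q \<in> Arr C" "Cod C f = Cod C g" "Dom C q = Dom C p"
    "Cod C p = Dom C f" "Cod C q = Dom C g" "f \<cdot> p = g \<cdot> q"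
    and *: "\<And>W a b. a \<in> Hom C W (Dom C f) \<Longrightarrow> b \<in> Hom C W (Dom C g) \<Longrightarrow> f \<cdot> a = g \<cdot> b \<Longrightarrow>
      \<exists>!h. h \<in> Hom C W (Dom C p) \<and> p \<cdot> h = a \<and> q \<cdot> h = b"
  shows "is_pullback C p q f g"
  unfolding is_pullback_def using assms(1-9)
  by (intro conjI allI ballI impI) ((rule *)?, (assumption | simp; fail)+)+

lemma is_pullbackI:
  assumes "f \<in> Arr C" "g \<in> Arr C" "p \<in> Arr C" "q \<in> Arr C" "Cod C f = Cod C g" "Dom C q = Dom C p"
    "Cod C p = Dom C f" "Cod C q = Dom C g" "f \<cdot> p = g \<cdot> q"
    and "\<And>a b. a \<in> Arr C \<Longrightarrow> b \<in> Arr C \<Longrightarrow> Dom C a = Dom C b \<Longrightarrow> Cod C a = Dom C f \<Longrightarrow>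
      Cod C b = Dom C g \<Longrightarrow> f \<cdot> a = g \<cdot> b \<Longrightarrow>
      \<exists>h\<in>Arr C. Dom C h = Dom C a \<and> Cod C h = Dom C p \<and> p \<cdot> h = a \<and> q \<cdot> h = b"
    and "\<And>h k. h \<in> Arr C \<Longrightarrow> k \<in> Arr C \<Longrightarrow> Dom C h = Dom C k \<Longrightarrow> Cod C h = Dom C p \<Longrightarrow>
      Cod C k = Dom C p \<Longrightarrow> p \<cdot> h = p \<cdot> k \<Longrightarrow> q \<cdot> h = q \<cdot> k \<Longrightarrow> h = k"
  shows "is_pullback C p q f g"
proof -
  have *: "\<exists>!h. h \<in> Hom C W (Dom C p) \<and> p \<cdot> h = a \<and> q \<cdot> h = b"
    if "a \<in> Hom C W (Dom C f)" "b \<in> Hom C W (Dom C g)" "f \<cdot> a = g \<cdot> b" for W a b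
  proof -
    have "\<exists>h\<in>Arr C. Dom C h = Dom C a \<and> Cod C h = Dom C p \<and> p \<cdot> h = a \<and> q \<cdot> h = b"
      by (rule assms(10)) (use that in simp_all)
    then obtain h where h: "h \<in> Arr C" "Dom C h = Dom C a" "Cod C h = Dom C p" "p \<cdot> h = a" "q \<cdot> h = b"
      by blast
    show ?thesis
    proof (rule ex1I[of _ h])
      show "k = h" if "k \<in> Hom C W (Dom C p) \<and> p \<cdot> k = a \<and> q \<cdot> k = b" for k
        by (rule assms(11)) (use that h \<open>a \<in> Hom C W (Dom C f)\<close> in simp_all)
    qed (use h that in simp)
  qed
  show ?thesis
    by (rule is_pullback_ex1I; (rule assms *; assumption)?)
qed

text \<open>Monicity as a pullback condition: a functor that preserves pullbacks therefore preserves
  monics.\<close>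

lemma is_pullback_ide_iff_monic:
  assumes "m \<in> Arr C"
  shows "is_pullback C (Ide C (Dom C m)) (Ide C (Dom C m)) m m \<longleftrightarrow> monic C m"
proof
  assume pb: "is_pullback C (Ide C (Dom C m)) (Ide C (Dom C m)) m m"
  show "monic C m"
  proof (rule monicI)
    fix f g assume *: "f \<in> Arr C" "g \<in> Arr C" "Dom C f = Dom C g" "Cod C f = Dom C m"
      "Cod C g = Dom C m" "m \<cdot> f = m \<cdot> g"
    obtain h where "h \<in> Arr C" "Cod C h = Dom C m" "Ide C (Dom C m) \<cdot> h = f" "Ide C (Dom C m) \<cdot> h = g"
      by (rule is_pullback_pair[OF pb, of f g]) (use * assms in simp_all)
    then show "f = g" by simp
  qed (use assms in simp)
next
  assume "monic C m"
  then show "is_pullback C (Ide C (Dom C m)) (Ide C (Dom C m)) m m"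
    using assms by - (rule is_pullbackI, simp_all, metis comp_ide_left monicD)
qed

lemma is_pullback_monic:
  assumes "is_pullback C p q f g" "monic C g"
  shows "monic C p"
proof (rule monicI)
  note D = is_pullbackD[OF assms(1)]
  fix h k assume *: "h \<in> Arr C" "k \<in> Arr C" "Dom C h = Dom C k" "Cod C h = Dom C p"
      "Cod C k = Dom C p" "p \<cdot> h = p \<cdot> k"
  have "g \<cdot> q \<cdot> h = g \<cdot> q \<cdot> k"
    using *(1-5) reduce[OF D(9), of h] reduce[OF D(9), of k] D(1-8)
    by (simp add: *(6))
  then have "q \<cdot> h = q \<cdot> k" using * D by - (rule monicD[OF assms(2)], simp_all)
  then show "h = k" using * D by - (rule is_pullback_eqI[OF assms(1)], simp_all)
qed (use is_pullbackD[OF assms(1)] in simp)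

lemma is_terminalD:
  assumes "is_terminal C T" "f \<in> Arr C" "g \<in> Arr C" "Cod C f = T" "Cod C g = T" "Dom C f = Dom C g"
  shows "f = g"
  using assms unfolding is_terminal_def in_Hom by (metis dom_obj)

lemma is_terminalE:
  assumes "is_terminal C T" "X \<in> Obj C"
  obtains f where "f \<in> Arr C" "Dom C f = X" "Cod C f = T"
  using assms unfolding is_terminal_def in_Hom by metis

text \<open>Over a terminal object every square commutes. Preservation of products by
  \<open>F\<close> thus becomes a case of preservation of pullbacks.\<close>

lemma is_product_iff_pullback:
  assumes "is_terminal C T" "f \<in> Arr C" "g \<in> Arr C" "Cod C f = T" "Cod C g = T"
    "p \<in> Arr C"
  shows "is_product C (Dom C f) (Dom C g) (Dom C p) p q \<longleftrightarrow> is_pullback C p q f g"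
proof -
  have "f \<cdot> a = g \<cdot> b" if "a \<in> Arr C" "b \<in> Arr C" "Dom C a = Dom C b" "Cod C a = Dom C f" "Cod C b = Dom C g"
    for a b
    using that assms by - (rule is_terminalD[OF assms(1)], simp_all)
  then show ?thesis
    unfolding is_product_def is_pullback_def using assms by auto
qed

end

text \<open>Arrows 0, 1, 2 are the identities, 3 and 4 the two legs. The second argument of
  \<open>Comp\<close> acts first: if it is a leg, the other factor is an identity, and otherwise it
  is itself an identity.\<close>

definition cospan :: "(nat, nat) category" where
  "cospan = \<lparr>Obj = {0, 1, 2}, Arr = {0, 1, 2, 3, 4},
     Dom = \<lambda>u. if u = 3 then 0 else if u = 4 then 1 else u,
     Cod = \<lambda>u. if u = 3 \<or> u = 4 then 2 else u,
     Ide = \<lambda>i. i, Comp = \<lambda>v u. if u = 3 \<or> u = 4 then u else v\<rparr>"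

definition cospan_diagram :: "('o, 'a) category \<Rightarrow> 'a \<Rightarrow> 'a \<Rightarrow> (nat, nat, 'o, 'a) functor_data" where
  "cospan_diagram C f g =
     \<lparr>fobj = \<lambda>i. if i = 0 then Dom C f else if i = 1 then Dom C g else Cod C f,
      farr = \<lambda>u. if u = 3 then f else if u = 4 then g else
        Ide C (if u = 0 then Dom C f else if u = 1 then Dom C g else Cod C f)\<rparr>"

lemma finite_shape_cospan: "finite_shape cospan"
  unfolding finite_shape_def is_category_def cospan_def by auto

context cat
begin

lemma is_functor_cospan_diagram:
  assumes "f \<in> Arr C" "g \<in> Arr C" "Cod C f = Cod C g"
  shows "is_functor cospan C (cospan_diagram C f g)"
  using assms unfolding is_functor_def cospan_diagram_def cospan_def by auto

lemma is_cone_cospan_iff: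
  assumes "is_functor cospan C D"
  shows "is_cone cospan C D L \<pi> \<longleftrightarrow> \<pi> 0 \<in> Hom C L (fobj D 0) \<and> \<pi> 1 \<in> Hom C L (fobj D 1) \<and>
    farr D 3 \<cdot> \<pi> 0 = farr D 4 \<cdot> \<pi> 1 \<and> \<pi> 2 = farr D 3 \<cdot> \<pi> 0"
proof -
  have "farr D 3 \<in> Hom C (fobj D 0) (fobj D 2)" "farr D 4 \<in> Hom C (fobj D 1) (fobj D 2)"
    and D: "\<forall>i\<in>{0,1,2}. fobj D i \<in> Obj C \<and> farr D i = Ide C (fobj D i)"
    using assms unfolding is_functor_def cospan_def by auto
  then show ?thesis unfolding is_cone_def cospan_def by auto
qed

lemma is_pullback_if_limit:
  assumes D: "is_functor cospan C D" and lim: "is_limit cospan C D L \<pi>"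
  shows "is_pullback C (\<pi> 0) (\<pi> 1) (farr D 3) (farr D 4)"
proof -
  have D3: "farr D 3 \<in> Hom C (fobj D 0) (fobj D 2)" "farr D 4 \<in> Hom C (fobj D 1) (fobj D 2)"
    using D unfolding is_functor_def cospan_def by auto
  have cone: "is_cone cospan C D L \<pi>" using lim unfolding is_limit_def by simp
  note c = cone[unfolded is_cone_cospan_iff[OF D]]
  have *: "\<exists>!h. h \<in> Hom C W (Dom C (\<pi> 0)) \<and> \<pi> 0 \<cdot> h = a \<and> \<pi> 1 \<cdot> h = b"
    if "a \<in> Hom C W (Dom C (farr D 3))" "b \<in> Hom C W (Dom C (farr D 4))"
      "farr D 3 \<cdot> a = farr D 4 \<cdot> b" for W a b
  proof -
    define \<mu> where "\<mu> i = (if i = 0 then a else if i = (1::nat) then b else farr D 3 \<cdot> a)" for i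
    have "is_cone cospan C D W \<mu>"
      unfolding is_cone_cospan_iff[OF D] using that D3 by (auto simp: \<mu>_def)
    then have ex: "\<exists>!h. h \<in> Hom C W L \<and> (\<forall>j\<in>Obj cospan. \<pi> j \<cdot> h = \<mu> j)"
      using lim unfolding is_limit_def by blast
    \<comment> \<open>The condition at vertex 2 follows from the one at vertex 0, so morphisms of
      cones and fillers of the square are the same arrows.\<close>
    have "(h \<in> Hom C W L \<and> (\<forall>j\<in>Obj cospan. \<pi> j \<cdot> h = \<mu> j)) \<longleftrightarrow>
      (h \<in> Hom C W (Dom C (\<pi> 0)) \<and> \<pi> 0 \<cdot> h = a \<and> \<pi> 1 \<cdot> h = b)" for h
    proof -
      have "\<pi> 2 \<cdot> h = farr D 3 \<cdot> (\<pi> 0 \<cdot> h)" if "h \<in> Hom C W L"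
      proof -
        have "\<pi> 2 = farr D 3 \<cdot> \<pi> 0" using c by blast
        then show ?thesis using assoc[of h "\<pi> 0" "farr D 3"] c D3 that by simp
      qed
      moreover have "(\<forall>j\<in>Obj cospan. \<pi> j \<cdot> h = \<mu> j) \<longleftrightarrow>
        \<pi> 0 \<cdot> h = a \<and> \<pi> 1 \<cdot> h = b \<and> \<pi> 2 \<cdot> h = farr D 3 \<cdot> a"
        by (simp add: cospan_def \<mu>_def)
      moreover have "Dom C (\<pi> 0) = L" using c by simp
      ultimately show ?thesis by metis
    qed
    then show ?thesis using ex by simp
  qed
  show ?thesis
    by (rule is_pullback_ex1I; (rule *; assumption)?) (use c D3 in simp_all)
qed

lemma is_limit_if_pullback:
  assumes pb: "is_pullback C p q f g"
  shows "is_limit cospan C (cospan_diagram C f g) (Dom C p)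
    (\<lambda>i. if i = 0 then p else if i = 1 then q else f \<cdot> p)" (is "is_limit _ _ ?D _ ?\<pi>")
proof -
  note d = is_pullbackD[OF pb]
  have D: "is_functor cospan C ?D" using is_functor_cospan_diagram d by simp
  have "\<exists>!h. h \<in> Hom C M (Dom C p) \<and> (\<forall>j\<in>Obj cospan. ?\<pi> j \<cdot> h = \<mu> j)"
    if "is_cone cospan C ?D M \<mu>" for M \<mu>
  proof -
    have \<mu>: "\<mu> 0 \<in> Hom C M (Dom C f)" "\<mu> 1 \<in> Hom C M (Dom C g)" "f \<cdot> \<mu> 0 = g \<cdot> \<mu> 1"
      "\<mu> 2 = f \<cdot> \<mu> 0"
      using that[unfolded is_cone_cospan_iff[OF D]] by (simp_all add: cospan_diagram_def)
    then have ex: "\<exists>!h. h \<in> Hom C M (Dom C p) \<and> p \<cdot> h = \<mu> 0 \<and> q \<cdot> h = \<mu> 1"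
      using pb unfolding is_pullback_def by blast
    have "(h \<in> Hom C M (Dom C p) \<and> (\<forall>j\<in>Obj cospan. ?\<pi> j \<cdot> h = \<mu> j)) \<longleftrightarrow>
       (h \<in> Hom C M (Dom C p) \<and> p \<cdot> h = \<mu> 0 \<and> q \<cdot> h = \<mu> 1)" for h
    proof -
      have "(f \<cdot> p) \<cdot> h = f \<cdot> (p \<cdot> h)" if "h \<in> Hom C M (Dom C p)"
        using d(1-8) that by simp
      moreover have "(\<forall>j\<in>Obj cospan. ?\<pi> j \<cdot> h = \<mu> j) \<longleftrightarrow>
        p \<cdot> h = \<mu> 0 \<and> q \<cdot> h = \<mu> 1 \<and> (f \<cdot> p) \<cdot> h = \<mu> 2"
        by (simp add: cospan_def)
      ultimately show ?thesis using \<mu>(4) by metis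
    qed
    then show ?thesis using ex by simp
  qed
  moreover have "is_cone cospan C ?D (Dom C p) ?\<pi>"
    unfolding is_cone_cospan_iff[OF D] using d by (auto simp: cospan_diagram_def)
  ultimately show ?thesis unfolding is_limit_def by simp
qed

lemma pullbacks_exist:
  assumes "has_finite_limits C" "f \<in> Arr C" "g \<in> Arr C" "Cod C f = Cod C g"
  obtains p q where "is_pullback C p q f g"
proof -
  obtain L \<pi> where "is_limit cospan C (cospan_diagram C f g) L \<pi>"
    using assms is_functor_cospan_diagram finite_shape_cospan unfolding has_finite_limits_def by blast
  then have "is_pullback C (\<pi> 0) (\<pi> 1) f g"
    using is_pullback_if_limit[OF is_functor_cospan_diagram] assms by (fastforce simp: cospan_diagram_def)
  then show ?thesis using that by blast
qed

end

section \<open>Subobject classifiers, initial objects and dense subobjects\<close>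

text \<open>The classifier is a parameter because \<open>elementary_topos\<close> only asserts that
  one exists, while \<open>dn_sheaf\<close> brings its own. The locale can be interpreted for any
  classifier of the same category.\<close>

locale topos = cat C
  for C :: "('o, 'a) category" (structure) +
  fixes t :: 'a
  assumes topos: "elementary_topos C"
    and classifier: "subobject_classifier C t"
begin

abbreviation one :: 'o where "one \<equiv> Dom C t"
abbreviation Om :: 'o where "Om \<equiv> Cod C t"

lemma t_arr [simp]: "t \<in> Arr C"
  using classifier by (simp add: subobject_classifier_def)

lemma one_terminal: "is_terminal C one"
  using classifier by (simp add: subobject_classifier_def)

definition bang :: "'o \<Rightarrow> 'a" where
  "bang X = (THE f. f \<in> Hom C X one)"

lemma bang_Hom: "X \<in> Obj C \<Longrightarrow> bang X \<in> Hom C X one"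
  unfolding bang_def by (rule theI') (use one_terminal in \<open>simp add: is_terminal_def\<close>)

lemma bang_arr [simp]: "X \<in> Obj C \<Longrightarrow> bang X \<in> Arr C"
  and dom_bang [simp]: "X \<in> Obj C \<Longrightarrow> Dom C (bang X) = X"
  and cod_bang [simp]: "X \<in> Obj C \<Longrightarrow> Cod C (bang X) = one"
  using bang_Hom by auto

lemma bang_unique:
  assumes "f \<in> Arr C" "Cod C f = one"
  shows "f = bang (Dom C f)"
  by (rule is_terminalD[OF one_terminal]) (use assms in simp_all)

lemma bang_comp [simp]: "f \<in> Arr C \<Longrightarrow> Cod C f = X \<Longrightarrow> bang X \<cdot> f = bang (Dom C f)"
  by (rule is_terminalD[OF one_terminal]) auto

text \<open>The constant \<open>true\<close> at \<open>X\<close>. A generalized truth value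
  \<open>w\<close> is said to hold when it equals \<open>tr (Dom C w)\<close>.\<close>

definition tr :: "'o \<Rightarrow> 'a" where
  "tr X = t \<cdot> bang X"

lemma tr_arr [simp]: "X \<in> Obj C \<Longrightarrow> tr X \<in> Arr C"
  and dom_tr [simp]: "X \<in> Obj C \<Longrightarrow> Dom C (tr X) = X"
  and cod_tr [simp]: "X \<in> Obj C \<Longrightarrow> Cod C (tr X) = Om"
  unfolding tr_def by simp_all

lemma tr_comp [simp]:
  assumes "f \<in> Arr C" "Cod C f = X"
  shows "tr X \<cdot> f = tr (Dom C f)"
proof -
  have "X \<in> Obj C" using assms by auto
  then show ?thesis unfolding tr_def using assms by simp
qed

lemma t_comp:
  assumes "u \<in> Arr C" "Cod C u = one"
  shows "t \<cdot> u = tr (Dom C u)"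
  using bang_unique[OF assms] unfolding tr_def by simp

lemma pullback_exists:
  assumes "f \<in> Arr C" "g \<in> Arr C" "Cod C f = Cod C g"
  obtains p q where "is_pullback C p q f g"
  using pullbacks_exist[OF _ assms] topos unfolding elementary_topos_def by blast

lemma product_exists:
  assumes "X \<in> Obj C" "Y \<in> Obj C"
  obtains P p q where "is_product C X Y P p q"
  using topos assms unfolding elementary_topos_def cartesian_closed_def by blast

text \<open>Obtained by pulling the diagonal of the codomain back along the pairing of
  \<open>f\<close> and \<open>g\<close>. Uniqueness of \<open>h\<close> is contained in the monicity
  of \<open>e\<close>.\<close>

lemma equalizer_exists:
  assumes f: "f \<in> Arr C" and g: "g \<in> Arr C" "Dom C f = Dom C g" "Cod C f = Cod C g"
  obtains e where "monic C e" "Cod C e = Dom C f" "f \<cdot> e = g \<cdot> e"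
    "\<And>a. a \<in> Arr C \<Longrightarrow> Cod C a = Dom C f \<Longrightarrow> f \<cdot> a = g \<cdot> a \<Longrightarrow>
      \<exists>h\<in>Arr C. Dom C h = Dom C a \<and> Cod C h = Dom C e \<and> e \<cdot> h = a"
proof -
  let ?Y = "Cod C f"
  obtain P p q where pr: "is_product C ?Y ?Y P p q"
    using product_exists[of ?Y ?Y] f by auto
  note P = is_productD[OF pr]
  obtain d where d: "d \<in> Arr C" "Dom C d = ?Y" "Cod C d = P" "p \<cdot> d = Ide C ?Y" "q \<cdot> d = Ide C ?Y"
    by (rule is_product_pair[OF pr, of "Ide C ?Y" "Ide C ?Y"]) (use f in simp_all)
  obtain h where h: "h \<in> Arr C" "Dom C h = Dom C f" "Cod C h = P" "p \<cdot> h = f" "q \<cdot> h = g"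
    by (rule is_product_pair[OF pr, of f g]) (use f g in simp_all)
  obtain e v where pb: "is_pullback C e v h d"
    using pullback_exists[of h d] d h by auto
  note D = is_pullbackD[OF pb]
  have "monic C d" using d P f by (intro split_monic[of p]) simp_all
  then have e: "monic C e" using is_pullback_monic[OF pb] by simp
  have "f \<cdot> e = v"
    using reduce[OF h(4), of e] reduce[OF d(4), of v] D h d P by simp
  moreover have "g \<cdot> e = v"
    using reduce[OF h(5), of e] reduce[OF d(5), of v] D h d P by simp
  moreover have "\<exists>k\<in>Arr C. Dom C k = Dom C a \<and> Cod C k = Dom C e \<and> e \<cdot> k = a"
    if a: "a \<in> Arr C" "Cod C a = Dom C f" "f \<cdot> a = g \<cdot> a" for a
  proof -
    have "h \<cdot> a = d \<cdot> f \<cdot> a"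
    proof (rule is_product_eqI[OF pr])
      show "p \<cdot> h \<cdot> a = p \<cdot> d \<cdot> f \<cdot> a"
        using reduce[OF h(4), of a] reduce[OF d(4), of "f \<cdot> a"] a h(1-3) d(1-3) P f g by simp
      show "q \<cdot> h \<cdot> a = q \<cdot> d \<cdot> f \<cdot> a"
        using reduce[OF h(5), of a] reduce[OF d(5), of "f \<cdot> a"] a h(1-3) d(1-3) P f g by simp
    qed (use a f g h d in simp_all)
    then obtain k where "k \<in> Arr C" "Dom C k = Dom C a" "Cod C k = Dom C e" "e \<cdot> k = a" "v \<cdot> k = f \<cdot> a"
      using is_pullback_pair[OF pb, of a "f \<cdot> a"] a h(1-3) d(1-3) f g by auto
    then show ?thesis by blast
  qed
  ultimately show ?thesis using that[of e] e D h by simp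
qed

text \<open>As \<open>m\<close> is monic, the uniqueness part of the pullback is automatic and only
  membership of generalized elements remains: \<open>\<chi>\<close> holds at \<open>a\<close>
  exactly when \<open>a\<close> factors through \<open>m\<close>. Later reasoning about \<Omega>
  uses this form.\<close>

lemma classifies_iff:
  assumes "monic C m"
  shows "classifies C t m \<chi> \<longleftrightarrow> \<chi> \<in> Hom C (Cod C m) Om \<and>
    (\<forall>a\<in>Arr C. Cod C a = Cod C m \<longrightarrow> (\<chi> \<cdot> a = tr (Dom C a) \<longleftrightarrow>
       (\<exists>h\<in>Arr C. Dom C h = Dom C a \<and> Cod C h = Dom C m \<and> m \<cdot> h = a)))" (is "_ \<longleftrightarrow> ?R")
proof
  assume "classifies C t m \<chi>"
  then obtain u where \<chi>: "\<chi> \<in> Hom C (Cod C m) Om" and pb: "is_pullback C m u \<chi> t"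
    unfolding classifies_def by blast
  note D = is_pullbackD[OF pb]
  have "\<chi> \<cdot> a = tr (Dom C a) \<longleftrightarrow> (\<exists>h\<in>Arr C. Dom C h = Dom C a \<and> Cod C h = Dom C m \<and> m \<cdot> h = a)"
    if a: "a \<in> Arr C" "Cod C a = Cod C m" for a
  proof
    assume "\<chi> \<cdot> a = tr (Dom C a)"
    then obtain h where "h \<in> Arr C" "Dom C h = Dom C a" "Cod C h = Dom C m" "m \<cdot> h = a"
      using is_pullback_pair[OF pb, of a "bang (Dom C a)"] a \<chi> unfolding tr_def by auto
    then show "\<exists>h\<in>Arr C. Dom C h = Dom C a \<and> Cod C h = Dom C m \<and> m \<cdot> h = a" by blast
  next
    assume "\<exists>h\<in>Arr C. Dom C h = Dom C a \<and> Cod C h = Dom C m \<and> m \<cdot> h = a"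
    then obtain h where h: "h \<in> Arr C" "Dom C h = Dom C a" "Cod C h = Dom C m" "m \<cdot> h = a" by blast
    have "\<chi> \<cdot> a = \<chi> \<cdot> m \<cdot> h" using h by simp
    also have "\<dots> = t \<cdot> u \<cdot> h" using reduce[OF D(9), of h] D(1-8) h by simp
    also have "\<dots> = tr (Dom C a)" using t_comp[of "u \<cdot> h"] D h by simp
    finally show "\<chi> \<cdot> a = tr (Dom C a)" .
  qed
  then show ?R using \<chi> by blast
next
  assume R: ?R
  have m: "m \<in> Arr C" using assms by simp
  have *: "\<exists>h\<in>Arr C. Dom C h = Dom C a \<and> Cod C h = Dom C m \<and> m \<cdot> h = a"
    if "a \<in> Arr C" "Cod C a = Cod C m" "\<chi> \<cdot> a = tr (Dom C a)" for a
    using R that by blast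
  have "\<chi> \<cdot> m = tr (Dom C m)"
    using R m by (metis comp_ide_right dom_obj ide_arr dom_ide cod_ide)
  then have "is_pullback C m (bang (Dom C m)) \<chi> t"
    using R m assms
    by (intro is_pullbackI) (simp_all add: tr_def, metis * bang_unique bang_comp tr_def, metis monicD)
  then show "classifies C t m \<chi>" using R unfolding classifies_def by blast
qed

text \<open>\<open>w\<close> is the characteristic arrow of the pullback of \<open>true\<close>
  along \<open>w\<close>. If \<open>w'\<close> holds at the same elements, it classifies the same
  monic, and characteristic arrows are unique.\<close>

lemma Om_ext:
  assumes "w \<in> Arr C" "w' \<in> Arr C" "Dom C w = Dom C w'" "Cod C w = Om" "Cod C w' = Om"
    and "\<And>u. u \<in> Arr C \<Longrightarrow> Cod C u = Dom C w \<Longrightarrow>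
      w \<cdot> u = tr (Dom C u) \<longleftrightarrow> w' \<cdot> u = tr (Dom C u)"
  shows "w = w'"
proof -
  obtain m v where pb: "is_pullback C m v w t"
    using pullback_exists[of w t] assms by auto
  note D = is_pullbackD[OF pb]
  have "monic C t"
    by (rule monicI) (use bang_unique in \<open>auto, metis\<close>)
  then have m: "monic C m" using is_pullback_monic[OF pb] by simp
  have cl: "classifies C t m w" unfolding classifies_def using pb D assms by auto
  moreover have "classifies C t m w'"
    using cl assms D unfolding classifies_iff[OF m] by simp
  ultimately show ?thesis using classifier m unfolding subobject_classifier_def by blast
qed

definition chi :: "'a \<Rightarrow> 'a" where
  "chi m = (THE \<chi>. classifies C t m \<chi>)"

lemma
  assumes "monic C m"
  shows classifies_chi: "classifies C t m (chi m)"
    and chi_arr [simp]: "chi m \<in> Arr C"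
    and dom_chi [simp]: "Dom C (chi m) = Cod C m"
    and cod_chi [simp]: "Cod C (chi m) = Om"
proof -
  show 1: "classifies C t m (chi m)"
    unfolding chi_def by (rule theI') (use assms classifier in \<open>simp add: subobject_classifier_def\<close>)
  show "chi m \<in> Arr C" "Dom C (chi m) = Cod C m" "Cod C (chi m) = Om"
    using 1 unfolding classifies_def by auto
qed

lemma chi_unique: "monic C m \<Longrightarrow> classifies C t m \<chi> \<Longrightarrow> \<chi> = chi m"
  using classifies_chi classifier unfolding subobject_classifier_def by blast

lemma chi_iff:
  assumes "monic C m" "a \<in> Arr C" "Cod C a = Cod C m"
  shows "chi m \<cdot> a = tr (Dom C a) \<longleftrightarrow>
    (\<exists>h\<in>Arr C. Dom C h = Dom C a \<and> Cod C h = Dom C m \<and> m \<cdot> h = a)"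
  using classifies_chi[OF assms(1)] assms unfolding classifies_iff[OF assms(1)] by blast

lemma chi_comp_self:
  assumes "monic C m" shows "chi m \<cdot> m = tr (Dom C m)"
  unfolding chi_iff[OF assms monic_arr[OF assms] refl]
  by (rule bexI[of _ "Ide C (Dom C m)"]) (use assms in simp_all)

lemma chi_eq_tr_imp_section:
  assumes "monic C m" "chi m = tr (Cod C m)"
  obtains s where "s \<in> Arr C" "Dom C s = Cod C m" "Cod C s = Dom C m" "m \<cdot> s = Ide C (Cod C m)"
proof -
  have "chi m \<cdot> Ide C (Cod C m) = tr (Dom C (Ide C (Cod C m)))" using assms by simp
  then show ?thesis using chi_iff[OF assms(1), of "Ide C (Cod C m)"] assms that by auto
qed

text \<open>\<open>Z\<close> is falsity defined impredicatively, as the statement that every truth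
  value holds: the part of \<open>1\<close> over which the identity of \<Omega> agrees with the
  constant \<open>true\<close>.\<close>

lemma degenerate_over_false_exists:
  obtains Z where "Z \<in> Obj C"
    "\<And>a w. a \<in> Arr C \<Longrightarrow> Cod C a = Z \<Longrightarrow> w \<in> Arr C \<Longrightarrow> Dom C w = Dom C a \<Longrightarrow> Cod C w = Om \<Longrightarrow>
      w = tr (Dom C a)"
proof -
  have one: "one \<in> Obj C" and Om: "Om \<in> Obj C" by simp_all
  have "\<exists>H P p q e. is_product C H Om P p q \<and> e \<in> Hom C P Om \<and>
        (\<forall>W Q r s. is_product C W Om Q r s \<longrightarrow>
           (\<forall>f\<in>Hom C Q Om. \<exists>!h. h \<in> Hom C W H \<and>
              (\<exists>k\<in>Hom C Q P. p \<cdot> k = h \<cdot> r \<and> q \<cdot> k = s \<and> e \<cdot> k = f)))"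
    using topos Om unfolding elementary_topos_def cartesian_closed_def by (elim conjE) (drule (1) bspec)+
  then obtain H P p q e where pr: "is_product C H Om P p q" and e: "e \<in> Hom C P Om"
    and exp: "\<forall>W Q r s. is_product C W Om Q r s \<longrightarrow>
           (\<forall>f\<in>Hom C Q Om. \<exists>!h. h \<in> Hom C W H \<and>
              (\<exists>k\<in>Hom C Q P. p \<cdot> k = h \<cdot> r \<and> q \<cdot> k = s \<and> e \<cdot> k = f))"
    by (elim exE conjE)
  note P = is_productD[OF pr]
  obtain Q r s where Q: "is_product C one Om Q r s"
    using product_exists[OF one Om] by blast
  note QD = is_productD[OF Q]
  \<comment> \<open>\<open>Q\<close> is \<open>1 \<times> \<Omega>\<close>, so transposing
    \<open>s\<close> and \<open>tr Q\<close> gives points \<open>n\<close> and \<open>n'\<close> of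
    the exponential that name the identity of \<Omega> and the constant \<open>true\<close>.\<close>
  have "s \<in> Hom C Q Om" "tr Q \<in> Hom C Q Om" using QD by simp_all
  then obtain n k n' k' where n: "n \<in> Hom C one H" "k \<in> Hom C Q P" "p \<cdot> k = n \<cdot> r" "q \<cdot> k = s" "e \<cdot> k = s"
    and n': "n' \<in> Hom C one H" "k' \<in> Hom C Q P" "p \<cdot> k' = n' \<cdot> r" "q \<cdot> k' = s" "e \<cdot> k' = tr Q"
    using exp[THEN spec, THEN spec, THEN spec, THEN spec, THEN mp, OF Q] by blast
  obtain z where z: "monic C z" "Cod C z = Dom C n" "n \<cdot> z = n' \<cdot> z"
    by (rule equalizer_exists[of n n']) (use n n' in auto)
  have "w = tr (Dom C a)" if a: "a \<in> Arr C" "Cod C a = Dom C z" and w: "w \<in> Arr C" "Dom C w = Dom C a" "Cod C w = Om"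
    for a w
  proof -
    \<comment> \<open>The element \<open>(z a, w)\<close> of \<open>1 \<times> \<Omega>\<close>:
      evaluating \<open>n\<close> there gives \<open>w\<close>, evaluating \<open>n'\<close> gives
      \<open>true\<close>.\<close>
    obtain g where g: "g \<in> Arr C" "Dom C g = Dom C a" "Cod C g = Q" "r \<cdot> g = z \<cdot> a" "s \<cdot> g = w"
      by (rule is_product_pair[OF Q, of "z \<cdot> a" w]) (use a w z n in simp_all)
    have "k \<cdot> g = k' \<cdot> g"
    proof (rule is_product_eqI[OF pr])
      have "p \<cdot> k \<cdot> g = n \<cdot> z \<cdot> a"
        using reduce[OF n(3), of g] n(1,2) g P QD by simp
      also have "\<dots> = n' \<cdot> z \<cdot> a"
        using reduce[OF z(3), of a] z(1,2) n(1) n'(1) a by simp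
      also have "\<dots> = p \<cdot> k' \<cdot> g"
        using reduce[OF n'(3), of g] n'(1,2) g P QD by simp
      finally show "p \<cdot> k \<cdot> g = p \<cdot> k' \<cdot> g" .
      show "q \<cdot> k \<cdot> g = q \<cdot> k' \<cdot> g"
        using reduce[OF n(4), of g] reduce[OF n'(4), of g] n(1,2) n'(1,2) g P by simp
    qed (use n n' g in simp_all)
    then have "e \<cdot> k \<cdot> g = e \<cdot> k' \<cdot> g" by simp
    then show ?thesis
      using reduce[OF n(5), of g] reduce[OF n'(5), of g] n(2) n'(2) g e by simp
  qed
  then show ?thesis using that[of "Dom C z"] z(1) by simp
qed

text \<open>All truth values over \<open>Z\<close> hold. Hence every monic whose codomain maps to
  \<open>Z\<close> has a section, and by way of equalizers parallel arrows out of an object over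
  \<open>Z\<close> agree. An arrow \<open>Z \<rightarrow> X\<close> comes from a section of the
  projection \<open>Z \<times> X \<rightarrow> Z\<close>, which is monic because such parallel
  arrows agree.\<close>

lemma strict_initial_exists:
  obtains Z where "is_initial C Z"
    "\<And>a. a \<in> Arr C \<Longrightarrow> Cod C a = Z \<Longrightarrow> is_initial C (Dom C a)"
proof -
  obtain Z where Z: "Z \<in> Obj C" and deg:
    "\<And>a w. a \<in> Arr C \<Longrightarrow> Cod C a = Z \<Longrightarrow> w \<in> Arr C \<Longrightarrow> Dom C w = Dom C a \<Longrightarrow> Cod C w = Om \<Longrightarrow>
      w = tr (Dom C a)"
    using degenerate_over_false_exists by blast
  have sect: "\<exists>s\<in>Arr C. Dom C s = Cod C m \<and> Cod C s = Dom C m \<and> m \<cdot> s = Ide C (Cod C m)"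
    if "monic C m" "a \<in> Arr C" "Dom C a = Cod C m" "Cod C a = Z" for a m
    using chi_eq_tr_imp_section[OF that(1)] deg[of a "chi m"] that by (metis chi_arr cod_chi dom_chi)
  have eq: "f = g" if a: "a \<in> Arr C" "Cod C a = Z" and fg: "f \<in> Arr C" "g \<in> Arr C" "Dom C f = Dom C a"
    "Dom C g = Dom C a" "Cod C f = Cod C g" for a f g
  proof -
    obtain e where e: "monic C e" "Cod C e = Dom C f" "f \<cdot> e = g \<cdot> e"
      by (rule equalizer_exists[of f g]) (use fg in auto)
    obtain s where s: "s \<in> Arr C" "Dom C s = Cod C e" "Cod C s = Dom C e" "e \<cdot> s = Ide C (Cod C e)"
      using sect[OF e(1), of a] a fg e by auto
    have "f \<cdot> e \<cdot> s = g \<cdot> e \<cdot> s"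
      using reduce[OF e(3), of s] e(1,2) s fg by simp
    then show ?thesis using s e fg by simp
  qed
  have initial: "is_initial C (Dom C a)" if a: "a \<in> Arr C" "Cod C a = Z" for a
  proof (rule is_initialI)
    fix X assume X: "X \<in> Obj C"
    obtain P p q where pr: "is_product C Z X P p q" using product_exists[OF Z X] by blast
    note P = is_productD[OF pr]
    have "monic C p"
      by (rule monicI) (use eq P in \<open>simp, metis comp_arr cod_comp dom_comp\<close>)
    then obtain s where "s \<in> Arr C" "Dom C s = Z" "Cod C s = P"
      using sect[of p "Ide C Z"] P by auto
    then show "\<exists>f\<in>Arr C. Dom C f = Dom C a \<and> Cod C f = X"
      using P a by (intro bexI[of _ "q \<cdot> s \<cdot> a"]) simp_all
  next
    show "f = g" if "f \<in> Arr C" "g \<in> Arr C" "Dom C f = Dom C a" "Dom C g = Dom C a" "Cod C f = Cod C g"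
      for f g using eq[OF a] that .
  qed (use a in simp)
  show ?thesis using that initial initial[of "Ide C Z"] Z by simp
qed

lemma initial_exists: obtains Z where "is_initial C Z"
  using strict_initial_exists by blast

lemma initial_strict:
  assumes "is_initial C Z" "a \<in> Arr C" "Cod C a = Z"
  shows "is_initial C (Dom C a)"
proof -
  obtain Z' where Z': "\<And>a. a \<in> Arr C \<Longrightarrow> Cod C a = Z' \<Longrightarrow> is_initial C (Dom C a)" "Z' \<in> Obj C"
    using strict_initial_exists is_initial_obj by metis
  obtain f where "f \<in> Arr C" "Dom C f = Z" "Cod C f = Z'"
    by (rule is_initialE[OF assms(1) Z'(2)])
  then show ?thesis using Z'(1)[of "f \<cdot> a"] assms by simp
qed

lemma initial_monic:
  assumes "is_initial C Z" "z \<in> Arr C" "Dom C z = Z"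
  shows "monic C z"
proof (rule monicI)
  fix f g assume *: "f \<in> Arr C" "g \<in> Arr C" "Dom C f = Dom C g" "Cod C f = Dom C z" "Cod C g = Dom C z"
  then have "is_initial C (Dom C f)" using initial_strict[OF assms(1), of f] assms by simp
  then show "f = g" by (rule is_initialD) (use * in simp_all)
qed (use assms in simp)

section \<open>Falsity, disjointness and density for the double-negation topology\<close>

definition zer :: 'a where
  "zer = (SOME z. z \<in> Arr C \<and> is_initial C (Dom C z) \<and> Cod C z = one)"

lemma zer_arr [simp]: "zer \<in> Arr C"
  and zer_initial: "is_initial C (Dom C zer)"
  and cod_zer [simp]: "Cod C zer = one"
proof -
  obtain Z where Z: "is_initial C Z" using initial_exists by blast
  obtain z where "z \<in> Arr C" "Dom C z = Z" "Cod C z = one" using Z is_initialE[of Z one] by auto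
  with Z have "\<exists>z. z \<in> Arr C \<and> is_initial C (Dom C z) \<and> Cod C z = one" by blast
  from someI_ex[OF this] show "zer \<in> Arr C" "is_initial C (Dom C zer)" "Cod C zer = one"
    unfolding zer_def by blast+
qed

lemma zer_monic [simp]: "monic C zer"
  using initial_monic[OF zer_initial] by simp

text \<open>By strictness, factoring through \<open>0 \<rightarrow> 1\<close> means having an
  initial domain. The arrow \<open>z\<close> is arbitrary because \<open>double_negation\<close>
  comes with its own choice of it.\<close>

lemma chi_initial_iff:
  assumes "is_initial C (Dom C z)" "z \<in> Arr C" "Cod C z = one" "a \<in> Arr C" "Cod C a = one"
  shows "chi z \<cdot> a = tr (Dom C a) \<longleftrightarrow> is_initial C (Dom C a)"
proof
  have z: "monic C z" using initial_monic assms by blast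
  assume "chi z \<cdot> a = tr (Dom C a)"
  then obtain h where "h \<in> Arr C" "Dom C h = Dom C a" "Cod C h = Dom C z"
    using chi_iff[OF z, of a] assms by auto
  then show "is_initial C (Dom C a)" using initial_strict[OF assms(1), of h] by simp
next
  assume "is_initial C (Dom C a)"
  then show "chi z \<cdot> a = tr (Dom C a)"
    by (rule is_initialD) (use assms initial_monic[of "Dom C z" z] in simp_all)
qed

definition fl :: "'o \<Rightarrow> 'a" where
  "fl X = chi zer \<cdot> bang X"

lemma fl_arr [simp]: "X \<in> Obj C \<Longrightarrow> fl X \<in> Arr C"
  and dom_fl [simp]: "X \<in> Obj C \<Longrightarrow> Dom C (fl X) = X"
  and cod_fl [simp]: "X \<in> Obj C \<Longrightarrow> Cod C (fl X) = Om"
  unfolding fl_def by simp_all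

lemma fl_eq_tr_iff: "X \<in> Obj C \<Longrightarrow> fl X = tr X \<longleftrightarrow> is_initial C X"
  unfolding fl_def using chi_initial_iff[OF zer_initial, of "bang X"] by simp

text \<open>Extensionality of \<Omega>: the constant \<open>false\<close> holds at \<open>u\<close>
  exactly when the domain of \<open>u\<close> is initial, and there every truth value holds, so only
  one implication is left to require.\<close>

lemma eq_fl_iff:
  assumes "w \<in> Arr C" "Dom C w = X" "Cod C w = Om"
  shows "w = fl X \<longleftrightarrow> (\<forall>u\<in>Arr C. Cod C u = X \<longrightarrow> w \<cdot> u = tr (Dom C u) \<longrightarrow> is_initial C (Dom C u))"
proof -
  have X: "X \<in> Obj C" using assms by auto
  have *: "fl X \<cdot> u = tr (Dom C u) \<longleftrightarrow> is_initial C (Dom C u)" if "u \<in> Arr C" "Cod C u = X" for u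
    using fl_eq_tr_iff[of "Dom C u"] that X unfolding fl_def by simp
  show ?thesis
  proof
    assume R: "\<forall>u\<in>Arr C. Cod C u = X \<longrightarrow> w \<cdot> u = tr (Dom C u) \<longrightarrow> is_initial C (Dom C u)"
    show "w = fl X"
    proof (rule Om_ext)
      fix u assume u: "u \<in> Arr C" "Cod C u = Dom C w"
      have "w \<cdot> u = tr (Dom C u)" if "is_initial C (Dom C u)"
        using that by (rule is_initialD) (use u assms in simp_all)
      then show "w \<cdot> u = tr (Dom C u) \<longleftrightarrow> fl X \<cdot> u = tr (Dom C u)"
        using R * u assms by blast
    qed (use assms X in simp_all)
  qed (use * in blast)
qed

text \<open>The pullback of \<open>m\<close> and \<open>n\<close> lies below both, hence below every
  subobject, in particular below \<open>0 \<rightarrow> X\<close>. Strictness makes everything that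
  maps to it initial.\<close>

lemma complement_disjoint:
  assumes "complement_of C X m n" "a \<in> Arr C" "b \<in> Arr C" "Dom C a = Dom C b"
    "Cod C a = Dom C m" "Cod C b = Dom C n" "m \<cdot> a = n \<cdot> b"
  shows "is_initial C (Dom C a)"
proof -
  have m: "monic C m" "Cod C m = X" and n: "monic C n" "Cod C n = X"
    using assms(1) unfolding complement_of_def subobject_def by auto
  obtain p q where pb: "is_pullback C p q m n" using pullback_exists[of m n] m n by auto
  note D = is_pullbackD[OF pb]
  have "monic C p" using is_pullback_monic[OF pb n(1)] .
  then have w: "subobject C X (m \<cdot> p)" using monic_comp[of p m] m D unfolding subobject_def by simp
  have "sub_le C (m \<cdot> p) m" by (rule sub_leI[of p]) (use D in simp_all)
  moreover have "sub_le C (m \<cdot> p) n" by (rule sub_leI[of q]) (use D in simp_all)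
  ultimately have least: "sub_le C (m \<cdot> p) v" if "subobject C X v" for v
    using that assms(1) w unfolding complement_of_def by blast
  obtain Z where Z: "is_initial C Z" using initial_exists by blast
  obtain z where z: "z \<in> Arr C" "Dom C z = Z" "Cod C z = X"
    by (rule is_initialE[OF Z, of X]) (use m in auto)
  have "subobject C X z" using initial_monic[OF Z] z unfolding subobject_def by simp
  then obtain h where h: "h \<in> Arr C" "Dom C h = Dom C p" "Cod C h = Z"
    using least[of z] sub_leE[of "m \<cdot> p" z] z D by auto
  obtain k where "k \<in> Arr C" "Dom C k = Dom C a" "Cod C k = Dom C p"
    using is_pullback_pair[OF pb assms(2-7)] by blast
  then show ?thesis using initial_strict[OF Z, of "h \<cdot> k"] h by simp
qed

lemma double_negation_exists: obtains j where "double_negation C t j"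
proof -
  have "monic C (chi zer)"
    by (rule monicI) (use bang_unique in \<open>auto, metis\<close>)
  then show ?thesis
    using that classifies_chi zer_initial unfolding double_negation_def in_Hom
    by (metis zer_arr cod_zer zer_monic)
qed

text \<open>Negation holds at a truth value exactly when that value is \<open>false\<close>; two
  applications to \<open>chi m\<close> say that nothing nonempty is disjoint from \<open>m\<close>.
  The right side mentions neither \<open>t\<close> nor \<open>j\<close>.\<close>

lemma dense_iff:
  assumes "double_negation C t j"
  shows "dense C t j m \<longleftrightarrow> monic C m \<and> (\<forall>a\<in>Arr C. Cod C a = Cod C m \<longrightarrow>
    (\<forall>u\<in>Arr C. \<forall>v\<in>Arr C. Cod C u = Dom C a \<longrightarrow> Cod C v = Dom C m \<longrightarrow> Dom C u = Dom C v \<longrightarrow>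
       a \<cdot> u = m \<cdot> v \<longrightarrow> is_initial C (Dom C u)) \<longrightarrow> is_initial C (Dom C a))"
proof (cases "monic C m")
  case m: True
  obtain Z z false neg where Z: "is_initial C Z" and z: "z \<in> Hom C Z one"
    and false: "classifies C t z false" and neg: "classifies C t false neg" and j: "j = neg \<cdot> neg"
    using assms unfolding double_negation_def by blast
  have z_monic: "monic C z" using initial_monic[OF Z] z by simp
  have false_chi: "false = chi z" using chi_unique[OF z_monic false] .
  then have fH: "false \<in> Arr C" "Dom C false = one" "Cod C false = Om" using z_monic z by auto
  \<comment> \<open>The arrow \<open>false\<close> of \<open>double_negation\<close> may come from
    another initial object than \<open>fl\<close>. Both hold exactly at elements with initial
    domain, so they agree.\<close>
  have false_bang: "false \<cdot> bang W = fl W" if W: "W \<in> Obj C" for W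
  proof -
    have "(false \<cdot> bang W) \<cdot> u = tr (Dom C u) \<longleftrightarrow> is_initial C (Dom C u)"
      if "u \<in> Arr C" "Cod C u = W" for u
      using chi_initial_iff[of z "bang (Dom C u)"] that Z z fH W unfolding false_chi by simp
    then show ?thesis
      using eq_fl_iff[of "false \<cdot> bang W" W] W fH by simp
  qed
  have "monic C false" by (rule monicI) (use fH bang_unique in \<open>auto, metis\<close>)
  note neg_iff = neg[unfolded classifies_iff[OF this]]
  have nH: "neg \<in> Arr C" "Dom C neg = Om" "Cod C neg = Om" using neg_iff fH by auto
  have neg_tr: "neg \<cdot> w = tr (Dom C w) \<longleftrightarrow> w = fl (Dom C w)" if w: "w \<in> Arr C" "Cod C w = Om" for w
  proof -
    have "neg \<cdot> w = tr (Dom C w) \<longleftrightarrow> (\<exists>h\<in>Arr C. Dom C h = Dom C w \<and> Cod C h = one \<and> false \<cdot> h = w)"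
      using neg_iff w fH by simp
    also have "\<dots> \<longleftrightarrow> false \<cdot> bang (Dom C w) = w"
      using w bang_unique by (metis bang_arr cod_bang dom_bang dom_obj)
    finally show ?thesis using false_bang[of "Dom C w"] w by auto
  qed
  let ?\<chi> = "chi m" and ?X = "Cod C m"
  have X: "?X \<in> Obj C" using m by simp
  have "dense C t j m \<longleftrightarrow> classifies C t (Ide C ?X) (j \<cdot> ?\<chi>)"
  proof -
    have "classifies C t m \<chi> \<longleftrightarrow> \<chi> = ?\<chi>" for \<chi>
      using chi_unique[OF m] classifies_chi[OF m] by blast
    then show ?thesis unfolding dense_def is_closure_def using m X by simp
  qed
  also have "\<dots> \<longleftrightarrow> j \<cdot> ?\<chi> = tr ?X"
  proof
    assume "classifies C t (Ide C ?X) (j \<cdot> ?\<chi>)"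
    then have "j \<cdot> ?\<chi> = chi (Ide C ?X)" using chi_unique[of "Ide C ?X"] X by simp
    moreover have "chi (Ide C ?X) = tr ?X" using chi_comp_self[of "Ide C ?X"] X by simp
    ultimately show "j \<cdot> ?\<chi> = tr ?X" by simp
  next
    assume *: "j \<cdot> ?\<chi> = tr ?X"
    have "chi (Ide C ?X) = tr ?X" using chi_comp_self[of "Ide C ?X"] X by simp
    then show "classifies C t (Ide C ?X) (j \<cdot> ?\<chi>)"
      unfolding * using classifies_chi[of "Ide C ?X"] X by simp
  qed
  also have "\<dots> \<longleftrightarrow> neg \<cdot> ?\<chi> = fl ?X"
    using neg_tr[of "neg \<cdot> ?\<chi>"] nH m unfolding j by simp
  also have "\<dots> \<longleftrightarrow> (\<forall>a\<in>Arr C. Cod C a = ?X \<longrightarrow> ?\<chi> \<cdot> a = fl (Dom C a) \<longrightarrow> is_initial C (Dom C a))"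
  proof -
    have "(neg \<cdot> ?\<chi>) \<cdot> a = tr (Dom C a) \<longleftrightarrow> ?\<chi> \<cdot> a = fl (Dom C a)" if "a \<in> Arr C" "Cod C a = ?X" for a
      using neg_tr[of "?\<chi> \<cdot> a"] nH m that by simp
    then show ?thesis using eq_fl_iff[of "neg \<cdot> ?\<chi>" ?X] nH m by auto
  qed
  also have "\<dots> \<longleftrightarrow> (\<forall>a\<in>Arr C. Cod C a = ?X \<longrightarrow>
    (\<forall>u\<in>Arr C. \<forall>v\<in>Arr C. Cod C u = Dom C a \<longrightarrow> Cod C v = Dom C m \<longrightarrow> Dom C u = Dom C v \<longrightarrow>
       a \<cdot> u = m \<cdot> v \<longrightarrow> is_initial C (Dom C u)) \<longrightarrow> is_initial C (Dom C a))"
  proof -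
    have "?\<chi> \<cdot> a = fl (Dom C a) \<longleftrightarrow>
      (\<forall>u\<in>Arr C. \<forall>v\<in>Arr C. Cod C u = Dom C a \<longrightarrow> Cod C v = Dom C m \<longrightarrow> Dom C u = Dom C v \<longrightarrow>
         a \<cdot> u = m \<cdot> v \<longrightarrow> is_initial C (Dom C u))" if a: "a \<in> Arr C" "Cod C a = ?X" for a
    proof -
      have "?\<chi> \<cdot> a = fl (Dom C a) \<longleftrightarrow>
        (\<forall>u\<in>Arr C. Cod C u = Dom C a \<longrightarrow> ?\<chi> \<cdot> a \<cdot> u = tr (Dom C u) \<longrightarrow> is_initial C (Dom C u))"
        using eq_fl_iff[of "?\<chi> \<cdot> a" "Dom C a"] a m by simp
      moreover have "?\<chi> \<cdot> a \<cdot> u = tr (Dom C u) \<longleftrightarrow>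
        (\<exists>v\<in>Arr C. Dom C v = Dom C u \<and> Cod C v = Dom C m \<and> m \<cdot> v = a \<cdot> u)"
        if "u \<in> Arr C" "Cod C u = Dom C a" for u
        using chi_iff[OF m, of "a \<cdot> u"] a that by simp
      ultimately show ?thesis by metis
    qed
    then show ?thesis by simp
  qed
  finally show ?thesis using m by simp
qed (simp add: dense_def is_closure_def)

end

section \<open>Adjunctions\<close>

locale func = C: cat C + D: cat D
  for C :: "('o, 'a) category" and D :: "('p, 'b) category" +
  fixes F :: "('o, 'a, 'p, 'b) functor_data"
  assumes is_functor: "is_functor C D F"
begin

lemma fobj_obj [simp]: "X \<in> Obj C \<Longrightarrow> fobj F X \<in> Obj D"
  using is_functor by (simp add: is_functor_def)

lemma
  assumes "f \<in> Arr C"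
  shows farr_arr [simp]: "farr F f \<in> Arr D"
    and dom_farr [simp]: "Dom D (farr F f) = fobj F (Dom C f)"
    and cod_farr [simp]: "Cod D (farr F f) = fobj F (Cod C f)"
  using is_functor assms by (simp_all add: is_functor_def)

lemma farr_ide [simp]: "X \<in> Obj C \<Longrightarrow> farr F (Ide C X) = Ide D (fobj F X)"
  using is_functor by (simp add: is_functor_def)

lemma farr_comp [simp]:
  "f \<in> Arr C \<Longrightarrow> g \<in> Arr C \<Longrightarrow> Cod C f = Dom C g \<Longrightarrow>
    farr F (g \<cdot>\<^bsub>C\<^esub> f) = farr F g \<cdot>\<^bsub>D\<^esub> farr F f"
  using is_functor by (simp add: is_functor_def)

lemma farr_eq:
  assumes "g \<cdot>\<^bsub>C\<^esub> f = k" "f \<in> Arr C" "g \<in> Arr C" "Cod C f = Dom C g"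
  shows "farr F g \<cdot>\<^bsub>D\<^esub> farr F f = farr F k"
  using assms farr_comp by metis

lemma farr_isomorphism:
  assumes "isomorphism C f" shows "isomorphism D (farr F f)"
proof -
  obtain g where g: "f \<in> Arr C" "g \<in> Arr C" "Dom C g = Cod C f" "Cod C g = Dom C f"
    "g \<cdot>\<^bsub>C\<^esub> f = Ide C (Dom C f)" "f \<cdot>\<^bsub>C\<^esub> g = Ide C (Cod C f)"
    using assms C.isomorphismE by metis
  show ?thesis
    by (rule D.isomorphismI[of _ "farr F g"]) (use g farr_eq[OF g(5)] farr_eq[OF g(6)] in simp_all)
qed

end

locale adj = F: func C D F + G: func D C G
  for C :: "('o, 'a) category" and D :: "('p, 'b) category"
    and F :: "('o, 'a, 'p, 'b) functor_data" and G :: "('p, 'b, 'o, 'a) functor_data" +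
  fixes \<eta> :: "'o \<Rightarrow> 'a" and \<epsilon> :: "'p \<Rightarrow> 'b"
  assumes adjunction: "adjunction C D F G \<eta> \<epsilon>"
begin

lemma
  assumes "X \<in> Obj C"
  shows unit_arr [simp]: "\<eta> X \<in> Arr C"
    and dom_unit [simp]: "Dom C (\<eta> X) = X"
    and cod_unit [simp]: "Cod C (\<eta> X) = fobj G (fobj F X)"
    and triangle_F: "\<epsilon> (fobj F X) \<cdot>\<^bsub>D\<^esub> farr F (\<eta> X) = Ide D (fobj F X)"
  using adjunction assms unfolding adjunction_def nat_trans_def id_functor_def comp_functor_def by auto

lemma
  assumes "Y \<in> Obj D"
  shows counit_arr [simp]: "\<epsilon> Y \<in> Arr D"
    and dom_counit [simp]: "Dom D (\<epsilon> Y) = fobj F (fobj G Y)"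
    and cod_counit [simp]: "Cod D (\<epsilon> Y) = Y"
    and triangle_G: "farr G (\<epsilon> Y) \<cdot>\<^bsub>C\<^esub> \<eta> (fobj G Y) = Ide C (fobj G Y)"
  using adjunction assms unfolding adjunction_def nat_trans_def id_functor_def comp_functor_def by auto

lemma unit_natural: "f \<in> Arr C \<Longrightarrow> farr G (farr F f) \<cdot>\<^bsub>C\<^esub> \<eta> (Dom C f) = \<eta> (Cod C f) \<cdot>\<^bsub>C\<^esub> f"
  using adjunction unfolding adjunction_def nat_trans_def id_functor_def comp_functor_def by simp

lemma counit_natural: "g \<in> Arr D \<Longrightarrow> g \<cdot>\<^bsub>D\<^esub> \<epsilon> (Dom D g) = \<epsilon> (Cod D g) \<cdot>\<^bsub>D\<^esub> farr F (farr G g)"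
  using adjunction unfolding adjunction_def nat_trans_def id_functor_def comp_functor_def by simp

lemma counit_universal_ex:
  assumes "X \<in> Obj C" "g \<in> Arr D" "Dom D g = fobj F X" "Cod D g = Y"
  obtains f where "f \<in> Arr C" "Dom C f = X" "Cod C f = fobj G Y" "\<epsilon> Y \<cdot>\<^bsub>D\<^esub> farr F f = g"
proof
  let ?f = "farr G g \<cdot>\<^bsub>C\<^esub> \<eta> X"
  show "?f \<in> Arr C" "Dom C ?f = X" "Cod C ?f = fobj G Y" using assms by simp_all
  have "\<epsilon> Y \<cdot>\<^bsub>D\<^esub> farr F ?f = (\<epsilon> (Cod D g) \<cdot>\<^bsub>D\<^esub> farr F (farr G g)) \<cdot>\<^bsub>D\<^esub> farr F (\<eta> X)"
    using assms by auto
  also have "\<dots> = g \<cdot>\<^bsub>D\<^esub> \<epsilon> (fobj F X) \<cdot>\<^bsub>D\<^esub> farr F (\<eta> X)"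
    unfolding counit_natural[OF assms(2), symmetric] using assms by simp
  also have "\<dots> = g" using triangle_F[OF assms(1)] assms by simp
  finally show "\<epsilon> Y \<cdot>\<^bsub>D\<^esub> farr F ?f = g" .
qed

lemma counit_transpose:
  assumes "f \<in> Arr C" "Cod C f = fobj G Y" "Y \<in> Obj D"
  shows "farr G (\<epsilon> Y \<cdot>\<^bsub>D\<^esub> farr F f) \<cdot>\<^bsub>C\<^esub> \<eta> (Dom C f) = f"
proof -
  have "farr G (\<epsilon> Y \<cdot>\<^bsub>D\<^esub> farr F f) \<cdot>\<^bsub>C\<^esub> \<eta> (Dom C f) = farr G (\<epsilon> Y) \<cdot>\<^bsub>C\<^esub> \<eta> (fobj G Y) \<cdot>\<^bsub>C\<^esub> f"
    using assms unit_natural[OF assms(1)] by simp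
  also have "\<dots> = f" using F.C.reduce[OF triangle_G[OF assms(3)], of f] assms by simp
  finally show ?thesis .
qed

lemma counit_universal_eq:
  assumes "f \<in> Arr C" "g \<in> Arr C" "Dom C f = Dom C g" "Cod C f = fobj G Y" "Cod C g = fobj G Y"
    "Y \<in> Obj D" "\<epsilon> Y \<cdot>\<^bsub>D\<^esub> farr F f = \<epsilon> Y \<cdot>\<^bsub>D\<^esub> farr F g"
  shows "f = g"
  using counit_transpose[of f Y] counit_transpose[of g Y] assms by metis

lemma unit_transpose:
  assumes "g \<in> Arr D" "Dom D g = fobj F X" "X \<in> Obj C"
  shows "\<epsilon> (Cod D g) \<cdot>\<^bsub>D\<^esub> farr F (farr G g \<cdot>\<^bsub>C\<^esub> \<eta> X) = g"
proof -
  have "\<epsilon> (Cod D g) \<cdot>\<^bsub>D\<^esub> farr F (farr G g \<cdot>\<^bsub>C\<^esub> \<eta> X)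
    = (\<epsilon> (Cod D g) \<cdot>\<^bsub>D\<^esub> farr F (farr G g)) \<cdot>\<^bsub>D\<^esub> farr F (\<eta> X)"
    using assms by simp
  also have "\<dots> = g \<cdot>\<^bsub>D\<^esub> \<epsilon> (fobj F X) \<cdot>\<^bsub>D\<^esub> farr F (\<eta> X)"
    unfolding counit_natural[OF assms(1), symmetric] using assms by simp
  also have "\<dots> = g" using triangle_F[OF assms(3)] assms by simp
  finally show ?thesis .
qed

lemma unit_universal_eq:
  assumes "f \<in> Arr D" "g \<in> Arr D" "Dom D f = fobj F X" "Dom D g = fobj F X" "Cod D f = Cod D g"
    "X \<in> Obj C" "farr G f \<cdot>\<^bsub>C\<^esub> \<eta> X = farr G g \<cdot>\<^bsub>C\<^esub> \<eta> X"
  shows "f = g"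
  using unit_transpose[of f X] unit_transpose[of g X] assms by metis

lemma G_monic:
  assumes "monic D m" shows "monic C (farr G m)"
proof (rule F.C.monicI)
  have m: "m \<in> Arr D" using assms by simp
  fix f g assume *: "f \<in> Arr C" "g \<in> Arr C" "Dom C f = Dom C g" "Cod C f = Dom C (farr G m)"
    "Cod C g = Dom C (farr G m)" "farr G m \<cdot>\<^bsub>C\<^esub> f = farr G m \<cdot>\<^bsub>C\<^esub> g"
  have eq: "m \<cdot>\<^bsub>D\<^esub> \<epsilon> (Dom D m) \<cdot>\<^bsub>D\<^esub> farr F h = \<epsilon> (Cod D m) \<cdot>\<^bsub>D\<^esub> farr F (farr G m \<cdot>\<^bsub>C\<^esub> h)"
    if "h \<in> Arr C" "Cod C h = fobj G (Dom D m)" for h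
    using F.D.reduce[OF counit_natural[OF m], of "farr F h"] m that by simp
  have "m \<cdot>\<^bsub>D\<^esub> \<epsilon> (Dom D m) \<cdot>\<^bsub>D\<^esub> farr F f = m \<cdot>\<^bsub>D\<^esub> \<epsilon> (Dom D m) \<cdot>\<^bsub>D\<^esub> farr F g"
    using eq[of f] eq[of g] * m by simp
  then have "\<epsilon> (Dom D m) \<cdot>\<^bsub>D\<^esub> farr F f = \<epsilon> (Dom D m) \<cdot>\<^bsub>D\<^esub> farr F g"
    by (rule F.D.monicD[OF assms]) (use * m in simp_all)
  then show "f = g" by (rule counit_universal_eq[rotated -1]) (use * m in simp_all)
qed (use assms in simp)

lemma F_initial:
  assumes "is_initial C Z" shows "is_initial D (fobj F Z)"
proof (rule F.D.is_initialI)
  have Z: "Z \<in> Obj C" using assms by (rule F.C.is_initial_obj)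
  then show "fobj F Z \<in> Obj D" by simp
  fix Y assume Y: "Y \<in> Obj D"
  obtain f where "f \<in> Arr C" "Dom C f = Z" "Cod C f = fobj G Y"
    by (rule F.C.is_initialE[OF assms, of "fobj G Y"]) (use Y in simp)
  then show "\<exists>f\<in>Arr D. Dom D f = fobj F Z \<and> Cod D f = Y"
    using Y by (intro bexI[of _ "\<epsilon> Y \<cdot>\<^bsub>D\<^esub> farr F f"]) simp_all
next
  have Z: "Z \<in> Obj C" using assms by (rule F.C.is_initial_obj)
  fix f g assume *: "f \<in> Arr D" "g \<in> Arr D" "Dom D f = fobj F Z" "Dom D g = fobj F Z" "Cod D f = Cod D g"
  have "farr G f \<cdot>\<^bsub>C\<^esub> \<eta> Z = farr G g \<cdot>\<^bsub>C\<^esub> \<eta> Z"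
    by (rule F.C.is_initialD[OF assms]) (use * Z in simp_all)
  then show "f = g" by (rule unit_universal_eq[rotated -1]) (use * Z in simp_all)
qed

lemma fully_faithful_right_adjoint:
  assumes "\<And>Y. Y \<in> Obj D \<Longrightarrow> isomorphism D (\<epsilon> Y)"
  shows "fully_faithful D C G"
proof -
  have "bij_betw (farr G) (Hom D X Y) (Hom C (fobj G X) (fobj G Y))" if XY: "X \<in> Obj D" "Y \<in> Obj D" for X Y
  proof -
    obtain s where s: "s \<in> Arr D" "Dom D s = X" "Cod D s = fobj F (fobj G X)"
      "s \<cdot>\<^bsub>D\<^esub> \<epsilon> X = Ide D (fobj F (fobj G X))" "\<epsilon> X \<cdot>\<^bsub>D\<^esub> s = Ide D X"
      by (rule F.D.isomorphismE[OF assms[OF XY(1)]]) (use XY in simp)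
    have "inj_on (farr G) (Hom D X Y)"
    proof (rule inj_onI)
      fix f g assume f: "f \<in> Hom D X Y" and g: "g \<in> Hom D X Y" and eq: "farr G f = farr G g"
      have "f \<cdot>\<^bsub>D\<^esub> \<epsilon> X = g \<cdot>\<^bsub>D\<^esub> \<epsilon> X"
        using counit_natural[of f] counit_natural[of g] f g eq by simp
      then have "(f \<cdot>\<^bsub>D\<^esub> \<epsilon> X) \<cdot>\<^bsub>D\<^esub> s = (g \<cdot>\<^bsub>D\<^esub> \<epsilon> X) \<cdot>\<^bsub>D\<^esub> s" by simp
      then show "f = g" using f g s XY by simp
    qed
    moreover have "h \<in> farr G ` Hom D X Y" if h: "h \<in> Hom C (fobj G X) (fobj G Y)" for h
    proof
      \<comment> \<open>The preimage of \<open>h\<close> is its transpose, moved to \<open>X\<close>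
        along the inverse \<open>s\<close> of the counit.\<close>
      let ?f = "\<epsilon> Y \<cdot>\<^bsub>D\<^esub> farr F h \<cdot>\<^bsub>D\<^esub> s"
      show "?f \<in> Hom D X Y" using h s XY by simp
      show "h = farr G ?f"
      proof (rule counit_universal_eq)
        have "\<epsilon> Y \<cdot>\<^bsub>D\<^esub> farr F (farr G ?f) = ?f \<cdot>\<^bsub>D\<^esub> \<epsilon> X"
          using counit_natural[of ?f] h s(1-3) XY by simp
        also have "\<dots> = \<epsilon> Y \<cdot>\<^bsub>D\<^esub> farr F h" using h s XY by simp
        finally show "\<epsilon> Y \<cdot>\<^bsub>D\<^esub> farr F h = \<epsilon> Y \<cdot>\<^bsub>D\<^esub> farr F (farr G ?f)" by simp
      qed (use h s XY in simp_all)
    qed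
    moreover have "farr G ` Hom D X Y \<subseteq> Hom C (fobj G X) (fobj G Y)" using XY by auto
    ultimately show ?thesis unfolding bij_betw_def by blast
  qed
  then show ?thesis unfolding fully_faithful_def using G.is_functor by blast
qed

text \<open>The inverse is the arrow \<open>s\<close> with \<open>F s = \<epsilon> (F X)\<close>,
  which exists by fullness. The triangle identity gives one equation by faithfulness and the other
  by universality of the counit.\<close>

lemma unit_isomorphism:
  assumes ff: "fully_faithful C D F" and X: "X \<in> Obj C"
  shows "isomorphism C (\<eta> X)"
proof -
  let ?Y = "fobj F X"
  have bij: "bij_betw (farr F) (Hom C Z X) (Hom D (fobj F Z) ?Y)" if "Z \<in> Obj C" for Z
    using ff X that unfolding fully_faithful_def by blast
  have "\<epsilon> ?Y \<in> Hom D (fobj F (fobj G ?Y)) ?Y" using X by simp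
  then obtain s where s: "s \<in> Hom C (fobj G ?Y) X" "farr F s = \<epsilon> ?Y"
    using bij[of "fobj G ?Y"] X unfolding bij_betw_def by (metis (no_types, lifting) G.fobj_obj F.fobj_obj imageE)
  show ?thesis
  proof (rule F.C.isomorphismI[of _ s])
    have "farr F (s \<cdot>\<^bsub>C\<^esub> \<eta> X) = farr F (Ide C X)"
      using s triangle_F[OF X] X by simp
    moreover have "s \<cdot>\<^bsub>C\<^esub> \<eta> X \<in> Hom C X X" "Ide C X \<in> Hom C X X" using s X by simp_all
    ultimately show "s \<cdot>\<^bsub>C\<^esub> \<eta> X = Ide C (Dom C (\<eta> X))"
      using bij[OF X] X unfolding bij_betw_def by (metis dom_unit inj_onD)
    then have r: "\<eta> X \<cdot>\<^bsub>C\<^esub> s \<cdot>\<^bsub>C\<^esub> \<eta> X = \<eta> X" using X s by simp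
    show "\<eta> X \<cdot>\<^bsub>C\<^esub> s = Ide C (Cod C (\<eta> X))"
    proof (rule counit_universal_eq)
      show "\<epsilon> ?Y \<cdot>\<^bsub>D\<^esub> farr F (\<eta> X \<cdot>\<^bsub>C\<^esub> s) = \<epsilon> ?Y \<cdot>\<^bsub>D\<^esub> farr F (Ide C (Cod C (\<eta> X)))"
        using F.D.reduce[OF triangle_F[OF X], of "farr F s"] s X by simp
    qed (use s X in simp_all)
  qed (use s X in simp_all)
qed

text \<open>The counit at \<open>F X\<close> is left inverse to \<open>F (\<eta> X)\<close>, which
  is invertible.\<close>

lemma counit_isomorphism_at_image:
  assumes "fully_faithful C D F" "X \<in> Obj C"
  shows "isomorphism D (\<epsilon> (fobj F X))"
proof -
  let ?Y = "fobj F X"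
  have i: "isomorphism D (farr F (\<eta> X))"
    using F.farr_isomorphism unit_isomorphism assms by blast
  obtain s where s: "s \<in> Arr D" "Dom D s = fobj F (fobj G ?Y)" "Cod D s = ?Y"
    "s \<cdot>\<^bsub>D\<^esub> farr F (\<eta> X) = Ide D ?Y" "farr F (\<eta> X) \<cdot>\<^bsub>D\<^esub> s = Ide D (fobj F (fobj G ?Y))"
    by (rule F.D.isomorphismE[OF i]) (use assms in simp)
  have "\<epsilon> ?Y = s"
    using F.D.reduce[OF triangle_F[OF assms(2)], of s] s assms(2) by simp
  then show ?thesis
    using s triangle_F[OF assms(2)] assms(2) by (intro F.D.isomorphismI[of _ "farr F (\<eta> X)"]) simp_all
qed

end

lemma adjI:
  assumes "is_category C" "is_category D" "adjunction C D F G \<eta> \<epsilon>"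
  shows "adj C D F G \<eta> \<epsilon>"
  using assms unfolding adj_def adj_axioms_def func_def func_axioms_def cat_def adjunction_def by simp

text \<open>A universal arrow from \<open>F\<close> to \<open>Y\<close>, that is, the value at
  \<open>Y\<close> of a right adjoint with its counit. In this form a right adjoint can be given
  object by object, without an action on arrows.\<close>

definition couniversal ::
  "('o, 'a) category \<Rightarrow> ('p, 'b) category \<Rightarrow> ('o, 'a, 'p, 'b) functor_data \<Rightarrow> 'p \<Rightarrow> 'o \<Rightarrow> 'b \<Rightarrow> bool" where
  "couniversal C D F Y R e \<longleftrightarrow> R \<in> Obj C \<and> e \<in> Hom D (fobj F R) Y \<and>
     (\<forall>X\<in>Obj C. \<forall>g\<in>Hom D (fobj F X) Y. \<exists>!f. f \<in> Hom C X R \<and> e \<cdot>\<^bsub>D\<^esub> farr F f = g)"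

context func
begin

lemma couniversalD:
  assumes "couniversal C D F Y R e"
  shows "R \<in> Obj C" "e \<in> Arr D" "Dom D e = fobj F R" "Cod D e = Y" "Y \<in> Obj D"
  using assms unfolding couniversal_def by auto

lemma couniversal_ex:
  assumes "couniversal C D F Y R e" "X \<in> Obj C" "g \<in> Arr D" "Dom D g = fobj F X" "Cod D g = Y"
  shows "\<exists>f. f \<in> Hom C X R \<and> e \<cdot>\<^bsub>D\<^esub> farr F f = g"
proof -
  have "g \<in> Hom D (fobj F X) Y" using assms by simp
  then show ?thesis using assms(1,2) unfolding couniversal_def by blast
qed

lemma couniversal_eq:
  assumes "couniversal C D F Y R e" "f \<in> Arr C" "f' \<in> Arr C" "Dom C f = Dom C f'"
    "Cod C f = R" "Cod C f' = R" "e \<cdot>\<^bsub>D\<^esub> farr F f = e \<cdot>\<^bsub>D\<^esub> farr F f'"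
  shows "f = f'"
proof -
  have "Dom C f \<in> Obj C" "e \<cdot>\<^bsub>D\<^esub> farr F f \<in> Hom D (fobj F (Dom C f)) Y"
    using assms couniversalD[OF assms(1)] by simp_all
  then have "\<exists>!k. k \<in> Hom C (Dom C f) R \<and> e \<cdot>\<^bsub>D\<^esub> farr F k = e \<cdot>\<^bsub>D\<^esub> farr F f"
    using assms(1) unfolding couniversal_def by blast
  then show ?thesis using assms by (metis in_Hom)
qed

lemma right_adjoint_exists:
  assumes "\<And>Y. Y \<in> Obj D \<Longrightarrow> \<exists>R e. couniversal C D F Y R e"
  shows "\<exists>G. left_adjoint C D F G"
proof -
  define u where "u Y = (SOME u. couniversal C D F Y (fst u) (snd u))" for Y
  define R where "R Y = fst (u Y)" for Y
  define e where "e Y = snd (u Y)" for Y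
  have cu: "couniversal C D F Y (R Y) (e Y)" if Y: "Y \<in> Obj D" for Y
  proof -
    obtain R' e' where "couniversal C D F Y R' e'" using assms[OF Y] by blast
    then have "\<exists>u. couniversal C D F Y (fst u) (snd u)" by (metis fst_conv snd_conv)
    then show ?thesis unfolding R_def e_def u_def by (rule someI_ex)
  qed
  note RD [simp] = couniversalD[OF cu]
  define Ga where "Ga g = (SOME f. f \<in> Hom C (R (Dom D g)) (R (Cod D g)) \<and>
      e (Cod D g) \<cdot>\<^bsub>D\<^esub> farr F f = g \<cdot>\<^bsub>D\<^esub> e (Dom D g))" for g
  define \<eta> where "\<eta> X = (SOME f. f \<in> Hom C X (R (fobj F X)) \<and>
      e (fobj F X) \<cdot>\<^bsub>D\<^esub> farr F f = Ide D (fobj F X))" for X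
  have Ga: "Ga g \<in> Hom C (R (Dom D g)) (R (Cod D g))"
    "e (Cod D g) \<cdot>\<^bsub>D\<^esub> farr F (Ga g) = g \<cdot>\<^bsub>D\<^esub> e (Dom D g)" if g: "g \<in> Arr D" for g
  proof -
    have "\<exists>f. f \<in> Hom C (R (Dom D g)) (R (Cod D g)) \<and> e (Cod D g) \<cdot>\<^bsub>D\<^esub> farr F f = g \<cdot>\<^bsub>D\<^esub> e (Dom D g)"
      by (rule couniversal_ex[OF cu]) (use g in simp_all)
    from someI_ex[OF this] show "Ga g \<in> Hom C (R (Dom D g)) (R (Cod D g))"
      "e (Cod D g) \<cdot>\<^bsub>D\<^esub> farr F (Ga g) = g \<cdot>\<^bsub>D\<^esub> e (Dom D g)"
      unfolding Ga_def by blast+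
  qed
  have [simp]: "Ga g \<in> Arr C" "Dom C (Ga g) = R (Dom D g)" "Cod C (Ga g) = R (Cod D g)"
    if "g \<in> Arr D" for g using Ga(1)[OF that] by simp_all
  have \<eta>: "\<eta> X \<in> Hom C X (R (fobj F X))" "e (fobj F X) \<cdot>\<^bsub>D\<^esub> farr F (\<eta> X) = Ide D (fobj F X)"
    if X: "X \<in> Obj C" for X
  proof -
    have "\<exists>f. f \<in> Hom C X (R (fobj F X)) \<and> e (fobj F X) \<cdot>\<^bsub>D\<^esub> farr F f = Ide D (fobj F X)"
      by (rule couniversal_ex[OF cu]) (use X in simp_all)
    from someI_ex[OF this] show "\<eta> X \<in> Hom C X (R (fobj F X))"
      "e (fobj F X) \<cdot>\<^bsub>D\<^esub> farr F (\<eta> X) = Ide D (fobj F X)"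
      unfolding \<eta>_def by blast+
  qed
  have [simp]: "\<eta> X \<in> Arr C" "Dom C (\<eta> X) = X" "Cod C (\<eta> X) = R (fobj F X)"
    if "X \<in> Obj C" for X using \<eta>(1)[OF that] by simp_all
  define G where "G = \<lparr>fobj = R, farr = Ga\<rparr>"
  have "is_functor D C G"
  proof -
    have "Ga (Ide D Y) = Ide C (R Y)" if "Y \<in> Obj D" for Y
      by (rule couniversal_eq[OF cu[OF that]]) (use that Ga(2)[of "Ide D Y"] in simp_all)
    moreover have "Ga (g \<cdot>\<^bsub>D\<^esub> f) = Ga g \<cdot>\<^bsub>C\<^esub> Ga f"
      if fg: "f \<in> Arr D" "g \<in> Arr D" "Cod D f = Dom D g" for f g
    proof (rule couniversal_eq[OF cu])
      have "e (Cod D g) \<cdot>\<^bsub>D\<^esub> farr F (Ga g \<cdot>\<^bsub>C\<^esub> Ga f) = g \<cdot>\<^bsub>D\<^esub> e (Dom D g) \<cdot>\<^bsub>D\<^esub> farr F (Ga f)"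
        using D.reduce[OF Ga(2)[OF fg(2)], of "farr F (Ga f)"] fg by simp
      also have "\<dots> = g \<cdot>\<^bsub>D\<^esub> f \<cdot>\<^bsub>D\<^esub> e (Dom D f)"
        using Ga(2)[OF fg(1)] fg by simp
      also have "\<dots> = e (Cod D g) \<cdot>\<^bsub>D\<^esub> farr F (Ga (g \<cdot>\<^bsub>D\<^esub> f))"
        using Ga(2)[of "g \<cdot>\<^bsub>D\<^esub> f"] fg by simp
      finally show "e (Cod D g) \<cdot>\<^bsub>D\<^esub> farr F (Ga (g \<cdot>\<^bsub>D\<^esub> f)) = e (Cod D g) \<cdot>\<^bsub>D\<^esub> farr F (Ga g \<cdot>\<^bsub>C\<^esub> Ga f)"
        by simp
    qed (use fg in simp_all)
    ultimately show ?thesis unfolding is_functor_def G_def by simp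
  qed
  moreover have "nat_trans C C id_functor (G \<odot> F) \<eta>"
  proof -
    have "Ga (farr F f) \<cdot>\<^bsub>C\<^esub> \<eta> (Dom C f) = \<eta> (Cod C f) \<cdot>\<^bsub>C\<^esub> f" if f: "f \<in> Arr C" for f
    proof (rule couniversal_eq[OF cu])
      let ?e = "e (fobj F (Cod C f))"
      have "?e \<cdot>\<^bsub>D\<^esub> farr F (Ga (farr F f) \<cdot>\<^bsub>C\<^esub> \<eta> (Dom C f))
        = farr F f \<cdot>\<^bsub>D\<^esub> e (fobj F (Dom C f)) \<cdot>\<^bsub>D\<^esub> farr F (\<eta> (Dom C f))"
        using D.reduce[OF Ga(2)[of "farr F f"], of "farr F (\<eta> (Dom C f))"] f by simp
      also have "\<dots> = farr F f" using \<eta>(2)[of "Dom C f"] f by simp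
      also have "\<dots> = ?e \<cdot>\<^bsub>D\<^esub> farr F (\<eta> (Cod C f) \<cdot>\<^bsub>C\<^esub> f)"
        using D.reduce[OF \<eta>(2)[of "Cod C f"], of "farr F f"] f by simp
      finally show "?e \<cdot>\<^bsub>D\<^esub> farr F (Ga (farr F f) \<cdot>\<^bsub>C\<^esub> \<eta> (Dom C f)) = ?e \<cdot>\<^bsub>D\<^esub> farr F (\<eta> (Cod C f) \<cdot>\<^bsub>C\<^esub> f)" .
    qed (use f in simp_all)
    then show ?thesis unfolding nat_trans_def G_def id_functor_def comp_functor_def by simp
  qed
  moreover have "nat_trans D D (F \<odot> G) id_functor e"
    unfolding nat_trans_def G_def id_functor_def comp_functor_def by (simp add: Ga(2))
  moreover have "Ga (e Y) \<cdot>\<^bsub>C\<^esub> \<eta> (R Y) = Ide C (R Y)" if Y: "Y \<in> Obj D" for Y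
  proof (rule couniversal_eq[OF cu[OF Y]])
    have "e Y \<cdot>\<^bsub>D\<^esub> farr F (Ga (e Y) \<cdot>\<^bsub>C\<^esub> \<eta> (R Y)) = e Y \<cdot>\<^bsub>D\<^esub> e (fobj F (R Y)) \<cdot>\<^bsub>D\<^esub> farr F (\<eta> (R Y))"
      using D.reduce[OF Ga(2)[of "e Y"], of "farr F (\<eta> (R Y))"] Y by simp
    then show "e Y \<cdot>\<^bsub>D\<^esub> farr F (Ga (e Y) \<cdot>\<^bsub>C\<^esub> \<eta> (R Y)) = e Y \<cdot>\<^bsub>D\<^esub> farr F (Ide C (R Y))"
      using \<eta>(2)[of "R Y"] Y by simp
  qed (use Y in simp_all)
  ultimately have "adjunction C D F G \<eta> e"
    using is_functor \<eta>(2) unfolding adjunction_def by (simp add: G_def)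
  then show ?thesis unfolding left_adjoint_def by blast
qed

end

text \<open>The comparison arrows are the transposes of the two counits, and universality makes them
  mutually inverse.\<close>

lemma right_adjoint_unique:
  assumes "adj C D F G \<eta> \<epsilon>" "adj C D F G' \<eta>' \<epsilon>'"
  shows "nat_isomorphic D C G' G"
proof -
  interpret A: adj C D F G \<eta> \<epsilon> by (fact assms(1))
  interpret B: adj C D F G' \<eta>' \<epsilon>' by (fact assms(2))
  define \<tau> where "\<tau> Y = farr G (\<epsilon>' Y) \<cdot>\<^bsub>C\<^esub> \<eta> (fobj G' Y)" for Y
  define \<sigma> where "\<sigma> Y = farr G' (\<epsilon> Y) \<cdot>\<^bsub>C\<^esub> \<eta>' (fobj G Y)" for Y
  have \<tau>: "\<epsilon> Y \<cdot>\<^bsub>D\<^esub> farr F (\<tau> Y) = \<epsilon>' Y" and \<sigma>: "\<epsilon>' Y \<cdot>\<^bsub>D\<^esub> farr F (\<sigma> Y) = \<epsilon> Y" if "Y \<in> Obj D" for Y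
    using A.unit_transpose[of "\<epsilon>' Y" "fobj G' Y"] B.unit_transpose[of "\<epsilon> Y" "fobj G Y"] that
    unfolding \<tau>_def \<sigma>_def by simp_all
  have [simp]: "\<tau> Y \<in> Arr C" "Dom C (\<tau> Y) = fobj G' Y" "Cod C (\<tau> Y) = fobj G Y"
    "\<sigma> Y \<in> Arr C" "Dom C (\<sigma> Y) = fobj G Y" "Cod C (\<sigma> Y) = fobj G' Y" if "Y \<in> Obj D" for Y
    using that unfolding \<tau>_def \<sigma>_def by simp_all
  have "isomorphism C (\<tau> Y)" if Y: "Y \<in> Obj D" for Y
  proof (rule A.F.C.isomorphismI)
    show "\<sigma> Y \<cdot>\<^bsub>C\<^esub> \<tau> Y = Ide C (Dom C (\<tau> Y))"
      by (rule B.counit_universal_eq[of _ _ Y])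
        (use Y \<tau>[OF Y] A.F.D.reduce[OF \<sigma>[OF Y], of "farr F (\<tau> Y)"] in simp_all)
    show "\<tau> Y \<cdot>\<^bsub>C\<^esub> \<sigma> Y = Ide C (Cod C (\<tau> Y))"
      by (rule A.counit_universal_eq[of _ _ Y])
        (use Y \<sigma>[OF Y] A.F.D.reduce[OF \<tau>[OF Y], of "farr F (\<sigma> Y)"] in simp_all)
  qed (use Y in simp_all)
  moreover have "farr G f \<cdot>\<^bsub>C\<^esub> \<tau> (Dom D f) = \<tau> (Cod D f) \<cdot>\<^bsub>C\<^esub> farr G' f" if f: "f \<in> Arr D" for f
  proof (rule A.counit_universal_eq[of _ _ "Cod D f"])
    have "\<epsilon> (Cod D f) \<cdot>\<^bsub>D\<^esub> farr F (farr G f \<cdot>\<^bsub>C\<^esub> \<tau> (Dom D f)) = f \<cdot>\<^bsub>D\<^esub> \<epsilon> (Dom D f) \<cdot>\<^bsub>D\<^esub> farr F (\<tau> (Dom D f))"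
      using A.F.D.reduce[OF A.counit_natural[OF f, symmetric], of "farr F (\<tau> (Dom D f))"] f by simp
    also have "\<dots> = f \<cdot>\<^bsub>D\<^esub> \<epsilon>' (Dom D f)" using \<tau> f by simp
    also have "\<dots> = \<epsilon>' (Cod D f) \<cdot>\<^bsub>D\<^esub> farr F (farr G' f)" using B.counit_natural f by simp
    also have "\<dots> = \<epsilon> (Cod D f) \<cdot>\<^bsub>D\<^esub> farr F (\<tau> (Cod D f) \<cdot>\<^bsub>C\<^esub> farr G' f)"
      using A.F.D.reduce[OF \<tau>[of "Cod D f"], of "farr F (farr G' f)"] f by simp
    finally show "\<epsilon> (Cod D f) \<cdot>\<^bsub>D\<^esub> farr F (farr G f \<cdot>\<^bsub>C\<^esub> \<tau> (Dom D f))
      = \<epsilon> (Cod D f) \<cdot>\<^bsub>D\<^esub> farr F (\<tau> (Cod D f) \<cdot>\<^bsub>C\<^esub> farr G' f)" .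
  qed (use f in simp_all)
  ultimately show ?thesis unfolding nat_isomorphic_def nat_trans_def by (intro exI[of _ \<tau>]) simp
qed

section \<open>Subobjects of discrete objects\<close>

definition empty_shape :: "(nat, nat) category" where
  "empty_shape = \<lparr>Obj = {}, Arr = {}, Dom = id, Cod = id, Ide = id, Comp = \<lambda>v u. u\<rparr>"

lemma finite_shape_empty: "finite_shape empty_shape"
  unfolding finite_shape_def is_category_def empty_shape_def by simp

lemma is_limit_empty_iff: "is_limit empty_shape C D L \<pi> \<longleftrightarrow> is_terminal C L"
  unfolding is_limit_def is_cone_def is_terminal_def empty_shape_def by auto

lemma is_functor_empty: "is_functor empty_shape C D"
  unfolding is_functor_def empty_shape_def by simp

context cat
begin

lemma complement_ofD:
  assumes "complement_of C X m n"
  shows "subobject C X m" "subobject C X n"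
  using assms unfolding complement_of_def by blast+

lemma subobjectD:
  assumes "subobject C X m"
  shows "monic C m" "Cod C m = X" "m \<in> Arr C" "X \<in> Obj C"
  using assms unfolding subobject_def by auto

text \<open>Complements are defined by the order alone, and \<open>m\<close> and \<open>m'\<close>
  have the same lower and the same upper bounds.\<close>

lemma complement_of_cong:
  assumes "complement_of C X m n" "subobject C X m'" "sub_le C m m'" "sub_le C m' m"
  shows "complement_of C X m' n"
proof -
  have m: "m \<in> Arr C" "m' \<in> Arr C"
    using complement_ofD(1)[OF assms(1)] assms(2) subobjectD(3) by blast+
  have "sub_le C w m \<longleftrightarrow> sub_le C w m'" for w
    using sub_le_trans[OF _ assms(3) m(2)] sub_le_trans[OF _ assms(4) m(1)] by blast
  moreover have "sub_le C m w \<longleftrightarrow> sub_le C m' w" if "subobject C X w" for w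
    using sub_le_trans[OF assms(3), of w] sub_le_trans[OF assms(4), of w] that
    unfolding subobject_def by auto
  ultimately show ?thesis using assms(1,2) unfolding complement_of_def by blast
qed

text \<open>The product \<open>P\<close> is kept and its projections are composed with
  \<open>f\<close>. The new diagonal is \<open>d g\<close>, with \<open>g\<close> the inverse of
  \<open>f\<close>; it is the same subobject of \<open>P\<close> as \<open>d\<close> and has the
  same complement.\<close>

lemma decidable_isomorphism:
  assumes "decidable C X" "isomorphism C f" "Dom C f = X"
  shows "decidable C (Cod C f)"
proof -
  obtain P p q d n where X: "X \<in> Obj C" and pr: "is_product C X X P p q" and d: "d \<in> Hom C X P"
    "p \<cdot> d = Ide C X" "q \<cdot> d = Ide C X" and n: "complement_of C (Cod C d) d n"
    using assms(1) unfolding decidable_def complemented_def by blast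
  note P = is_productD[OF pr]
  obtain g where f: "f \<in> Arr C" and g: "g \<in> Arr C" "Dom C g = Cod C f" "Cod C g = Dom C f"
    and gf: "g \<cdot> f = Ide C (Dom C f)" and fg: "f \<cdot> g = Ide C (Cod C f)"
    using assms(2) isomorphismE by metis
  let ?Y = "Cod C f"
  have "is_product C ?Y ?Y P (f \<cdot> p) (f \<cdot> q)"
  proof -
    have *: "\<exists>!h. h \<in> Hom C W P \<and> (f \<cdot> p) \<cdot> h = a \<and> (f \<cdot> q) \<cdot> h = b"
      if a: "a \<in> Hom C W ?Y" and b: "b \<in> Hom C W ?Y" for W a b
    proof -
      have "(f \<cdot> p') \<cdot> h = c \<longleftrightarrow> p' \<cdot> h = g \<cdot> c" if "c \<in> Hom C W ?Y" "h \<in> Hom C W P" "p' \<in> Hom C P X" for c h p'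
      proof
        assume "(f \<cdot> p') \<cdot> h = c"
        then have "g \<cdot> c = g \<cdot> f \<cdot> p' \<cdot> h" using that f assms(3) by simp
        then show "p' \<cdot> h = g \<cdot> c" using reduce[OF gf, of "p' \<cdot> h"] that f g assms(3) by simp
      next
        assume "p' \<cdot> h = g \<cdot> c"
        then have "(f \<cdot> p') \<cdot> h = f \<cdot> g \<cdot> c" using that f assms(3) by simp
        then show "(f \<cdot> p') \<cdot> h = c" using reduce[OF fg, of c] that f g by simp
      qed
      then have "(h \<in> Hom C W P \<and> (f \<cdot> p) \<cdot> h = a \<and> (f \<cdot> q) \<cdot> h = b) \<longleftrightarrow>
         (h \<in> Hom C W P \<and> p \<cdot> h = g \<cdot> a \<and> q \<cdot> h = g \<cdot> b)" for h
        using a b P by auto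
      moreover have "g \<cdot> a \<in> Hom C W X" "g \<cdot> b \<in> Hom C W X" using a b g assms(3) by simp_all
      then have "\<exists>!h. h \<in> Hom C W P \<and> p \<cdot> h = g \<cdot> a \<and> q \<cdot> h = g \<cdot> b"
        using pr unfolding is_product_def by blast
      ultimately show ?thesis by simp
    qed
    show ?thesis unfolding is_product_def
      by (intro conjI allI ballI; (rule *; assumption)?) (use P f assms(3) in simp_all)
  qed
  moreover have "d \<cdot> g \<in> Hom C ?Y P" using d g assms(3) by simp
  moreover have "(f \<cdot> p) \<cdot> d \<cdot> g = Ide C ?Y" "(f \<cdot> q) \<cdot> d \<cdot> g = Ide C ?Y"
    using reduce[OF d(2), of g] reduce[OF d(3), of g] d(1) P f g fg assms(3) by simp_all
  moreover have "complemented C (d \<cdot> g)"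
  proof -
    have dm: "monic C d" using subobjectD(1)[OF complement_ofD(1)[OF n]] .
    have "isomorphism C g" by (rule isomorphismI[of g f]) (use f g gf fg in simp_all)
    then have "subobject C (Cod C d) (d \<cdot> g)"
      using isomorphism_monic monic_comp[OF _ dm, of g] d(1) g assms(3) unfolding subobject_def by simp
    moreover have "sub_le C d (d \<cdot> g)" by (rule sub_leI[of f]) (use d(1) f g gf assms(3) in simp_all)
    moreover have "sub_le C (d \<cdot> g) d" by (rule sub_leI[of g]) (use d(1) f g assms(3) in simp_all)
    ultimately show ?thesis
      using complement_of_cong[OF n] d(1) g assms(3) unfolding complemented_def by auto
  qed
  moreover have "?Y \<in> Obj C" using f by simp
  ultimately show ?thesis unfolding decidable_def by blast
qed

end

locale left_exact_gm = S: topos S tS + E: topos E tE + adj S E F G \<eta> \<beta>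
  for S :: "('so, 'sa) category" and E :: "('eo, 'ea) category"
    and F :: "('so, 'sa, 'eo, 'ea) functor_data" and G :: "('eo, 'ea, 'so, 'sa) functor_data"
    and \<eta> :: "'so \<Rightarrow> 'sa" and \<beta> :: "'eo \<Rightarrow> 'ea" and tE :: 'ea and tS :: 'sa +
  assumes limits: "preserves_finite_limits S E F"
begin

lemma limit_preserved:
  assumes "finite_shape J" "is_functor J S D" "is_limit J S D L \<pi>"
  shows "is_limit J E (F \<odot> D) (fobj F L) (\<lambda>j. farr F (\<pi> j))"
  using limits[unfolded preserves_finite_limits_def preserves_limits_of_shape_def, rule_format, OF assms(1),
    OF conjI, OF assms(2,3)] .

lemma F_one: "is_terminal E (fobj F S.one)"
proof -
  \<comment> \<open>The empty shape has no vertex at which the diagram or the legs would be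
    evaluated, so any values serve.\<close>
  let ?D = "undefined :: (nat, nat, 'so, 'sa) functor_data"
  have "is_limit empty_shape S ?D S.one undefined"
    using S.one_terminal by (simp add: is_limit_empty_iff)
  from limit_preserved[OF finite_shape_empty is_functor_empty this]
  show ?thesis by (simp add: is_limit_empty_iff)
qed

lemma F_pullback:
  assumes "is_pullback S p q f g"
  shows "is_pullback E (farr F p) (farr F q) (farr F f) (farr F g)"
proof -
  note D = S.is_pullbackD[OF assms]
  let ?D = "cospan_diagram S f g"
  let ?\<pi> = "\<lambda>i. if i = (0::nat) then p else if i = 1 then q else f \<cdot>\<^bsub>S\<^esub> p"
  have D': "is_functor cospan S ?D" using S.is_functor_cospan_diagram D by simp
  then have "is_limit cospan E (F \<odot> ?D) (fobj F (Dom S p)) (\<lambda>j. farr F (?\<pi> j))"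
    by (rule limit_preserved[OF finite_shape_cospan _ S.is_limit_if_pullback[OF assms]])
  moreover have "is_functor cospan E (F \<odot> ?D)"
    using D' D unfolding is_functor_def cospan_def cospan_diagram_def comp_functor_def by auto
  ultimately have "is_pullback E (farr F (?\<pi> 0)) (farr F (?\<pi> 1)) (farr (F \<odot> ?D) 3) (farr (F \<odot> ?D) 4)"
    by (rule E.is_pullback_if_limit[rotated])
  then show ?thesis by (simp add: comp_functor_def cospan_diagram_def)
qed

lemma F_monic: "monic S m \<Longrightarrow> monic E (farr F m)"
  using F_pullback[of "Ide S (Dom S m)" "Ide S (Dom S m)" m m]
    S.is_pullback_ide_iff_monic[of m] E.is_pullback_ide_iff_monic[of "farr F m"] by simp

lemma F_product:
  assumes "is_product S X Y P p q"
  shows "is_product E (fobj F X) (fobj F Y) (fobj F P) (farr F p) (farr F q)"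
proof -
  note P = S.is_productD[OF assms]
  have "is_pullback S p q (S.bang X) (S.bang Y)"
    using S.is_product_iff_pullback[OF S.one_terminal, of "S.bang X" "S.bang Y" p q] assms P by simp
  then have "is_pullback E (farr F p) (farr F q) (farr F (S.bang X)) (farr F (S.bang Y))"
    by (rule F_pullback)
  then show ?thesis
    using E.is_product_iff_pullback[OF F_one, of "farr F (S.bang X)" "farr F (S.bang Y)" "farr F p" "farr F q"] P
    by simp
qed

end

section \<open>Hyperconnectedness: subobjects and decidability of the objects
  \<open>F A\<close>\<close>

locale hyperconnected_gm = left_exact_gm +
  assumes full_faithful: "fully_faithful S E F"
    and counit_monic: "X \<in> Obj E \<Longrightarrow> monic E (\<beta> X)"
begin

lemma F_full:
  assumes "h \<in> Arr E" "Dom E h = fobj F X" "Cod E h = fobj F Y" "X \<in> Obj S" "Y \<in> Obj S"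
  obtains f where "f \<in> Arr S" "Dom S f = X" "Cod S f = Y" "farr F f = h"
proof -
  have "h \<in> farr F ` Hom S X Y"
    using full_faithful assms unfolding fully_faithful_def bij_betw_def by simp
  then show ?thesis using that by auto
qed

lemma F_faithful:
  assumes "f \<in> Arr S" "g \<in> Arr S" "Dom S f = Dom S g" "Cod S f = Cod S g" "farr F f = farr F g"
  shows "f = g"
proof -
  have "inj_on (farr F) (Hom S (Dom S f) (Cod S f))"
    using full_faithful assms unfolding fully_faithful_def bij_betw_def by simp
  from inj_onD[OF this assms(5)] show ?thesis using assms by simp
qed

text \<open>Fullness turns the arrow \<open>F A \<rightarrow> F 0\<close> into an arrow
  \<open>A \<rightarrow> 0\<close>, and \<open>0\<close> is strict.\<close>

lemma F_initial_imp_initial: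
  assumes "is_initial E (fobj F A)" "A \<in> Obj S"
  shows "is_initial S A"
proof -
  obtain Z where Z: "is_initial S Z" using S.initial_exists by blast
  then have Z': "Z \<in> Obj S" by (rule S.is_initial_obj)
  obtain h where h: "h \<in> Arr E" "Dom E h = fobj F A" "Cod E h = fobj F Z"
    by (rule E.is_initialE[OF assms(1), of "fobj F Z"]) (use Z' in simp)
  obtain f where "f \<in> Arr S" "Dom S f = A" "Cod S f = Z"
    by (rule F_full[OF h assms(2) Z'])
  then show ?thesis using S.initial_strict[OF Z] by auto
qed

text \<open>\<open>k\<close> is the transpose of \<open>true\<close> at \<open>F 1\<close>. As
  \<open>F 1\<close> is terminal but need not be the chosen \<open>E.one\<close>, the equation is
  given on all elements of \<open>F 1\<close>.\<close>

lemma tr_discrete: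
  obtains k where "k \<in> Arr S" "Dom S k = S.one" "Cod S k = fobj G E.Om"
    "\<And>u. u \<in> Arr E \<Longrightarrow> Cod E u = fobj F S.one \<Longrightarrow> \<beta> E.Om \<cdot>\<^bsub>E\<^esub> farr F k \<cdot>\<^bsub>E\<^esub> u = E.tr (Dom E u)"
proof -
  have [simp]: "S.one \<in> Obj S" "E.Om \<in> Obj E" by simp_all
  obtain k where k: "k \<in> Arr S" "Dom S k = S.one" "Cod S k = fobj G E.Om"
    "\<beta> E.Om \<cdot>\<^bsub>E\<^esub> farr F k = E.tr (fobj F S.one)"
    by (rule counit_universal_ex[of S.one "E.tr (fobj F S.one)" E.Om]) simp_all
  have "\<beta> E.Om \<cdot>\<^bsub>E\<^esub> farr F k \<cdot>\<^bsub>E\<^esub> u = E.tr (Dom E u)" if "u \<in> Arr E" "Cod E u = fobj F S.one" for u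
    using E.reduce[OF k(4), of u] k that by simp
  then show ?thesis using that k by blast
qed

text \<open>The two characteristic arrows \<open>\<chi>\<close> and \<open>true\<close> factor through the monic counit at \<open>\<Omega>\<close>, so the
  pullback can be computed in \<open>S\<close>.\<close>

lemma subobject_discrete:
  assumes w: "monic E w" "Cod E w = fobj F A" and A: "A \<in> Obj S"
  obtains v where "monic S v" "Cod S v = A" "sub_le E w (farr F v)" "sub_le E (farr F v) w"
proof -
  have [simp]: "E.Om \<in> Obj E" "S.one \<in> Obj S" by simp_all
  obtain c where c: "c \<in> Arr S" "Dom S c = A" "Cod S c = fobj G E.Om" "\<beta> E.Om \<cdot>\<^bsub>E\<^esub> farr F c = E.chi w"
    by (rule counit_universal_ex[of A "E.chi w" E.Om]) (use w A in simp_all)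
  obtain k where k: "k \<in> Arr S" "Dom S k = S.one" "Cod S k = fobj G E.Om"
    and k_tr: "\<And>u. u \<in> Arr E \<Longrightarrow> Cod E u = fobj F S.one \<Longrightarrow> \<beta> E.Om \<cdot>\<^bsub>E\<^esub> farr F k \<cdot>\<^bsub>E\<^esub> u = E.tr (Dom E u)"
    using tr_discrete by blast
  obtain v u where pb: "is_pullback S v u c k"
    using S.pullback_exists[of c k] c k by auto
  note D = S.is_pullbackD[OF pb]
  have "monic S k"
    by (rule S.monicI) (use k S.is_terminalD[OF S.one_terminal] in auto)
  then have v: "monic S v" using S.is_pullback_monic[OF pb] by simp
  note pbE = F_pullback[OF pb]
  have "E.chi w \<cdot>\<^bsub>E\<^esub> farr F v = \<beta> E.Om \<cdot>\<^bsub>E\<^esub> farr F c \<cdot>\<^bsub>E\<^esub> farr F v"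
    using E.reduce[OF c(4), of "farr F v"] c(1-3) D by simp
  also have "farr F c \<cdot>\<^bsub>E\<^esub> farr F v = farr F k \<cdot>\<^bsub>E\<^esub> farr F u" using E.is_pullbackD[OF pbE] by simp
  also have "\<beta> E.Om \<cdot>\<^bsub>E\<^esub> farr F k \<cdot>\<^bsub>E\<^esub> farr F u = E.tr (Dom E (farr F v))"
    using k_tr[of "farr F u"] k D by simp
  finally have "E.chi w \<cdot>\<^bsub>E\<^esub> farr F v = E.tr (Dom E (farr F v))" .
  then have "sub_le E (farr F v) w"
    using E.chi_iff[OF w(1), of "farr F v"] v w D c(2) by (auto intro: E.sub_leI)
  moreover have "sub_le E w (farr F v)"
  proof -
    obtain b where b: "b \<in> Arr E" "Dom E b = Dom E w" "Cod E b = fobj F S.one"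
      by (rule E.is_terminalE[OF F_one, of "Dom E w"]) (use w in simp)
    \<comment> \<open>Both sides are \<open>true\<close> on the domain of \<open>w\<close>.
      Cancelling the monic counit leaves a commuting square over \<open>F c\<close> and
      \<open>F k\<close>, whose pullback is the image under \<open>F\<close> of the one in
      \<open>S\<close>.\<close>
    have "\<beta> E.Om \<cdot>\<^bsub>E\<^esub> farr F c \<cdot>\<^bsub>E\<^esub> w = \<beta> E.Om \<cdot>\<^bsub>E\<^esub> farr F k \<cdot>\<^bsub>E\<^esub> b"
      using E.reduce[OF c(4), of w] c(1-3) w E.chi_comp_self[OF w(1)] k_tr[OF b(1,3)] b k by simp
    then have "farr F c \<cdot>\<^bsub>E\<^esub> w = farr F k \<cdot>\<^bsub>E\<^esub> b"
      by (rule E.monicD[OF counit_monic[OF \<open>E.Om \<in> Obj E\<close>]]) (use c k b w in simp_all)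
    then obtain h where "h \<in> Arr E" "Dom E h = Dom E w" "Cod E h = Dom E (farr F v)" "farr F v \<cdot>\<^bsub>E\<^esub> h = w"
      using E.is_pullback_pair[OF pbE, of w b] w b c(1-3) k D by auto
    then show ?thesis by (auto intro: E.sub_leI)
  qed
  ultimately show ?thesis using that v D c(2) by simp
qed

lemma F_sub_le_iff:
  assumes "m \<in> Arr S" "n \<in> Arr S" "Cod S m = Cod S n"
  shows "sub_le E (farr F m) (farr F n) \<longleftrightarrow> sub_le S m n"
proof
  assume "sub_le E (farr F m) (farr F n)"
  then obtain h where h: "h \<in> Arr E" "Dom E h = fobj F (Dom S m)" "Cod E h = fobj F (Dom S n)"
    "farr F n \<cdot>\<^bsub>E\<^esub> h = farr F m" using E.sub_leE assms by (metis F.dom_farr)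
  obtain k where k: "k \<in> Arr S" "Dom S k = Dom S m" "Cod S k = Dom S n" "farr F k = h"
    by (rule F_full[OF h(1-3)]) (use assms in simp_all)
  have "n \<cdot>\<^bsub>S\<^esub> k = m" by (rule F_faithful) (use assms k h in simp_all)
  then show "sub_le S m n" using k by (auto intro: S.sub_leI)
next
  assume "sub_le S m n"
  then obtain h where h: "h \<in> Arr S" "Dom S h = Dom S m" "Cod S h = Dom S n" "n \<cdot>\<^bsub>S\<^esub> h = m"
    using S.sub_leE by blast
  show "sub_le E (farr F m) (farr F n)"
    by (rule E.sub_leI[of "farr F h"]) (use h assms F.farr_eq[OF h(4)] in simp_all)
qed

text \<open>\<open>F\<close> identifies the preorder of subobjects of \<open>X\<close> with that of
  \<open>F X\<close>, and complements depend on the order alone. Arbitrary subobjects of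
  \<open>F X\<close> are therefore replaced by some \<open>F v\<close> on both sides of an
  inequality.\<close>

lemma F_complement_of:
  assumes "complement_of S X m n"
  shows "complement_of E (fobj F X) (farr F m) (farr F n)"
proof -
  note m = S.subobjectD[OF S.complement_ofD(1)[OF assms]]
    and n = S.subobjectD[OF S.complement_ofD(2)[OF assms]]
  have X: "X \<in> Obj S" using m by simp
  have *: "\<exists>v. subobject S X v \<and> sub_le E w (farr F v) \<and> sub_le E (farr F v) w" if "subobject E (fobj F X) w" for w
    using subobject_discrete[of w X] that X unfolding subobject_def by metis
  have arr: "v \<in> Arr S" "Cod S v = X" "farr F v \<in> Arr E" if "subobject S X v" for v
    using that unfolding subobject_def by auto
  have le: "sub_le E (farr F v) (farr F v') \<longleftrightarrow> sub_le S v v'" if "subobject S X v" "subobject S X v'" for v v'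
    using F_sub_le_iff arr that by metis
  have mn: "subobject S X m" "subobject S X n" using m n unfolding subobject_def by simp_all
  have arrE: "w \<in> Arr E" if "subobject E (fobj F X) w" for w using that unfolding subobject_def by simp
  have "sub_le E w v" if w: "subobject E (fobj F X) w" "sub_le E w (farr F m)" "sub_le E w (farr F n)"
    and v: "subobject E (fobj F X) v" for w v
  proof -
    obtain w' where w': "subobject S X w'" "sub_le E w (farr F w')" "sub_le E (farr F w') w" using *[OF w(1)] by blast
    obtain v' where v': "subobject S X v'" "sub_le E v (farr F v')" "sub_le E (farr F v') v" using *[OF v] by blast
    have "sub_le S w' m" "sub_le S w' n"
      using E.sub_le_trans[OF w'(3) w(2) arr(3)[OF mn(1)]] E.sub_le_trans[OF w'(3) w(3) arr(3)[OF mn(2)]]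
        le[OF w'(1) mn(1)] le[OF w'(1) mn(2)] by simp_all
    then have "sub_le S w' v'" using assms w'(1) v'(1) unfolding complement_of_def by blast
    then have "sub_le E (farr F w') (farr F v')" using le[OF w'(1) v'(1)] by simp
    from E.sub_le_trans[OF E.sub_le_trans[OF w'(2) this arr(3)[OF v'(1)]] v'(3) arrE[OF v]]
    show ?thesis .
  qed
  moreover have "sub_le E v w" if w: "subobject E (fobj F X) w" "sub_le E (farr F m) w" "sub_le E (farr F n) w"
    and v: "subobject E (fobj F X) v" for w v
  proof -
    obtain w' where w': "subobject S X w'" "sub_le E w (farr F w')" "sub_le E (farr F w') w" using *[OF w(1)] by blast
    obtain v' where v': "subobject S X v'" "sub_le E v (farr F v')" "sub_le E (farr F v') v" using *[OF v] by blast
    have "sub_le S m w'" "sub_le S n w'"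
      using E.sub_le_trans[OF w(2) w'(2) arr(3)[OF w'(1)]] E.sub_le_trans[OF w(3) w'(2) arr(3)[OF w'(1)]]
        le[OF mn(1) w'(1)] le[OF mn(2) w'(1)] by simp_all
    then have "sub_le S v' w'" using assms w'(1) v'(1) unfolding complement_of_def by blast
    then have "sub_le E (farr F v') (farr F w')" using le[OF v'(1) w'(1)] by simp
    from E.sub_le_trans[OF E.sub_le_trans[OF v'(2) this arr(3)[OF w'(1)]] w'(3) arrE[OF w(1)]]
    show ?thesis .
  qed
  moreover have "subobject E (fobj F X) (farr F m)" "subobject E (fobj F X) (farr F n)"
    using m n F_monic unfolding subobject_def by simp_all
  ultimately show ?thesis unfolding complement_of_def by blast
qed

lemma F_decidable:
  assumes "boolean_topos S" "B \<in> Obj S"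
  shows "decidable E (fobj F B)"
proof -
  obtain P p q where pr: "is_product S B B P p q" using S.product_exists assms(2) by blast
  note P = S.is_productD[OF pr]
  obtain d where d: "d \<in> Arr S" "Dom S d = B" "Cod S d = P" "p \<cdot>\<^bsub>S\<^esub> d = Ide S B" "q \<cdot>\<^bsub>S\<^esub> d = Ide S B"
    by (rule S.is_product_pair[OF pr, of "Ide S B" "Ide S B"]) (use assms in simp_all)
  have "monic S d" by (rule S.split_monic[of p]) (use d P in simp_all)
  then obtain n where "complement_of S P d n"
    using assms(1) d unfolding boolean_topos_def complemented_def by auto
  then have "complement_of E (fobj F P) (farr F d) (farr F n)" by (rule F_complement_of)
  then have "complemented E (farr F d)" unfolding complemented_def using d by auto
  moreover have "farr F p \<cdot>\<^bsub>E\<^esub> farr F d = Ide E (fobj F B)" "farr F q \<cdot>\<^bsub>E\<^esub> farr F d = Ide E (fobj F B)"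
    using F.farr_eq[OF d(4)] F.farr_eq[OF d(5)] d P by simp_all
  ultimately show ?thesis
    unfolding decidable_def using F_product[OF pr] d assms(2)
    by (intro conjI exI[of _ "fobj F P"] exI[of _ "farr F p"] exI[of _ "farr F q"] exI[of _ "farr F d"]) simp_all
qed

text \<open>Naturality at \<open>i\<close> writes the counit at the domain of \<open>i\<close> as a
  composite of isomorphisms, one of them the counit at \<open>F A\<close>.\<close>

lemma counit_isomorphism_if_iso_image:
  assumes "isomorphism E i" "Cod E i = fobj F A" "A \<in> Obj S"
  shows "isomorphism E (\<beta> (Dom E i))"
proof -
  obtain g where i: "i \<in> Arr E" and g: "g \<in> Arr E" "Dom E g = Cod E i" "Cod E g = Dom E i"
    "g \<cdot>\<^bsub>E\<^esub> i = Ide E (Dom E i)" "i \<cdot>\<^bsub>E\<^esub> g = Ide E (Cod E i)"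
    using assms(1) E.isomorphismE by metis
  have "isomorphism E g" by (rule E.isomorphismI[of g i]) (use i g in simp_all)
  moreover have "isomorphism E (\<beta> (fobj F A))"
    using counit_isomorphism_at_image full_faithful assms(3) by blast
  moreover have "isomorphism E (farr F (farr G i))"
    using assms(1) by (intro F.farr_isomorphism G.farr_isomorphism)
  ultimately have "isomorphism E (g \<cdot>\<^bsub>E\<^esub> \<beta> (fobj F A) \<cdot>\<^bsub>E\<^esub> farr F (farr G i))"
    by (intro E.isomorphism_comp) (use i g assms in simp_all)
  also have "g \<cdot>\<^bsub>E\<^esub> \<beta> (fobj F A) \<cdot>\<^bsub>E\<^esub> farr F (farr G i) = \<beta> (Dom E i)"
    using counit_natural[OF i] E.reduce[OF g(4), of "\<beta> (Dom E i)"] i g(1-3) assms by simp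
  finally show ?thesis .
qed

text \<open>\<open>w\<close> is the same subobject as some \<open>F v\<close>, so its domain is
  isomorphic to an object in the image of \<open>F\<close>.\<close>

lemma counit_isomorphism_if_subobject:
  assumes "monic E w" "Cod E w = fobj F A" "A \<in> Obj S"
  shows "isomorphism E (\<beta> (Dom E w))"
proof -
  obtain v where v: "monic S v" "Cod S v = A" "sub_le E w (farr F v)" "sub_le E (farr F v) w"
    using subobject_discrete[OF assms] by blast
  obtain i where i: "i \<in> Arr E" "Dom E i = Dom E w" "Cod E i = fobj F (Dom S v)" "farr F v \<cdot>\<^bsub>E\<^esub> i = w"
    using E.sub_leE[OF v(3)] v(1) by auto
  obtain j where j: "j \<in> Arr E" "Dom E j = fobj F (Dom S v)" "Cod E j = Dom E w" "w \<cdot>\<^bsub>E\<^esub> j = farr F v"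
    using E.sub_leE[OF v(4)] v(1) by auto
  have im: "monic E i" using E.monic_cancel_right[of "farr F v" i] assms(1) i v(1) by simp
  have "farr F v \<cdot>\<^bsub>E\<^esub> i \<cdot>\<^bsub>E\<^esub> j = farr F v \<cdot>\<^bsub>E\<^esub> Ide E (fobj F (Dom S v))"
    using E.reduce[OF i(4), of j] i j v(1) by simp
  then have "i \<cdot>\<^bsub>E\<^esub> j = Ide E (Cod E i)"
    using i by - (rule E.monicD[OF F_monic[OF v(1)]], use i j v(1) in simp_all)
  then have "isomorphism E i"
    using E.monic_section_isomorphism(1)[OF im, of j] i j by simp
  then show ?thesis using counit_isomorphism_if_iso_image[of i "Dom S v"] i v(1) by simp
qed

end

section \<open>Decidable objects are discrete\<close>

text \<open>\<open>s\<close> is the unit at \<open>X\<close> of a reflection along \<open>F\<close>,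
  with \<open>B\<close> in the role of \<open>p_! X\<close>. It is stated pointwise because left
  adjoints are given only for the slices.\<close>

definition universal ::
  "('o, 'a) category \<Rightarrow> ('p, 'b) category \<Rightarrow> ('o, 'a, 'p, 'b) functor_data \<Rightarrow> 'p \<Rightarrow> 'o \<Rightarrow> 'b \<Rightarrow> bool" where
  "universal C D F X B s \<longleftrightarrow> B \<in> Obj C \<and> s \<in> Hom D X (fobj F B) \<and>
     (\<forall>Z\<in>Obj C. \<forall>g\<in>Hom D X (fobj F Z). \<exists>!f. f \<in> Hom C B Z \<and> farr F f \<cdot>\<^bsub>D\<^esub> s = g)"

context func
begin

lemma universalD:
  assumes "universal C D F X B s"
  shows "B \<in> Obj C" "s \<in> Arr D" "Dom D s = X" "Cod D s = fobj F B" "X \<in> Obj D"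
  using assms unfolding universal_def by auto

lemma universal_ex:
  assumes "universal C D F X B s" "Z \<in> Obj C" "g \<in> Arr D" "Dom D g = X" "Cod D g = fobj F Z"
  obtains f where "f \<in> Arr C" "Dom C f = B" "Cod C f = Z" "farr F f \<cdot>\<^bsub>D\<^esub> s = g"
proof -
  have "g \<in> Hom D X (fobj F Z)" using assms by simp
  then have "\<exists>f. f \<in> Hom C B Z \<and> farr F f \<cdot>\<^bsub>D\<^esub> s = g"
    using assms(1,2) unfolding universal_def by blast
  then show ?thesis using that by auto
qed

lemma universal_eq:
  assumes "universal C D F X B s" "f \<in> Arr C" "f' \<in> Arr C" "Dom C f = B" "Dom C f' = B"
    "Cod C f = Cod C f'" "farr F f \<cdot>\<^bsub>D\<^esub> s = farr F f' \<cdot>\<^bsub>D\<^esub> s"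
  shows "f = f'"
proof -
  have "Cod C f \<in> Obj C" "farr F f \<cdot>\<^bsub>D\<^esub> s \<in> Hom D X (fobj F (Cod C f))"
    using assms universalD[OF assms(1)] by simp_all
  then have "\<exists>!k. k \<in> Hom C B (Cod C f) \<and> farr F k \<cdot>\<^bsub>D\<^esub> s = farr F f \<cdot>\<^bsub>D\<^esub> s"
    using assms(1) unfolding universal_def by blast
  then show ?thesis using assms by (metis in_Hom)
qed

end

text \<open>The second assumption is the contribution of stability: arrows from the kernel pair of
  \<open>s\<close> to objects \<open>F V\<close> factor through its arrow to \<open>F B\<close>, so
  it is connected over \<open>B\<close> just as \<open>X\<close> is.\<close>

locale stable_reflection = hyperconnected_gm +
  assumes reflection: "X \<in> Obj E \<Longrightarrow> \<exists>B s. universal S E F X B s"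
    and kernel_pair_reflection: "universal S E F X B s \<Longrightarrow> is_pullback E k k' s s \<Longrightarrow> V \<in> Obj S \<Longrightarrow>
      g \<in> Arr E \<Longrightarrow> Dom E g = Dom E k \<Longrightarrow> Cod E g = fobj F V \<Longrightarrow>
      \<exists>f\<in>Arr S. Dom S f = B \<and> Cod S f = V \<and> farr F f \<cdot>\<^bsub>E\<^esub> s \<cdot>\<^bsub>E\<^esub> k = g"
begin

text \<open>An arrow that is constant at the point \<open>y\<close> factors through the terminal
  object \<open>F 1\<close>, and arrows out of \<open>F 1\<close> factor through the counit.\<close>

lemma point_discrete:
  assumes "y \<in> Arr E" "Dom E y = E.one" "X \<in> Obj E"
  obtains z where "z \<in> Arr E" "Dom E z = X" "Cod E z = fobj F (fobj G (Cod E y))"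
    "\<beta> (Cod E y) \<cdot>\<^bsub>E\<^esub> z = y \<cdot>\<^bsub>E\<^esub> E.bang X"
proof -
  let ?O = "fobj F S.one"
  have one: "S.one \<in> Obj S" by simp
  obtain k where k: "k \<in> Arr S" "Dom S k = S.one" "Cod S k = fobj G (Cod E y)"
    "\<beta> (Cod E y) \<cdot>\<^bsub>E\<^esub> farr F k = y \<cdot>\<^bsub>E\<^esub> E.bang ?O"
    by (rule counit_universal_ex[OF one, of "y \<cdot>\<^bsub>E\<^esub> E.bang ?O" "Cod E y"]) (use assms in simp_all)
  obtain b where b: "b \<in> Arr E" "Dom E b = X" "Cod E b = ?O"
    by (rule E.is_terminalE[OF F_one assms(3)])
  have "\<beta> (Cod E y) \<cdot>\<^bsub>E\<^esub> farr F k \<cdot>\<^bsub>E\<^esub> b = y \<cdot>\<^bsub>E\<^esub> E.bang X"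
    using E.reduce[OF k(4), of b] k(1-3) b assms by simp
  then show ?thesis using that[of "farr F k \<cdot>\<^bsub>E\<^esub> b"] k b by simp
qed

text \<open>A complemented subobject has a characteristic arrow \<open>P \<rightarrow> 1 + 1 \<rightarrow> \<Omega>\<close>, and \<open>1 + 1\<close> is discrete. To
  avoid coproducts, pull the monic counit at \<open>\<Omega>\<close> back along the characteristic arrow: the result
  contains both the subobject and its complement.\<close>

lemma chi_complemented_discrete:
  assumes "complement_of E P d n"
  obtains c where "c \<in> Arr E" "Dom E c = P" "Cod E c = fobj F (fobj G E.Om)" "\<beta> E.Om \<cdot>\<^bsub>E\<^esub> c = E.chi d"
proof -
  have [simp]: "E.Om \<in> Obj E" "P \<in> Obj E"
    using E.subobjectD(4)[OF E.complement_ofD(1)[OF assms]] by simp_all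
  have d: "monic E d" "Cod E d = P" "d \<in> Arr E" and n: "monic E n" "Cod E n = P" "n \<in> Arr E"
    using E.subobjectD E.complement_ofD[OF assms] by blast+
  obtain w v where pb: "is_pullback E w v (E.chi d) (\<beta> E.Om)"
    using E.pullback_exists[of "E.chi d" "\<beta> E.Om"] d by auto
  note D = E.is_pullbackD[OF pb]
  have w: "subobject E P w"
    using E.is_pullback_monic[OF pb counit_monic] D d unfolding subobject_def by simp
  \<comment> \<open>If \<open>chi d\<close> is constant at a point \<open>y\<close> on the domain of
    \<open>m\<close>, then it factors through the counit there, so \<open>m\<close> lies in the
    pullback \<open>w\<close>. This is used for \<open>d\<close> with \<open>true\<close> and for
    \<open>n\<close> with \<open>false\<close>.\<close>
  have le: "sub_le E m w" if m: "m \<in> Arr E" "Cod E m = P" and y: "y \<in> Arr E" "Dom E y = E.one" "Cod E y = E.Om"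
    and eq: "E.chi d \<cdot>\<^bsub>E\<^esub> m = y \<cdot>\<^bsub>E\<^esub> E.bang (Dom E m)" for m y
  proof -
    obtain z where "z \<in> Arr E" "Dom E z = Dom E m" "Cod E z = fobj F (fobj G (Cod E y))"
      "\<beta> (Cod E y) \<cdot>\<^bsub>E\<^esub> z = y \<cdot>\<^bsub>E\<^esub> E.bang (Dom E m)"
      by (rule point_discrete[OF y(1,2), of "Dom E m"]) (use m in simp)
    then obtain h where "h \<in> Arr E" "Dom E h = Dom E m" "Cod E h = Dom E w" "w \<cdot>\<^bsub>E\<^esub> h = m"
      using E.is_pullback_pair[OF pb, of m z] m y eq d by auto
    then show ?thesis by (rule E.sub_leI)
  qed
  have "sub_le E d w"
    by (rule le[of d tE]) (use d E.chi_comp_self[OF d(1)] in \<open>simp_all add: E.tr_def\<close>)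
  moreover have "sub_le E n w"
  proof (rule le[of n "E.chi E.zer"])
    \<comment> \<open>Disjointness of \<open>d\<close> and \<open>n\<close>: an element of
      \<open>n\<close> at which \<open>chi d\<close> holds has an initial domain.\<close>
    have "E.chi d \<cdot>\<^bsub>E\<^esub> n = E.fl (Dom E n)"
    proof (subst E.eq_fl_iff, goal_cases)
      case 4
      show ?case
      proof (intro ballI impI)
        fix u assume u: "u \<in> Arr E" "Cod E u = Dom E n" "(E.chi d \<cdot>\<^bsub>E\<^esub> n) \<cdot>\<^bsub>E\<^esub> u = E.tr (Dom E u)"
        then obtain h where "h \<in> Arr E" "Dom E h = Dom E u" "Cod E h = Dom E d" "d \<cdot>\<^bsub>E\<^esub> h = n \<cdot>\<^bsub>E\<^esub> u"
          using E.chi_iff[OF d(1), of "n \<cdot>\<^bsub>E\<^esub> u"] d n by auto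
        then show "is_initial E (Dom E u)"
          using E.complement_disjoint[OF assms, of h u] u by simp
      qed
    qed (use d n in simp_all)
    then show "E.chi d \<cdot>\<^bsub>E\<^esub> n = E.chi E.zer \<cdot>\<^bsub>E\<^esub> E.bang (Dom E n)" unfolding E.fl_def .
  qed (use n in simp_all)
  moreover have "subobject E P (Ide E P)" unfolding subobject_def by simp
  ultimately have "sub_le E (Ide E P) w"
    using assms w unfolding complement_of_def by blast
  then obtain h where h: "h \<in> Arr E" "Dom E h = P" "Cod E h = Dom E w" "w \<cdot>\<^bsub>E\<^esub> h = Ide E P"
    using E.sub_leE[of "Ide E P" w] by auto
  have "\<beta> E.Om \<cdot>\<^bsub>E\<^esub> v \<cdot>\<^bsub>E\<^esub> h = E.chi d"
    using E.reduce[OF D(9)[symmetric], of h] D(1-8) h d by simp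
  then show ?thesis using that[of "v \<cdot>\<^bsub>E\<^esub> h"] D h by simp
qed

text \<open>The kernel pair \<open>K\<close> of the reflection \<open>s : X \<rightarrow> F B\<close> is connected over \<open>B\<close>, so a characteristic arrow
  on \<open>K\<close> with discrete values that is true on the diagonal is true everywhere.\<close>

lemma decidable_imp_discrete:
  assumes "decidable E X"
  shows "isomorphism E (\<beta> X)"
proof -
  obtain P p q d n where X: "X \<in> Obj E" and pr: "is_product E X X P p q" and d: "d \<in> Hom E X P"
    "p \<cdot>\<^bsub>E\<^esub> d = Ide E X" "q \<cdot>\<^bsub>E\<^esub> d = Ide E X" and n: "complement_of E (Cod E d) d n"
    using assms unfolding decidable_def complemented_def by blast
  have dm: "monic E d" using E.subobjectD(1)[OF E.complement_ofD(1)[OF n]] .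
  note P = E.is_productD[OF pr]
  have Om [simp]: "E.Om \<in> Obj E" by simp
  obtain c where c: "c \<in> Arr E" "Dom E c = P" "Cod E c = fobj F (fobj G E.Om)" "\<beta> E.Om \<cdot>\<^bsub>E\<^esub> c = E.chi d"
    using chi_complemented_discrete[OF n] d by auto
  obtain B s where s: "universal S E F X B s" using reflection[OF X] by blast
  note sD = F.universalD[OF s]
  obtain k k' where pb: "is_pullback E k k' s s"
    using E.pullback_exists[of s s] sD by auto
  note D = E.is_pullbackD[OF pb]
  obtain i where i: "i \<in> Arr E" "Dom E i = Dom E k" "Cod E i = P" "p \<cdot>\<^bsub>E\<^esub> i = k" "q \<cdot>\<^bsub>E\<^esub> i = k'"
    by (rule E.is_product_pair[OF pr, of k k']) (use D sD in simp_all)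
  obtain \<Delta> where \<Delta>: "\<Delta> \<in> Arr E" "Dom E \<Delta> = X" "Cod E \<Delta> = Dom E k" "k \<cdot>\<^bsub>E\<^esub> \<Delta> = Ide E X" "k' \<cdot>\<^bsub>E\<^esub> \<Delta> = Ide E X"
    by (rule E.is_pullback_pair[OF pb, of "Ide E X" "Ide E X"]) (use X sD in simp_all)
  have i\<Delta>: "i \<cdot>\<^bsub>E\<^esub> \<Delta> = d"
  proof (rule E.is_product_eqI[OF pr])
    show "p \<cdot>\<^bsub>E\<^esub> i \<cdot>\<^bsub>E\<^esub> \<Delta> = p \<cdot>\<^bsub>E\<^esub> d" "q \<cdot>\<^bsub>E\<^esub> i \<cdot>\<^bsub>E\<^esub> \<Delta> = q \<cdot>\<^bsub>E\<^esub> d"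
      using E.reduce[OF i(4), of \<Delta>] E.reduce[OF i(5), of \<Delta>] i(1-3) P \<Delta> d by simp_all
  qed (use i \<Delta> d in simp_all)
  obtain f where f: "f \<in> Arr S" "Dom S f = B" "Cod S f = fobj G E.Om" "farr F f \<cdot>\<^bsub>E\<^esub> s \<cdot>\<^bsub>E\<^esub> k = c \<cdot>\<^bsub>E\<^esub> i"
    using kernel_pair_reflection[OF s pb, of "fobj G E.Om" "c \<cdot>\<^bsub>E\<^esub> i"] c i by auto
  \<comment> \<open>As \<open>c i\<close> factors through \<open>s k\<close> and
    \<open>k \<Delta>\<close> is the identity, its value at a pair is its value at the diagonal pair
    formed from the first component.\<close>
  have "c \<cdot>\<^bsub>E\<^esub> i = (farr F f \<cdot>\<^bsub>E\<^esub> s \<cdot>\<^bsub>E\<^esub> k \<cdot>\<^bsub>E\<^esub> \<Delta>) \<cdot>\<^bsub>E\<^esub> k"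
    using f sD \<Delta> D(1-8) by simp
  also have "farr F f \<cdot>\<^bsub>E\<^esub> s \<cdot>\<^bsub>E\<^esub> k \<cdot>\<^bsub>E\<^esub> \<Delta> = (c \<cdot>\<^bsub>E\<^esub> i) \<cdot>\<^bsub>E\<^esub> \<Delta>"
    unfolding f(4)[symmetric] using f(1-3) sD \<Delta>(1-3) D(1-8) by simp
  also have "\<dots> = c \<cdot>\<^bsub>E\<^esub> d" using c i \<Delta> i\<Delta> by simp
  finally have ci: "c \<cdot>\<^bsub>E\<^esub> i = c \<cdot>\<^bsub>E\<^esub> d \<cdot>\<^bsub>E\<^esub> k" using c d D(1-8) sD by simp
  \<comment> \<open>\<open>chi d\<close> is \<open>true\<close> on the diagonal, hence on the whole
    kernel pair. So \<open>i\<close> factors through \<open>d\<close>, and the two projections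
    \<open>k\<close> and \<open>k'\<close> coincide.\<close>
  have "E.chi d \<cdot>\<^bsub>E\<^esub> i = \<beta> E.Om \<cdot>\<^bsub>E\<^esub> c \<cdot>\<^bsub>E\<^esub> i"
    using E.reduce[OF c(4), of i] c(1-3) i by simp
  also have "\<dots> = (\<beta> E.Om \<cdot>\<^bsub>E\<^esub> c) \<cdot>\<^bsub>E\<^esub> d \<cdot>\<^bsub>E\<^esub> k" unfolding ci using c(1-3) d D(1-8) sD by simp
  also have "\<dots> = (E.chi d \<cdot>\<^bsub>E\<^esub> d) \<cdot>\<^bsub>E\<^esub> k" unfolding c(4) using d D(1-8) sD dm by simp
  also have "\<dots> = E.tr (Dom E i)" using E.chi_comp_self[OF dm] d D(1-8) sD i by simp
  finally obtain h where h: "h \<in> Arr E" "Dom E h = Dom E i" "Cod E h = Dom E d" "d \<cdot>\<^bsub>E\<^esub> h = i"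
    using E.chi_iff[OF dm, of i] i d by auto
  have "k = h" using E.reduce[OF d(2), of h] h i P d(1) X by simp
  moreover have "k' = h" using E.reduce[OF d(3), of h] h i P d(1) X by simp
  ultimately have kk': "k = k'" by simp
  have "monic E s"
  proof (rule E.monicI)
    fix a b assume ab: "a \<in> Arr E" "b \<in> Arr E" "Dom E a = Dom E b" "Cod E a = Dom E s" "Cod E b = Dom E s"
      "s \<cdot>\<^bsub>E\<^esub> a = s \<cdot>\<^bsub>E\<^esub> b"
    obtain l where "k \<cdot>\<^bsub>E\<^esub> l = a" "k' \<cdot>\<^bsub>E\<^esub> l = b"
      by (rule E.is_pullback_pair[OF pb, of a b]) (use ab in simp_all)
    then show "a = b" using kk' by simp
  qed (use sD in simp)
  then show ?thesis using counit_isomorphism_if_subobject sD by metis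
qed

end

section \<open>Double-negation sheaves\<close>

context adj
begin

text \<open>In an adjoint triple \<open>F \<stileturn> G \<stileturn> R\<close>, arrows
  \<open>W \<rightarrow> G (R Z)\<close> correspond to arrows \<open>F W \<rightarrow> R Z\<close>,
  then to \<open>G (F W) \<rightarrow> Z\<close>, and through the invertible unit to
  \<open>W \<rightarrow> Z\<close>. The composite correspondence is composition with the counit at
  \<open>Z\<close>.\<close>

lemma counit_isomorphism_right_adjoint:
  assumes ff: "fully_faithful C D F" and R: "adj D C G R \<theta> \<epsilon>'" and Z: "Z \<in> Obj C"
  shows "isomorphism C (\<epsilon>' Z)"
proof -
  interpret R: adj D C G R \<theta> \<epsilon>' by (fact R)
  obtain j where j: "j \<in> Arr C" "Dom C j = fobj G (fobj F Z)" "Cod C j = Z"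
    "j \<cdot>\<^bsub>C\<^esub> \<eta> Z = Ide C Z" "\<eta> Z \<cdot>\<^bsub>C\<^esub> j = Ide C (fobj G (fobj F Z))"
    by (rule F.C.isomorphismE[OF unit_isomorphism[OF ff Z]]) (use Z in simp)
  obtain h where h: "h \<in> Arr D" "Dom D h = fobj F Z" "Cod D h = fobj R Z" "\<epsilon>' Z \<cdot>\<^bsub>C\<^esub> farr G h = j"
    by (rule R.counit_universal_ex[of "fobj F Z" j Z]) (use Z j in simp_all)
  have m: "monic C (\<epsilon>' Z)"
  proof (rule F.C.monicI)
    fix a b assume ab: "a \<in> Arr C" "b \<in> Arr C" "Dom C a = Dom C b" "Cod C a = Dom C (\<epsilon>' Z)"
      "Cod C b = Dom C (\<epsilon>' Z)" "\<epsilon>' Z \<cdot>\<^bsub>C\<^esub> a = \<epsilon>' Z \<cdot>\<^bsub>C\<^esub> b"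
    let ?W = "Dom C b" and ?RZ = "fobj R Z"
    \<comment> \<open>The transpose along \<open>F \<stileturn> G\<close>. Its image under
      \<open>G\<close> is \<open>a\<close> composed with the inverse \<open>i\<close> of the unit at
      \<open>?W\<close>.\<close>
    let ?t = "\<lambda>a. \<epsilon> ?RZ \<cdot>\<^bsub>D\<^esub> farr F a"
    have t: "farr G (?t a) \<cdot>\<^bsub>C\<^esub> \<eta> ?W = a" "farr G (?t b) \<cdot>\<^bsub>C\<^esub> \<eta> ?W = b"
      using counit_transpose[of a ?RZ] counit_transpose[of b ?RZ] ab Z by simp_all
    obtain i where i: "i \<in> Arr C" "Dom C i = fobj G (fobj F ?W)" "Cod C i = ?W"
      "\<eta> ?W \<cdot>\<^bsub>C\<^esub> i = Ide C (fobj G (fobj F ?W))"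
      by (rule F.C.isomorphismE[OF unit_isomorphism[OF ff, of ?W]]) (use ab in simp_all)
    have "\<epsilon>' Z \<cdot>\<^bsub>C\<^esub> farr G (?t c) = (\<epsilon>' Z \<cdot>\<^bsub>C\<^esub> c) \<cdot>\<^bsub>C\<^esub> i"
      if c: "farr G (?t c) \<cdot>\<^bsub>C\<^esub> \<eta> ?W = c" and cH: "c \<in> Arr C" "Dom C c = ?W" "Cod C c = fobj G ?RZ" for c
    proof -
      have "farr G (?t c) = (farr G (?t c) \<cdot>\<^bsub>C\<^esub> \<eta> ?W) \<cdot>\<^bsub>C\<^esub> i"
        using i cH Z ab by simp
      then have "farr G (?t c) = c \<cdot>\<^bsub>C\<^esub> i" unfolding c .
      then show ?thesis using cH i Z by simp
    qed
    then have "\<epsilon>' Z \<cdot>\<^bsub>C\<^esub> farr G (?t a) = \<epsilon>' Z \<cdot>\<^bsub>C\<^esub> farr G (?t b)"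
      using t ab Z by (metis R.dom_counit)
    then have "?t a = ?t b"
      by (rule R.counit_universal_eq[rotated -1]) (use ab Z in simp_all)
    then show "a = b" using t by metis
  qed (use Z in simp)
  have "\<epsilon>' Z \<cdot>\<^bsub>C\<^esub> farr G h \<cdot>\<^bsub>C\<^esub> \<eta> Z = Ide C Z"
    using F.C.reduce[OF h(4), of "\<eta> Z"] h(1-3) j(4) Z by simp
  then show ?thesis
    using F.C.monic_section_isomorphism(1)[OF m, of "farr G h \<cdot>\<^bsub>C\<^esub> \<eta> Z"] h(1-3) Z by simp
qed

end

locale precohesive = stable_reflection S E F G \<eta> \<beta> tE tS + R: adj E S G R \<theta> \<epsilon>
  for S :: "('so, 'sa) category" and E :: "('eo, 'ea) category"
    and F :: "('so, 'sa, 'eo, 'ea) functor_data" and G :: "('eo, 'ea, 'so, 'sa) functor_data"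
    and \<eta> :: "'so \<Rightarrow> 'sa" and \<beta> :: "'eo \<Rightarrow> 'ea" and tE :: 'ea and tS :: 'sa
    and R :: "('so, 'sa, 'eo, 'ea) functor_data" and \<theta> :: "'eo \<Rightarrow> 'ea" and \<epsilon> :: "'so \<Rightarrow> 'sa" +
  assumes boolean: "boolean_topos S"
begin

lemma counit_R_isomorphism: "Z \<in> Obj S \<Longrightarrow> isomorphism S (\<epsilon> Z)"
  using counit_isomorphism_right_adjoint[OF full_faithful R.adj_axioms] .

text \<open>The equalizer of \<open>u\<close> and \<open>v\<close> is a subobject of
  \<open>F B\<close>, hence comes from some \<open>w\<close> into \<open>B\<close>. As
  \<open>s\<close> factors through it, universality of \<open>s\<close> yields a section of
  \<open>w\<close>, so the equalizer is all of \<open>F B\<close>.\<close>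

lemma reflection_epic:
  assumes s: "universal S E F X B s" and u: "u \<in> Arr E" "Dom E u = fobj F B"
    and v: "v \<in> Arr E" "Dom E v = fobj F B" and "Cod E u = Cod E v" and us: "u \<cdot>\<^bsub>E\<^esub> s = v \<cdot>\<^bsub>E\<^esub> s"
  shows "u = v"
proof -
  note sD = F.universalD[OF s]
  obtain e where e: "monic E e" "Cod E e = Dom E u" "u \<cdot>\<^bsub>E\<^esub> e = v \<cdot>\<^bsub>E\<^esub> e"
    and eu: "\<And>a. a \<in> Arr E \<Longrightarrow> Cod E a = Dom E u \<Longrightarrow> u \<cdot>\<^bsub>E\<^esub> a = v \<cdot>\<^bsub>E\<^esub> a \<Longrightarrow>
      \<exists>h\<in>Arr E. Dom E h = Dom E a \<and> Cod E h = Dom E e \<and> e \<cdot>\<^bsub>E\<^esub> h = a"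
    by (rule E.equalizer_exists[of u v]) (use assms in simp_all)
  obtain w where w: "monic S w" "Cod S w = B" "sub_le E e (farr F w)" "sub_le E (farr F w) e"
    using subobject_discrete[of e B] e u sD by auto
  obtain a where a: "a \<in> Arr E" "Dom E a = Dom E e" "Cod E a = fobj F (Dom S w)" "farr F w \<cdot>\<^bsub>E\<^esub> a = e"
    using E.sub_leE[OF w(3)] w(1) by auto
  obtain b where b: "b \<in> Arr E" "Dom E b = fobj F (Dom S w)" "Cod E b = Dom E e" "e \<cdot>\<^bsub>E\<^esub> b = farr F w"
    using E.sub_leE[OF w(4)] w(1) by auto
  obtain h where h: "h \<in> Arr E" "Dom E h = X" "Cod E h = Dom E e" "e \<cdot>\<^bsub>E\<^esub> h = s"
    using eu[of s] us sD u by auto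
  obtain g where g: "g \<in> Arr S" "Dom S g = B" "Cod S g = Dom S w" "farr F g \<cdot>\<^bsub>E\<^esub> s = a \<cdot>\<^bsub>E\<^esub> h"
    by (rule F.universal_ex[OF s, of "Dom S w" "a \<cdot>\<^bsub>E\<^esub> h"]) (use a h w in simp_all)
  have "w \<cdot>\<^bsub>S\<^esub> g = Ide S B"
  proof (rule F.universal_eq[OF s])
    have "farr F (w \<cdot>\<^bsub>S\<^esub> g) \<cdot>\<^bsub>E\<^esub> s = farr F w \<cdot>\<^bsub>E\<^esub> a \<cdot>\<^bsub>E\<^esub> h"
      using g w sD by simp
    also have "\<dots> = s" using E.reduce[OF a(4), of h] a(1-3) h w by simp
    finally show "farr F (w \<cdot>\<^bsub>S\<^esub> g) \<cdot>\<^bsub>E\<^esub> s = farr F (Ide S B) \<cdot>\<^bsub>E\<^esub> s" using sD by simp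
  qed (use g w sD in simp_all)
  then have wg: "farr F w \<cdot>\<^bsub>E\<^esub> farr F g = Ide E (fobj F B)"
    using F.farr_comp[of g w] g w sD by simp
  have "e \<cdot>\<^bsub>E\<^esub> b \<cdot>\<^bsub>E\<^esub> farr F g = Ide E (fobj F B)"
    using E.reduce[OF b(4), of "farr F g"] b(1-3) e(1) g w wg by simp
  moreover have "u \<cdot>\<^bsub>E\<^esub> e \<cdot>\<^bsub>E\<^esub> b \<cdot>\<^bsub>E\<^esub> farr F g = v \<cdot>\<^bsub>E\<^esub> e \<cdot>\<^bsub>E\<^esub> b \<cdot>\<^bsub>E\<^esub> farr F g"
    using E.reduce[OF e(3), of "b \<cdot>\<^bsub>E\<^esub> farr F g"] e(1,2) u v b g by simp
  ultimately show ?thesis using u v by simp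
qed

text \<open>The Nullstellensatz: \<open>G X \<rightarrow> B\<close> is epic, as \<open>G\<close> is a left adjoint.\<close>

lemma G_reflects_initial:
  assumes X: "X \<in> Obj E" and init: "is_initial S (fobj G X)"
  shows "is_initial E X"
proof -
  obtain B s where s: "universal S E F X B s" using reflection[OF X] by blast
  note sD = F.universalD[OF s]
  obtain j where j: "j \<in> Arr S" "Dom S j = fobj G (fobj F B)" "Cod S j = B"
    "j \<cdot>\<^bsub>S\<^esub> \<eta> B = Ide S B"
    by (rule S.isomorphismE[OF unit_isomorphism[OF full_faithful, of B]]) (use sD in simp_all)
  have "u = v" if u: "u \<in> Arr S" "Dom S u = B" and v: "v \<in> Arr S" "Dom S v = B" and uv: "Cod S u = Cod S v" for u v
  proof -
    \<comment> \<open>The transpose \<open>F B \<rightarrow> R (Cod S u)\<close> of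
      \<open>u j\<close>, where \<open>j\<close> inverts the unit at \<open>B\<close>. Composing it
      with \<open>s\<close> transposes to composing \<open>u j\<close> with \<open>G s\<close>, and
      all arrows out of the initial \<open>G X\<close> agree. So the transposes agree on
      \<open>s\<close>, which is epic.\<close>
    let ?t = "\<lambda>u. farr R (u \<cdot>\<^bsub>S\<^esub> j) \<cdot>\<^bsub>E\<^esub> \<theta> (fobj F B)"
    have ts: "?t u \<cdot>\<^bsub>E\<^esub> s = farr R (u \<cdot>\<^bsub>S\<^esub> j \<cdot>\<^bsub>S\<^esub> farr G s) \<cdot>\<^bsub>E\<^esub> \<theta> X" if "u \<in> Arr S" "Dom S u = B" for u
      using R.unit_natural[of s] sD j(1-3) that by simp
    have "u \<cdot>\<^bsub>S\<^esub> j \<cdot>\<^bsub>S\<^esub> farr G s = v \<cdot>\<^bsub>S\<^esub> j \<cdot>\<^bsub>S\<^esub> farr G s"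
      by (rule S.is_initialD[OF init]) (use u v uv j sD in simp_all)
    then have "?t u \<cdot>\<^bsub>E\<^esub> s = ?t v \<cdot>\<^bsub>E\<^esub> s" using ts u v by simp
    then have "?t u = ?t v" by (rule reflection_epic[OF s, rotated -1]) (use u v uv j sD in simp_all)
    then have "u \<cdot>\<^bsub>S\<^esub> j = v \<cdot>\<^bsub>S\<^esub> j"
      by (rule R.unit_universal_eq[rotated -1]) (use u v uv j sD in simp_all)
    then have "(u \<cdot>\<^bsub>S\<^esub> j) \<cdot>\<^bsub>S\<^esub> \<eta> B = (v \<cdot>\<^bsub>S\<^esub> j) \<cdot>\<^bsub>S\<^esub> \<eta> B" by simp
    then show ?thesis using u v j sD by simp
  qed
  \<comment> \<open>Parallel arrows out of \<open>B\<close> agree. For \<open>false\<close> and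
    \<open>true\<close> this says that \<open>B\<close> is initial.\<close>
  from this[of "S.fl B" "S.tr B"] have "S.fl B = S.tr B" using sD by simp
  then have "is_initial S B" using S.fl_eq_tr_iff sD by simp
  then have "is_initial E (fobj F B)" by (rule F_initial)
  then show ?thesis using E.initial_strict[of "fobj F B" s] sD by simp
qed

text \<open>By transposition, an arrow that factors the counit through \<open>m\<close> is a section
  of \<open>G m\<close>, which is monic since \<open>G\<close> is a right adjoint.\<close>

lemma counit_le_iff_G_isomorphism:
  assumes m: "monic E m"
  shows "sub_le E (\<beta> (Cod E m)) m \<longleftrightarrow> isomorphism S (farr G m)"
proof
  have mA: "m \<in> Arr E" "Cod E m \<in> Obj E" using m by simp_all
  assume "sub_le E (\<beta> (Cod E m)) m"
  then obtain s where s: "s \<in> Arr E" "Dom E s = fobj F (fobj G (Cod E m))" "Cod E s = Dom E m"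
    "m \<cdot>\<^bsub>E\<^esub> s = \<beta> (Cod E m)"
    using E.sub_leE mA by (metis dom_counit)
  have "farr G m \<cdot>\<^bsub>S\<^esub> farr G s \<cdot>\<^bsub>S\<^esub> \<eta> (fobj G (Cod E m)) = Ide S (fobj G (Cod E m))"
    using S.reduce[OF G.farr_eq[OF s(4)], of "\<eta> (fobj G (Cod E m))"] triangle_G[OF mA(2)] s mA by simp
  then show "isomorphism S (farr G m)"
    using S.monic_section_isomorphism(1)[OF G_monic[OF m], of "farr G s \<cdot>\<^bsub>S\<^esub> \<eta> (fobj G (Cod E m))"] s mA
    by simp
next
  have mA: "m \<in> Arr E" "Cod E m \<in> Obj E" using m by simp_all
  assume "isomorphism S (farr G m)"
  then obtain k where k: "k \<in> Arr S" "Dom S k = fobj G (Cod E m)" "Cod S k = fobj G (Dom E m)"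
    "farr G m \<cdot>\<^bsub>S\<^esub> k = Ide S (fobj G (Cod E m))"
    using S.isomorphismE mA by (metis G.dom_farr G.cod_farr)
  have "m \<cdot>\<^bsub>E\<^esub> \<beta> (Dom E m) \<cdot>\<^bsub>E\<^esub> farr F k = \<beta> (Cod E m) \<cdot>\<^bsub>E\<^esub> farr F (farr G m) \<cdot>\<^bsub>E\<^esub> farr F k"
    using E.reduce[OF counit_natural[OF mA(1)], of "farr F k"] k mA by simp
  also have "farr F (farr G m) \<cdot>\<^bsub>E\<^esub> farr F k = Ide E (fobj F (fobj G (Cod E m)))"
    using F.farr_eq[OF k(4)] k(1-3) mA by simp
  finally have "m \<cdot>\<^bsub>E\<^esub> \<beta> (Dom E m) \<cdot>\<^bsub>E\<^esub> farr F k = \<beta> (Cod E m)" using mA by simp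
  then show "sub_le E (\<beta> (Cod E m)) m"
    using k mA by (intro E.sub_leI[of "\<beta> (Dom E m) \<cdot>\<^bsub>E\<^esub> farr F k"]) simp_all
qed

text \<open>If \<open>m\<close> is dense, the complement \<open>n\<close> of \<open>G m\<close>
  transposes to an arrow \<open>F N \<rightarrow> X\<close> disjoint from \<open>m\<close>; so
  \<open>N\<close> is initial and \<open>G m\<close> is everything. Conversely, if \<open>m\<close>
  contains the discrete part of \<open>X\<close> and \<open>a : W \<rightarrow> X\<close> is
  disjoint from \<open>m\<close>, then the discrete part of \<open>W\<close> is initial, hence so
  are \<open>G W\<close> and \<open>W\<close>.\<close>

lemma dense_iff_G_isomorphism:
  assumes j: "double_negation E tE j"
  shows "dense E tE j m \<longleftrightarrow> monic E m \<and> isomorphism S (farr G m)"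
proof (cases "monic E m")
  case m: True
  have mA: "m \<in> Arr E" "Cod E m \<in> Obj E" "Dom E m \<in> Obj E" using m by simp_all
  let ?X = "Cod E m" and ?A = "Dom E m"
  show ?thesis
  proof
    assume "dense E tE j m"
    then have dense: "is_initial E (Dom E a)" if "a \<in> Arr E" "Cod E a = ?X"
      "\<And>u v. u \<in> Arr E \<Longrightarrow> v \<in> Arr E \<Longrightarrow> Cod E u = Dom E a \<Longrightarrow> Cod E v = ?A \<Longrightarrow> Dom E u = Dom E v \<Longrightarrow>
        a \<cdot>\<^bsub>E\<^esub> u = m \<cdot>\<^bsub>E\<^esub> v \<Longrightarrow> is_initial E (Dom E u)" for a
      using that unfolding E.dense_iff[OF j] by blast
    have Gm: "monic S (farr G m)" using G_monic[OF m] .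
    then obtain n where n: "complement_of S (fobj G ?X) (farr G m) n"
      using boolean mA unfolding boolean_topos_def complemented_def by (metis G.cod_farr)
    note nD = S.subobjectD[OF S.complement_ofD(2)[OF n]]
    let ?N = "Dom S n"
    let ?a = "\<beta> ?X \<cdot>\<^bsub>E\<^esub> farr F n"
    have "is_initial E (Dom E ?a)"
    proof (rule dense)
      fix u v assume u: "u \<in> Arr E" "Cod E u = Dom E ?a" and v: "v \<in> Arr E" "Cod E v = ?A"
        and uv: "Dom E u = Dom E v" "?a \<cdot>\<^bsub>E\<^esub> u = m \<cdot>\<^bsub>E\<^esub> v"
      have uN: "Cod E u = fobj F ?N" using u nD mA by simp
      obtain i where i: "i \<in> Arr S" "Dom S i = fobj G (fobj F ?N)" "Cod S i = ?N"
        "\<eta> ?N \<cdot>\<^bsub>S\<^esub> i = Ide S (fobj G (fobj F ?N))"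
        by (rule S.isomorphismE[OF unit_isomorphism[OF full_faithful, of ?N]]) (use nD in simp_all)
      \<comment> \<open>Applying \<open>G\<close> turns a common element of \<open>?a\<close> and
        \<open>m\<close> into one of \<open>n\<close> and \<open>G m\<close>. The arrow
        \<open>i\<close> undoes the unit at \<open>?N\<close>, which brings \<open>G u\<close> back
        to an element of \<open>?N\<close>.\<close>
      let ?b = "i \<cdot>\<^bsub>S\<^esub> farr G u"
      have "farr G m \<cdot>\<^bsub>S\<^esub> farr G v = farr G (?a \<cdot>\<^bsub>E\<^esub> u)"
        unfolding uv(2) using v mA by simp
      also have "\<dots> = farr G (\<beta> ?X) \<cdot>\<^bsub>S\<^esub> farr G (farr F n) \<cdot>\<^bsub>S\<^esub> farr G u"
        using u(1) uN nD mA by simp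
      also have "farr G u = \<eta> ?N \<cdot>\<^bsub>S\<^esub> ?b"
        using S.reduce[OF i(4), of "farr G u"] i(1-3) u(1) uN nD by simp
      also have "farr G (farr F n) \<cdot>\<^bsub>S\<^esub> \<eta> ?N \<cdot>\<^bsub>S\<^esub> ?b = \<eta> (fobj G ?X) \<cdot>\<^bsub>S\<^esub> n \<cdot>\<^bsub>S\<^esub> ?b"
        using S.reduce[OF unit_natural[OF nD(3)], of ?b] i(1-3) u(1) uN nD by simp
      also have "farr G (\<beta> ?X) \<cdot>\<^bsub>S\<^esub> \<eta> (fobj G ?X) \<cdot>\<^bsub>S\<^esub> n \<cdot>\<^bsub>S\<^esub> ?b = n \<cdot>\<^bsub>S\<^esub> ?b"
        using S.reduce[OF triangle_G[OF mA(2)], of "n \<cdot>\<^bsub>S\<^esub> ?b"] i(1-3) u(1) uN nD mA by simp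
      finally have "is_initial S (Dom S (farr G v))"
        by (rule S.complement_disjoint[OF n, rotated -1]) (use u(1) uN uv(1) v i(1-3) nD mA in simp_all)
      then have "is_initial E (Dom E v)" using G_reflects_initial v by simp
      then show "is_initial E (Dom E u)" using uv by simp
    qed (use nD mA in simp_all)
    then have N: "is_initial S ?N" using F_initial_imp_initial nD mA by simp
    obtain h where h: "h \<in> Arr S" "Dom S h = ?N" "Cod S h = fobj G ?A"
      by (rule S.is_initialE[OF N, of "fobj G ?A"]) (use mA in simp)
    have "farr G m \<cdot>\<^bsub>S\<^esub> h = n" by (rule S.is_initialD[OF N]) (use h nD mA in simp_all)
    then have "sub_le S n (farr G m)" using h mA by (intro S.sub_leI[of h]) simp_all
    moreover have "sub_le S (farr G m) (farr G m)"
      by (rule S.sub_leI[of "Ide S (fobj G ?A)"]) (use mA in simp_all)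
    moreover have "subobject S (fobj G ?X) (Ide S (fobj G ?X))" using mA unfolding subobject_def by simp
    ultimately have "sub_le S (Ide S (fobj G ?X)) (farr G m)"
      using n S.complement_ofD(1)[OF n] unfolding complement_of_def by blast
    then obtain k where "k \<in> Arr S" "Cod S k = fobj G ?A" "farr G m \<cdot>\<^bsub>S\<^esub> k = Ide S (fobj G ?X)"
      using S.sub_leE mA by (metis G.dom_farr)
    then show "monic E m \<and> isomorphism S (farr G m)"
      using m S.monic_section_isomorphism(1)[OF Gm, of k] mA by simp
  next
    assume "monic E m \<and> isomorphism S (farr G m)"
    then have "sub_le E (\<beta> ?X) m" using counit_le_iff_G_isomorphism[OF m] by simp
    then obtain s where s: "s \<in> Arr E" "Dom E s = fobj F (fobj G ?X)" "Cod E s = ?A" "m \<cdot>\<^bsub>E\<^esub> s = \<beta> ?X"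
      using E.sub_leE mA by (metis dom_counit)
    have "is_initial E (Dom E a)" if a: "a \<in> Arr E" "Cod E a = ?X"
      and H: "\<forall>u\<in>Arr E. \<forall>v\<in>Arr E. Cod E u = Dom E a \<longrightarrow> Cod E v = ?A \<longrightarrow> Dom E u = Dom E v \<longrightarrow>
        a \<cdot>\<^bsub>E\<^esub> u = m \<cdot>\<^bsub>E\<^esub> v \<longrightarrow> is_initial E (Dom E u)" for a
    proof -
      let ?W = "Dom E a"
      \<comment> \<open>The discrete part of \<open>?W\<close> lands in that of \<open>?X\<close>,
        hence in \<open>m\<close>, so it is a common part of \<open>a\<close> and
        \<open>m\<close>.\<close>
      have "a \<cdot>\<^bsub>E\<^esub> \<beta> ?W = m \<cdot>\<^bsub>E\<^esub> s \<cdot>\<^bsub>E\<^esub> farr F (farr G a)"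
        using counit_natural[OF a(1)] E.reduce[OF s(4), of "farr F (farr G a)"] s(1-3) a mA by simp
      then have "is_initial E (Dom E (\<beta> ?W))"
        using H[rule_format, of "\<beta> ?W" "s \<cdot>\<^bsub>E\<^esub> farr F (farr G a)"] a s(1-3) by simp
      then have "is_initial S (fobj G ?W)" using F_initial_imp_initial a by simp
      then show ?thesis using G_reflects_initial a by simp
    qed
    then show "dense E tE j m" unfolding E.dense_iff[OF j] using m by blast
  qed
qed (simp add: E.dense_iff[OF j])

text \<open>Extending \<open>f\<close> along a dense \<open>m\<close> transposes to extending an
  arrow into \<open>Z\<close> along \<open>G m\<close>, which is invertible.\<close>

lemma R_is_sheaf:
  assumes j: "double_negation E tE j" and Z: "Z \<in> Obj S"
  shows "is_sheaf E tE j (fobj R Z)"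
proof -
  have "\<exists>!g. g \<in> Hom E (Cod E m) (fobj R Z) \<and> g \<cdot>\<^bsub>E\<^esub> m = f"
    if m: "dense E tE j m" and f: "f \<in> Hom E (Dom E m) (fobj R Z)" for m f
  proof -
    have mA: "m \<in> Arr E" "Cod E m \<in> Obj E" "Dom E m \<in> Obj E" "isomorphism S (farr G m)"
      using m unfolding dense_iff_G_isomorphism[OF j] by simp_all
    obtain k where k: "k \<in> Arr S" "Dom S k = fobj G (Cod E m)" "Cod S k = fobj G (Dom E m)"
      "k \<cdot>\<^bsub>S\<^esub> farr G m = Ide S (fobj G (Dom E m))" "farr G m \<cdot>\<^bsub>S\<^esub> k = Ide S (fobj G (Cod E m))"
      by (rule S.isomorphismE[OF mA(4)]) (use mA in simp)
    obtain g where g: "g \<in> Arr E" "Dom E g = Cod E m" "Cod E g = fobj R Z"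
      "\<epsilon> Z \<cdot>\<^bsub>S\<^esub> farr G g = \<epsilon> Z \<cdot>\<^bsub>S\<^esub> farr G f \<cdot>\<^bsub>S\<^esub> k"
      by (rule R.counit_universal_ex[of "Cod E m" "\<epsilon> Z \<cdot>\<^bsub>S\<^esub> farr G f \<cdot>\<^bsub>S\<^esub> k" Z]) (use Z f k mA in simp_all)
    have "g \<cdot>\<^bsub>E\<^esub> m = f"
    proof (rule R.counit_universal_eq[of _ _ Z])
      have "\<epsilon> Z \<cdot>\<^bsub>S\<^esub> farr G (g \<cdot>\<^bsub>E\<^esub> m) = (\<epsilon> Z \<cdot>\<^bsub>S\<^esub> farr G g) \<cdot>\<^bsub>S\<^esub> farr G m"
        using g(1-3) mA Z by simp
      also have "\<dots> = \<epsilon> Z \<cdot>\<^bsub>S\<^esub> farr G f" unfolding g(4) using k f mA Z by simp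
      finally show "\<epsilon> Z \<cdot>\<^bsub>S\<^esub> farr G (g \<cdot>\<^bsub>E\<^esub> m) = \<epsilon> Z \<cdot>\<^bsub>S\<^esub> farr G f" .
    qed (use g f mA Z in simp_all)
    moreover have "g' = g" if g': "g' \<in> Hom E (Cod E m) (fobj R Z)" "g' \<cdot>\<^bsub>E\<^esub> m = f" for g'
    proof (rule R.counit_universal_eq[of _ _ Z])
      have "farr G g' = (farr G g' \<cdot>\<^bsub>S\<^esub> farr G m) \<cdot>\<^bsub>S\<^esub> k"
        using g' k mA Z by simp
      also have "farr G g' \<cdot>\<^bsub>S\<^esub> farr G m = farr G f"
        using G.farr_eq[OF g'(2)] g'(1) mA by simp
      finally show "\<epsilon> Z \<cdot>\<^bsub>S\<^esub> farr G g' = \<epsilon> Z \<cdot>\<^bsub>S\<^esub> farr G g" using g(4) by simp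
    qed (use g g' mA Z in simp_all)
    moreover have "g \<in> Hom E (Cod E m) (fobj R Z)" using g by simp
    ultimately show ?thesis by blast
  qed
  then show ?thesis unfolding is_sheaf_def using Z by simp
qed

text \<open>\<open>G\<close> inverts \<open>\<theta> X\<close>. Arrows \<open>a\<close> and
  \<open>b\<close> identified by \<open>\<theta> X\<close> have equal images under \<open>G\<close>,
  so their equalizer contains the discrete part and is dense; maps into a sheaf that agree on a
  dense part are equal. Thus \<open>\<theta> X\<close> is a dense monic between two sheaves, and
  such a monic is invertible.\<close>

lemma sheaf_unit_isomorphism:
  assumes j: "double_negation E tE j" and sh: "is_sheaf E tE j X"
  shows "isomorphism E (\<theta> X)"
proof -
  have X: "X \<in> Obj E" using sh unfolding is_sheaf_def by simp
  let ?RX = "fobj R (fobj G X)"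
  have sheafD: "\<exists>!g. g \<in> Hom E (Cod E m) Y \<and> g \<cdot>\<^bsub>E\<^esub> m = f"
    if "is_sheaf E tE j Y" "dense E tE j m" "f \<in> Hom E (Dom E m) Y" for m f Y
    using that unfolding is_sheaf_def by blast
  obtain k where k: "k \<in> Arr S" "Dom S k = fobj G X" "Cod S k = fobj G ?RX"
    "k \<cdot>\<^bsub>S\<^esub> \<epsilon> (fobj G X) = Ide S (fobj G ?RX)" "\<epsilon> (fobj G X) \<cdot>\<^bsub>S\<^esub> k = Ide S (fobj G X)"
    by (rule S.isomorphismE[OF counit_R_isomorphism[of "fobj G X"]]) (use X in simp_all)
  have "k \<cdot>\<^bsub>S\<^esub> \<epsilon> (fobj G X) \<cdot>\<^bsub>S\<^esub> farr G (\<theta> X) = k"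
    using R.triangle_F[OF X] k(1-3) by simp
  then have "farr G (\<theta> X) = k"
    using S.reduce[OF k(4), of "farr G (\<theta> X)"] k(1-3) X by simp
  then have iso: "isomorphism S (farr G (\<theta> X))"
    using k X by (intro S.isomorphismI[of _ "\<epsilon> (fobj G X)"]) simp_all
  have mono: "monic E (\<theta> X)"
  proof (rule E.monicI)
    fix a b assume ab: "a \<in> Arr E" "b \<in> Arr E" "Dom E a = Dom E b" "Cod E a = Dom E (\<theta> X)"
      "Cod E b = Dom E (\<theta> X)" "\<theta> X \<cdot>\<^bsub>E\<^esub> a = \<theta> X \<cdot>\<^bsub>E\<^esub> b"
    let ?W = "Dom E b"
    have "farr G (\<theta> X) \<cdot>\<^bsub>S\<^esub> farr G a = farr G (\<theta> X) \<cdot>\<^bsub>S\<^esub> farr G b"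
      using G.farr_eq[OF ab(6)] ab(1-5) X by simp
    then have Gab: "farr G a = farr G b"
      by (rule S.monicD[OF S.isomorphism_monic[OF iso]]) (use ab X in simp_all)
    obtain e where e: "monic E e" "Cod E e = Dom E a" "a \<cdot>\<^bsub>E\<^esub> e = b \<cdot>\<^bsub>E\<^esub> e"
      and eu: "\<And>c. c \<in> Arr E \<Longrightarrow> Cod E c = Dom E a \<Longrightarrow> a \<cdot>\<^bsub>E\<^esub> c = b \<cdot>\<^bsub>E\<^esub> c \<Longrightarrow>
        \<exists>h\<in>Arr E. Dom E h = Dom E c \<and> Cod E h = Dom E e \<and> e \<cdot>\<^bsub>E\<^esub> h = c"
      by (rule E.equalizer_exists[of a b]) (use ab X in simp_all)
    have "a \<cdot>\<^bsub>E\<^esub> \<beta> ?W = b \<cdot>\<^bsub>E\<^esub> \<beta> ?W"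
      using counit_natural[OF ab(1)] counit_natural[OF ab(2)] Gab ab X by simp
    then have "\<exists>h\<in>Arr E. Dom E h = Dom E (\<beta> ?W) \<and> Cod E h = Dom E e \<and> e \<cdot>\<^bsub>E\<^esub> h = \<beta> ?W"
      by (intro eu) (use ab in simp_all)
    then have "sub_le E (\<beta> (Cod E e)) e" using e(2) ab(3) by (auto intro: E.sub_leI)
    then have d: "dense E tE j e"
      using dense_iff_G_isomorphism[OF j] counit_le_iff_G_isomorphism[OF e(1)] e(1) by simp
    have "b \<cdot>\<^bsub>E\<^esub> e \<in> Hom E (Dom E e) X" using e ab X by simp
    from sheafD[OF sh d this] have "\<exists>!g. g \<in> Hom E (Dom E a) X \<and> g \<cdot>\<^bsub>E\<^esub> e = b \<cdot>\<^bsub>E\<^esub> e"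
      unfolding e(2) .
    moreover have "a \<in> Hom E (Dom E a) X" "b \<in> Hom E (Dom E a) X" using ab(1-5) X by simp_all
    ultimately show "a = b" using e(3) by blast
  qed (use X in simp)
  have d: "dense E tE j (\<theta> X)" using dense_iff_G_isomorphism[OF j] mono iso by simp
  have "Ide E X \<in> Hom E (Dom E (\<theta> X)) X" using X by simp
  \<comment> \<open>Extending the identity of \<open>X\<close> along the dense
    \<open>\<theta> X\<close> gives a retraction \<open>r\<close>. The other composite is the
    identity because extensions into the sheaf \<open>?RX\<close> are unique.\<close>
  from sheafD[OF sh d this] obtain r where r: "r \<in> Arr E" "Dom E r = ?RX" "Cod E r = X" "r \<cdot>\<^bsub>E\<^esub> \<theta> X = Ide E X"
    using X by auto
  have RX: "is_sheaf E tE j ?RX" using R_is_sheaf[OF j] X by simp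
  have "\<theta> X \<in> Hom E (Dom E (\<theta> X)) ?RX" using X by simp
  from sheafD[OF RX d this]
  have "\<exists>!g. g \<in> Hom E ?RX ?RX \<and> g \<cdot>\<^bsub>E\<^esub> \<theta> X = \<theta> X" using X by simp
  moreover have "\<theta> X \<cdot>\<^bsub>E\<^esub> r \<in> Hom E ?RX ?RX" "(\<theta> X \<cdot>\<^bsub>E\<^esub> r) \<cdot>\<^bsub>E\<^esub> \<theta> X = \<theta> X" using r X by simp_all
  moreover have "Ide E ?RX \<in> Hom E ?RX ?RX" "Ide E ?RX \<cdot>\<^bsub>E\<^esub> \<theta> X = \<theta> X" using X by simp_all
  ultimately have "\<theta> X \<cdot>\<^bsub>E\<^esub> r = Ide E ?RX" by blast
  then show ?thesis using r X by (intro E.isomorphismI[of _ r]) simp_all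
qed

end

section \<open>The equivalences\<close>

lemma comp_id_functor [simp]: "F \<odot> id_functor = F" "id_functor \<odot> F = F"
  unfolding comp_functor_def id_functor_def by simp_all

lemma full_subcategory_simps [simp]:
  "Obj (full_subcategory C P) = {X \<in> Obj C. P X}"
  "Arr (full_subcategory C P) = {f \<in> Arr C. P (Dom C f) \<and> P (Cod C f)}"
  "Dom (full_subcategory C P) = Dom C" "Cod (full_subcategory C P) = Cod C"
  "Ide (full_subcategory C P) = Ide C" "Comp (full_subcategory C P) = Comp C"
  unfolding full_subcategory_def by simp_all

lemma is_category_full_subcategory: "is_category C \<Longrightarrow> is_category (full_subcategory C P)"
  unfolding is_category_def by simp

lemma is_functor_from_full_subcategory: "is_functor C D F \<Longrightarrow> is_functor (full_subcategory C P) D F"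
  unfolding is_functor_def by simp

lemma is_functor_to_full_subcategory:
  "is_category C \<Longrightarrow> is_functor C D F \<Longrightarrow> (\<And>X. X \<in> Obj C \<Longrightarrow> P (fobj F X)) \<Longrightarrow>
    is_functor C (full_subcategory D P) F"
  unfolding is_functor_def is_category_def by simp

lemma is_functor_id: "is_category C \<Longrightarrow> is_functor C C id_functor"
  unfolding is_functor_def id_functor_def is_category_def by simp

lemma isomorphism_full_subcategory:
  "isomorphism C f \<Longrightarrow> P (Dom C f) \<Longrightarrow> P (Cod C f) \<Longrightarrow> isomorphism (full_subcategory C P) f"
  unfolding isomorphism_def by auto

lemma nat_isomorphic_full_subcategory:
  assumes "nat_trans C C F F' \<tau>"
    and "\<And>X. X \<in> Obj C \<Longrightarrow> P X \<Longrightarrow> P (fobj F X) \<and> P (fobj F' X) \<and> isomorphism C (\<tau> X)"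
  shows "nat_isomorphic (full_subcategory C P) (full_subcategory C P) F F'"
  unfolding nat_isomorphic_def
  using assms by (intro exI[of _ \<tau>]) (simp add: nat_trans_def isomorphism_full_subcategory)

lemma nat_isomorphic_refl:
  assumes "is_category D" "is_functor C D F"
  shows "nat_isomorphic C D F F"
proof -
  interpret cat D by (rule cat.intro) (fact assms(1))
  have "isomorphism D (Ide D (fobj F X))" if "X \<in> Obj C" for X
    using that assms(2) by (intro isomorphismI[of _ "Ide D (fobj F X)"]) (simp_all add: is_functor_def)
  then show ?thesis
    unfolding nat_isomorphic_def nat_trans_def using assms(2)
    by (intro exI[of _ "\<lambda>X. Ide D (fobj F X)"]) (simp add: is_functor_def)
qed

lemma nat_isomorphic_sym:
  assumes C: "is_category C" and D: "is_category D" and F: "is_functor C D F" and F': "is_functor C D F'"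
    and iso: "nat_isomorphic C D F F'"
  shows "nat_isomorphic C D F' F"
proof -
  interpret F: func C D F using C D F by (simp add: func_def func_axioms_def cat_def)
  interpret F': func C D F' using C D F' by (simp add: func_def func_axioms_def cat_def)
  obtain \<tau> where \<tau>: "\<And>X. X \<in> Obj C \<Longrightarrow> \<tau> X \<in> Hom D (fobj F X) (fobj F' X) \<and> isomorphism D (\<tau> X)"
    and nat: "\<And>f. f \<in> Arr C \<Longrightarrow> farr F' f \<cdot>\<^bsub>D\<^esub> \<tau> (Dom C f) = \<tau> (Cod C f) \<cdot>\<^bsub>D\<^esub> farr F f"
    using iso unfolding nat_isomorphic_def nat_trans_def by blast
  define \<sigma> where "\<sigma> X = (SOME g. g \<in> Hom D (fobj F' X) (fobj F X) \<and> g \<cdot>\<^bsub>D\<^esub> \<tau> X = Ide D (fobj F X) \<and>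
    \<tau> X \<cdot>\<^bsub>D\<^esub> g = Ide D (fobj F' X))" for X
  have \<sigma>: "\<sigma> X \<in> Hom D (fobj F' X) (fobj F X) \<and> \<sigma> X \<cdot>\<^bsub>D\<^esub> \<tau> X = Ide D (fobj F X) \<and>
    \<tau> X \<cdot>\<^bsub>D\<^esub> \<sigma> X = Ide D (fobj F' X)" if "X \<in> Obj C" for X
    unfolding \<sigma>_def by (rule someI_ex) (use \<tau>[OF that] in \<open>auto simp: isomorphism_def\<close>)
  have "isomorphism D (\<sigma> X)" if "X \<in> Obj C" for X
    using \<sigma>[OF that] \<tau>[OF that] by (intro F.D.isomorphismI[of _ "\<tau> X"]) simp_all
  moreover have "farr F f \<cdot>\<^bsub>D\<^esub> \<sigma> (Dom C f) = \<sigma> (Cod C f) \<cdot>\<^bsub>D\<^esub> farr F' f" if f: "f \<in> Arr C" for f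
  proof -
    let ?X = "Dom C f" and ?Y = "Cod C f"
    have X: "?X \<in> Obj C" and Y: "?Y \<in> Obj C" using f by simp_all
    have tX: "\<tau> ?X \<in> Arr D" "Dom D (\<tau> ?X) = fobj F ?X" "Cod D (\<tau> ?X) = fobj F' ?X"
      and tY: "\<tau> ?Y \<in> Arr D" "Dom D (\<tau> ?Y) = fobj F ?Y" "Cod D (\<tau> ?Y) = fobj F' ?Y"
      using \<tau>[OF X] \<tau>[OF Y] by simp_all
    have sX: "\<sigma> ?X \<in> Arr D" "Dom D (\<sigma> ?X) = fobj F' ?X" "Cod D (\<sigma> ?X) = fobj F ?X"
      and sY: "\<sigma> ?Y \<in> Arr D" "Dom D (\<sigma> ?Y) = fobj F' ?Y" "Cod D (\<sigma> ?Y) = fobj F ?Y"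
      and st: "\<sigma> ?Y \<cdot>\<^bsub>D\<^esub> \<tau> ?Y = Ide D (fobj F ?Y)" and ts: "\<tau> ?X \<cdot>\<^bsub>D\<^esub> \<sigma> ?X = Ide D (fobj F' ?X)"
      using \<sigma>[OF X] \<sigma>[OF Y] by simp_all
    have "farr F f \<cdot>\<^bsub>D\<^esub> \<sigma> ?X = \<sigma> ?Y \<cdot>\<^bsub>D\<^esub> \<tau> ?Y \<cdot>\<^bsub>D\<^esub> farr F f \<cdot>\<^bsub>D\<^esub> \<sigma> ?X"
      using F.D.reduce[OF st, of "farr F f \<cdot>\<^bsub>D\<^esub> \<sigma> ?X"] tY sX sY f by simp
    also have "\<tau> ?Y \<cdot>\<^bsub>D\<^esub> farr F f \<cdot>\<^bsub>D\<^esub> \<sigma> ?X = farr F' f \<cdot>\<^bsub>D\<^esub> \<tau> ?X \<cdot>\<^bsub>D\<^esub> \<sigma> ?X"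
      using F.D.reduce[OF nat[OF f, symmetric], of "\<sigma> ?X"] tX tY sX f by simp
    also have "\<dots> = farr F' f" unfolding ts using f by simp
    finally show ?thesis .
  qed
  ultimately show ?thesis
    unfolding nat_isomorphic_def nat_trans_def using \<sigma> by (intro exI[of _ \<sigma>]) blast
qed

text \<open>\<open>quasi_inverse\<close> is directed, with isomorphisms
  \<open>1 \<rightarrow> G F\<close> and \<open>F G \<rightarrow> 1\<close>, so both have to be
  inverted. Units and counits supply one orientation for each equivalence; the theorem uses the
  other as well.\<close>

lemma quasi_inverse_sym:
  assumes "is_category C" "is_category D" "quasi_inverse C D F G"
  shows "quasi_inverse D C G F"
proof -
  have F: "is_functor C D F" and G: "is_functor D C G" using assms(3) unfolding quasi_inverse_def by blast+
  then have GF: "is_functor C C (G \<odot> F)" and FG: "is_functor D D (F \<odot> G)"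
    using assms(1,2) unfolding is_functor_def comp_functor_def by (simp_all add: is_category_def)
  have "nat_isomorphic C C id_functor (G \<odot> F)" "nat_isomorphic D D (F \<odot> G) id_functor"
    using assms(3) unfolding quasi_inverse_def by blast+
  then have "nat_isomorphic C C (G \<odot> F) id_functor" "nat_isomorphic D D id_functor (F \<odot> G)"
    using nat_isomorphic_sym[OF assms(1,1) is_functor_id[OF assms(1)] GF]
      nat_isomorphic_sym[OF assms(2,2) FG is_functor_id[OF assms(2)]] by simp_all
  then show ?thesis using F G unfolding quasi_inverse_def by simp
qed

lemma (in cat) is_sheaf_isomorphism:
  assumes sh: "is_sheaf C t j X" and f: "isomorphism C f" "Dom C f = X"
  shows "is_sheaf C t j (Cod C f)"
proof -
  obtain g where fA: "f \<in> Arr C" and g: "g \<in> Arr C" "Dom C g = Cod C f" "Cod C g = Dom C f"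
    and gf: "g \<cdot> f = Ide C (Dom C f)" and fg: "f \<cdot> g = Ide C (Cod C f)"
    using f(1) isomorphismE by metis
  have "\<exists>!l. l \<in> Hom C (Cod C m) (Cod C f) \<and> l \<cdot> m = h"
    if m: "dense C t j m" and h: "h \<in> Hom C (Dom C m) (Cod C f)" for m h
  proof -
    have mA: "m \<in> Arr C" using m unfolding dense_def is_closure_def by simp
    have "g \<cdot> h \<in> Hom C (Dom C m) X" using g h f(2) by simp
    then have ex: "\<exists>!l. l \<in> Hom C (Cod C m) X \<and> l \<cdot> m = g \<cdot> h"
      using sh m unfolding is_sheaf_def by blast
    then obtain l where l: "l \<in> Hom C (Cod C m) X" "l \<cdot> m = g \<cdot> h" by blast
    have "f \<cdot> l \<in> Hom C (Cod C m) (Cod C f) \<and> (f \<cdot> l) \<cdot> m = h"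
      using l(1) fA f(2) mA h reduce[OF fg, of h] g l(2) by simp
    moreover have "l' = f \<cdot> l" if l': "l' \<in> Hom C (Cod C m) (Cod C f)" "l' \<cdot> m = h" for l'
    proof -
      have "g \<cdot> l' \<in> Hom C (Cod C m) X \<and> (g \<cdot> l') \<cdot> m = g \<cdot> h"
        using l' g f(2) mA by simp
      then have "g \<cdot> l' = l" using ex l by blast
      then show ?thesis using reduce[OF fg, of l'] l'(1) g fA by simp
    qed
    ultimately show ?thesis by blast
  qed
  then show ?thesis unfolding is_sheaf_def using fA by simp
qed

context precohesive
begin

lemma dn_sheaf_unit_isomorphism:
  assumes "dn_sheaf E X"
  shows "isomorphism E (\<theta> X)"
proof -
  obtain t j where t: "subobject_classifier E t" and j: "double_negation E t j" and X: "is_sheaf E t j X"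
    using assms unfolding dn_sheaf_def by blast
  \<comment> \<open>The sheaf condition may refer to another classifier than \<open>tE\<close>, so
    the locales are interpreted once more at \<open>t\<close>.\<close>
  interpret T: topos E t by unfold_locales (fact E.topos t)+
  interpret P: precohesive S E F G \<eta> \<beta> t tS R \<theta> \<epsilon>
    by unfold_locales (fact full_faithful limits counit_monic reflection kernel_pair_reflection boolean)+
  show ?thesis by (rule P.sheaf_unit_isomorphism[OF j X])
qed

lemma dn_sheaf_R:
  assumes "Z \<in> Obj S" shows "dn_sheaf E (fobj R Z)"
  using E.double_negation_exists E.classifier R_is_sheaf assms unfolding dn_sheaf_def by metis

lemma dn_sheaf_isomorphism: "dn_sheaf E X \<Longrightarrow> isomorphism E f \<Longrightarrow> Dom E f = X \<Longrightarrow> dn_sheaf E (Cod E f)"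
  unfolding dn_sheaf_def using E.is_sheaf_isomorphism by blast

lemma isomorphicI: "isomorphism E f \<Longrightarrow> isomorphic E (Dom E f) (Cod E f)"
  unfolding isomorphic_def by (auto simp: isomorphism_def)

lemma isomorphicI': "isomorphism E f \<Longrightarrow> isomorphic E (Cod E f) (Dom E f)"
  using E.isomorphismI E.isomorphismE isomorphicI by metis

lemma essential_image_F: "essential_image S E F = {X \<in> Obj E. decidable E X}"
proof -
  have "decidable E Y" if "isomorphic E (fobj F X) Y" "X \<in> Obj S" for X Y
    using that F_decidable[OF boolean] E.decidable_isomorphism unfolding isomorphic_def by fastforce
  moreover have "\<exists>X\<in>Obj S. isomorphic E (fobj F X) Y" if "Y \<in> Obj E" "decidable E Y" for Y
    using isomorphicI[OF decidable_imp_discrete[OF that(2)]] that(1)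
    by (intro bexI[of _ "fobj G Y"]) simp_all
  ultimately show ?thesis unfolding essential_image_def by blast
qed

lemma essential_image_R: "essential_image S E R = {X \<in> Obj E. dn_sheaf E X}"
proof -
  have "dn_sheaf E Y" if "isomorphic E (fobj R X) Y" "X \<in> Obj S" for X Y
    using that dn_sheaf_R dn_sheaf_isomorphism unfolding isomorphic_def by fastforce
  moreover have "\<exists>X\<in>Obj S. isomorphic E (fobj R X) Y" if "Y \<in> Obj E" "dn_sheaf E Y" for Y
    using isomorphicI'[OF dn_sheaf_unit_isomorphism[OF that(2)]] that(1)
    by (intro bexI[of _ "fobj G Y"]) simp_all
  ultimately show ?thesis unfolding essential_image_def by blast
qed

lemma R_fully_faithful: "fully_faithful S E R"
  using R.fully_faithful_right_adjoint counit_R_isomorphism by blast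

lemma quasi_inverse_decidable: "quasi_inverse S (Dec E) F G"
proof -
  have "nat_isomorphic S S id_functor (G \<odot> F)"
    unfolding nat_isomorphic_def
    using adjunction unit_isomorphism[OF full_faithful] unfolding adjunction_def by blast
  moreover have "nat_isomorphic (Dec E) (Dec E) (F \<odot> G) id_functor"
    unfolding Dec_def
  proof (rule nat_isomorphic_full_subcategory)
    show "nat_trans E E (F \<odot> G) id_functor \<beta>" using adjunction unfolding adjunction_def by blast
  qed (use decidable_imp_discrete F_decidable[OF boolean] in \<open>simp add: comp_functor_def id_functor_def\<close>)
  moreover have "is_functor S (Dec E) F"
    unfolding Dec_def using S.cat F.is_functor F_decidable[OF boolean] by (rule is_functor_to_full_subcategory)
  moreover have "is_functor (Dec E) S G"
    unfolding Dec_def by (rule is_functor_from_full_subcategory) (fact G.is_functor)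
  ultimately show ?thesis unfolding quasi_inverse_def by blast
qed

lemma quasi_inverse_sheaves: "quasi_inverse (Sh_dn E) S G R"
proof -
  have "nat_isomorphic S S (G \<odot> R) id_functor"
    unfolding nat_isomorphic_def
    using R.adjunction counit_R_isomorphism unfolding adjunction_def by blast
  moreover have "nat_isomorphic (Sh_dn E) (Sh_dn E) id_functor (R \<odot> G)"
    unfolding Sh_dn_def
  proof (rule nat_isomorphic_full_subcategory)
    show "nat_trans E E id_functor (R \<odot> G) \<theta>" using R.adjunction unfolding adjunction_def by blast
  qed (use dn_sheaf_unit_isomorphism dn_sheaf_R in \<open>simp add: comp_functor_def id_functor_def\<close>)
  moreover have "is_functor S (Sh_dn E) R"
    unfolding Sh_dn_def using S.cat R.G.is_functor dn_sheaf_R by (rule is_functor_to_full_subcategory)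
  moreover have "is_functor (Sh_dn E) S G"
    unfolding Sh_dn_def by (rule is_functor_from_full_subcategory) (fact G.is_functor)
  ultimately show ?thesis unfolding quasi_inverse_def by blast
qed

lemma is_category_Dec: "is_category (Dec E)" and is_category_Sh_dn: "is_category (Sh_dn E)"
  unfolding Dec_def Sh_dn_def using is_category_full_subcategory E.cat by blast+

lemma unity_and_identity: "unity_and_identity (Dec E) (Sh_dn E) E S inclusion inclusion G"
  unfolding unity_and_identity_def is_equivalence_def comp_id_functor
  using quasi_inverse_sheaves quasi_inverse_sym[OF S.cat is_category_Dec quasi_inverse_decidable] G.is_functor
    is_functor_from_full_subcategory[OF is_functor_id[OF E.cat]]
  unfolding Dec_def Sh_dn_def by blast

end

section \<open>Reflections of kernel pairs\<close>

context adj
begin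

lemma unit_universal_ex:
  assumes "g \<in> Arr C" "Dom C g = X" "Cod C g = fobj G Y" "Y \<in> Obj D"
  obtains f where "f \<in> Arr D" "Dom D f = fobj F X" "Cod D f = Y" "farr G f \<cdot>\<^bsub>C\<^esub> \<eta> X = g"
proof
  let ?f = "\<epsilon> Y \<cdot>\<^bsub>D\<^esub> farr F g"
  show "?f \<in> Arr D" "Dom D ?f = fobj F X" "Cod D ?f = Y" using assms by simp_all
  show "farr G ?f \<cdot>\<^bsub>C\<^esub> \<eta> X = g" using counit_transpose[of g Y] assms by simp
qed

end

section \<open>Slice categories, and products in them\<close>

lemma slice_simps [simp]:
  "x \<in> Obj (slice C B) \<longleftrightarrow> x \<in> Arr C \<and> Cod C x = B"
  "(x, h, y) \<in> Arr (slice C B) \<longleftrightarrow> x \<in> Arr C \<and> Cod C x = B \<and> y \<in> Arr C \<and> Cod C y = B \<and>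
     h \<in> Arr C \<and> Dom C h = Dom C x \<and> Cod C h = Dom C y \<and> y \<cdot>\<^bsub>C\<^esub> h = x"
  "Dom (slice C B) (x, h, y) = x" "Cod (slice C B) (x, h, y) = y"
  "Ide (slice C B) x = (x, Ide C (Dom C x), x)"
  "(y', k, z) \<cdot>\<^bsub>slice C B\<^esub> (x, h, y) = (x, k \<cdot>\<^bsub>C\<^esub> h, z)"
  unfolding slice_def by auto

lemma slice_functor_simps [simp]:
  "fobj (slice_functor F) x = farr F x"
  "farr (slice_functor F) (x, h, y) = (farr F x, farr F h, farr F y)"
  unfolding slice_functor_def by simp_all

lemma slice_arrE:
  assumes "f \<in> Arr (slice C B)" "Dom (slice C B) f = x" "Cod (slice C B) f = y"
  obtains h where "f = (x, h, y)" "h \<in> Arr C" "Dom C h = Dom C x" "Cod C h = Dom C y" "y \<cdot>\<^bsub>C\<^esub> h = x"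
    "x \<in> Arr C" "Cod C x = B" "y \<in> Arr C" "Cod C y = B"
  using assms by (cases f) auto

lemma (in cat) is_category_slice: "is_category (slice C B)"
proof -
  have "\<forall>f\<in>Arr (slice C B). Dom (slice C B) f \<in> Obj (slice C B) \<and> Cod (slice C B) f \<in> Obj (slice C B)"
    by auto
  moreover have "\<forall>x\<in>Obj (slice C B). Ide (slice C B) x \<in> Hom (slice C B) x x" by simp
  moreover have "g \<cdot>\<^bsub>slice C B\<^esub> f \<in> Hom (slice C B) (Dom (slice C B) f) (Cod (slice C B) g)"
    if fg: "f \<in> Arr (slice C B)" "g \<in> Arr (slice C B)" "Cod (slice C B) f = Dom (slice C B) g" for f g
  proof -
    obtain x h y where f: "f = (x, h, y)" by (cases f)
    obtain y' k z where g: "g = (y', k, z)" by (cases g)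
    have *: "z \<cdot> k = y" using fg f g by simp
    show ?thesis using fg reduce[OF *, of h] unfolding f g by simp
  qed
  moreover have "f \<cdot>\<^bsub>slice C B\<^esub> Ide (slice C B) (Dom (slice C B) f) = f \<and>
    Ide (slice C B) (Cod (slice C B) f) \<cdot>\<^bsub>slice C B\<^esub> f = f" if "f \<in> Arr (slice C B)" for f
    using that by (cases f) simp
  moreover have "h \<cdot>\<^bsub>slice C B\<^esub> (g \<cdot>\<^bsub>slice C B\<^esub> f) = (h \<cdot>\<^bsub>slice C B\<^esub> g) \<cdot>\<^bsub>slice C B\<^esub> f"
    if "f \<in> Arr (slice C B)" "g \<in> Arr (slice C B)" "h \<in> Arr (slice C B)"
      "Cod (slice C B) f = Dom (slice C B) g" "Cod (slice C B) g = Dom (slice C B) h" for f g h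
    using that by (cases f, cases g, cases h) simp
  ultimately show ?thesis unfolding is_category_def by blast
qed

definition pair_shape :: "(nat, nat) category" where
  "pair_shape = \<lparr>Obj = {0, 1}, Arr = {0, 1}, Dom = id, Cod = id, Ide = id, Comp = \<lambda>v u. u\<rparr>"

lemma pair_shape: "finite_shape pair_shape" "discrete_shape pair_shape"
  unfolding finite_shape_def discrete_shape_def is_category_def pair_shape_def by auto

context cat
begin

lemma is_limit_pair_iff:
  assumes D: "is_functor pair_shape C D"
  shows "is_limit pair_shape C D L \<pi> \<longleftrightarrow> L \<in> Obj C \<and> is_product C (fobj D 0) (fobj D 1) L (\<pi> 0) (\<pi> 1)"
proof -
  have D01: "fobj D i \<in> Obj C" "farr D i = Ide C (fobj D i)" if "i = 0 \<or> i = 1" for i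
    using D that unfolding is_functor_def pair_shape_def by auto
  have cone: "is_cone pair_shape C D M \<mu> \<longleftrightarrow>
    M \<in> Obj C \<and> \<mu> 0 \<in> Hom C M (fobj D 0) \<and> \<mu> 1 \<in> Hom C M (fobj D 1)" for M \<mu>
    using D01[of 0] D01[of 1] unfolding is_cone_def pair_shape_def by auto
  have obj: "(\<forall>j\<in>Obj pair_shape. \<pi> j \<cdot> h = \<mu> j) \<longleftrightarrow> \<pi> 0 \<cdot> h = \<mu> 0 \<and> \<pi> 1 \<cdot> h = \<mu> 1" for h \<mu>
    unfolding pair_shape_def by simp
  show ?thesis
  proof
    assume lim: "is_limit pair_shape C D L \<pi>"
    have "\<exists>!h. h \<in> Hom C W L \<and> \<pi> 0 \<cdot> h = f \<and> \<pi> 1 \<cdot> h = g"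
      if fg: "f \<in> Hom C W (fobj D 0)" "g \<in> Hom C W (fobj D 1)" for W f g
    proof -
      define \<mu> where "\<mu> i = (if i = (0::nat) then f else g)" for i
      have "W \<in> Obj C" using fg by auto
      then have "is_cone pair_shape C D W \<mu>" unfolding cone using fg by (simp add: \<mu>_def)
      then have "\<exists>!h. h \<in> Hom C W L \<and> (\<forall>j\<in>Obj pair_shape. \<pi> j \<cdot> h = \<mu> j)"
        using lim unfolding is_limit_def by blast
      then show ?thesis unfolding obj by (simp add: \<mu>_def)
    qed
    then show "L \<in> Obj C \<and> is_product C (fobj D 0) (fobj D 1) L (\<pi> 0) (\<pi> 1)"
      using lim unfolding is_limit_def cone is_product_def by blast
  next
    assume pr: "L \<in> Obj C \<and> is_product C (fobj D 0) (fobj D 1) L (\<pi> 0) (\<pi> 1)"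
    then have "\<exists>!h. h \<in> Hom C M L \<and> (\<forall>j\<in>Obj pair_shape. \<pi> j \<cdot> h = \<mu> j)"
      if "is_cone pair_shape C D M \<mu>" for M \<mu>
      using that unfolding cone obj is_product_def by blast
    then show "is_limit pair_shape C D L \<pi>"
      using pr unfolding is_limit_def cone is_product_def by blast
  qed
qed

end

context func
begin

lemma product_preserved:
  assumes F: "preserves_finite_products C D F" and pr: "is_product C X Y P p q"
  shows "is_product D (fobj F X) (fobj F Y) (fobj F P) (farr F p) (farr F q)"
proof -
  note P = C.is_productD[OF pr]
  define K where "K = \<lparr>fobj = \<lambda>i. if i = (0::nat) then X else Y,
    farr = \<lambda>i. Ide C (if i = (0::nat) then X else Y)\<rparr>"
  define \<pi> where "\<pi> i = (if i = (0::nat) then p else q)" for i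
  have K: "is_functor pair_shape C K"
    using P unfolding is_functor_def pair_shape_def K_def by auto
  then have lim: "is_limit pair_shape C K P \<pi>"
    unfolding C.is_limit_pair_iff[OF K] using pr P by (simp add: K_def \<pi>_def)
  have "is_limit pair_shape D (F \<odot> K) (fobj F P) (\<lambda>j. farr F (\<pi> j))"
    using F[unfolded preserves_finite_products_def preserves_limits_of_shape_def, rule_format,
      OF conjI[OF pair_shape], OF conjI[OF K lim]] .
  moreover have "is_functor pair_shape D (F \<odot> K)"
    using P unfolding is_functor_def pair_shape_def K_def comp_functor_def by auto
  ultimately show ?thesis by (simp add: D.is_limit_pair_iff K_def \<pi>_def comp_functor_def)
qed

end

context hyperconnected_gm
begin

text \<open>As an object of \<open>E/F B\<close>, \<open>s\<close> has the terminal reflection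
  \<open>c\<close>. Its square there is the kernel pair, with structure arrow
  \<open>\<kappa>\<close>, so the reflection \<open>d\<close> of \<open>\<kappa>\<close> is a
  product of terminal objects and itself terminal. To factor \<open>g\<close> through
  \<open>\<kappa>\<close>, it is first made into an arrow over \<open>F B\<close> with target
  \<open>F (B \<times> V)\<close> and then transposed.\<close>

lemma kernel_pair_reflection_if_slice:
  assumes s: "universal S E F X B s" and pb: "is_pullback E k k' s s"
    and adj: "adjunction (slice E (fobj F B)) (slice S B) L (slice_functor F) l m"
    and prod: "preserves_finite_products (slice E (fobj F B)) (slice S B) L"
    and V: "V \<in> Obj S" and g: "g \<in> Arr E" "Dom E g = Dom E k" "Cod E g = fobj F V"
  shows "\<exists>f\<in>Arr S. Dom S f = B \<and> Cod S f = V \<and> farr F f \<cdot>\<^bsub>E\<^esub> s \<cdot>\<^bsub>E\<^esub> k = g"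
proof -
  let ?E = "slice E (fobj F B)" and ?S = "slice S B"
  interpret A: adj ?E ?S L "slice_functor F" l m
    using E.is_category_slice S.is_category_slice adj by (rule adjI)
  note sD = F.universalD[OF s] and D = E.is_pullbackD[OF pb]
  have sO: "s \<in> Obj ?E" using sD by simp
  obtain c where c: "fobj L s = c" "c \<in> Arr S" "Cod S c = B" using A.F.fobj_obj[OF sO] by simp
  obtain u where u: "l s = (s, u, farr F c)" "u \<in> Arr E" "Dom E u = X" "Cod E u = fobj F (Dom S c)"
    "farr F c \<cdot>\<^bsub>E\<^esub> u = s"
    by (rule slice_arrE[of "l s" E "fobj F B" s "farr F c"])
      (use A.unit_arr[OF sO] A.dom_unit[OF sO] A.cod_unit[OF sO] c sD in simp_all)
  \<comment> \<open>\<open>r\<close> will be inverse to \<open>c\<close>: one equation holds by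
    universality of \<open>s\<close> in \<open>E\<close>, the other by universality of the unit in
    the slice.\<close>
  obtain r where r: "r \<in> Arr S" "Dom S r = B" "Cod S r = Dom S c" "farr F r \<cdot>\<^bsub>E\<^esub> s = u"
    by (rule F.universal_ex[OF s, of "Dom S c" u]) (use u c in simp_all)
  have cr: "c \<cdot>\<^bsub>S\<^esub> r = Ide S B"
  proof (rule F.universal_eq[OF s])
    show "farr F (c \<cdot>\<^bsub>S\<^esub> r) \<cdot>\<^bsub>E\<^esub> s = farr F (Ide S B) \<cdot>\<^bsub>E\<^esub> s" using u r c sD by simp
  qed (use r c sD in simp_all)
  have "(c, r \<cdot>\<^bsub>S\<^esub> c, c) = Ide ?S c"
  proof (rule A.unit_universal_eq[of _ _ s])
    show "farr (slice_functor F) (c, r \<cdot>\<^bsub>S\<^esub> c, c) \<cdot>\<^bsub>?E\<^esub> l s = farr (slice_functor F) (Ide ?S c) \<cdot>\<^bsub>?E\<^esub> l s"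
      using u r c sD by simp
  qed (use c r cr S.reduce[OF cr, of c] sO in simp_all)
  then have rc: "r \<cdot>\<^bsub>S\<^esub> c = Ide S (Dom S c)" by simp
  have c_monic: "monic S c" by (rule S.split_monic[OF rc]) (use c r in simp_all)
  have terminal: "is_terminal ?S c"
    unfolding is_terminal_def
  proof (intro conjI ballI)
    fix z assume z: "z \<in> Obj ?S"
    show "\<exists>!h. h \<in> Hom ?S z c"
    proof (rule ex1I[of _ "(z, r \<cdot>\<^bsub>S\<^esub> z, c)"])
      show "(z, r \<cdot>\<^bsub>S\<^esub> z, c) \<in> Hom ?S z c" using z c r cr S.reduce[OF cr, of z] by simp
      fix h assume "h \<in> Hom ?S z c"
      then obtain h' where h': "h = (z, h', c)" "h' \<in> Arr S" "Dom S h' = Dom S z" "Cod S h' = Dom S c" "c \<cdot>\<^bsub>S\<^esub> h' = z"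
        using slice_arrE[of h S B z c] by auto
      have "h' = r \<cdot>\<^bsub>S\<^esub> z"
        by (rule S.monicD[OF c_monic]) (use h' z r c cr S.reduce[OF cr, of z] in simp_all)
      then show "h = (z, r \<cdot>\<^bsub>S\<^esub> z, c)" using h' by simp
    qed
  qed (use c in simp)
  define \<kappa> where "\<kappa> = s \<cdot>\<^bsub>E\<^esub> k"
  have \<kappa>: "\<kappa> \<in> Arr E" "Dom E \<kappa> = Dom E k" "Cod E \<kappa> = fobj F B" "s \<cdot>\<^bsub>E\<^esub> k = \<kappa>" "s \<cdot>\<^bsub>E\<^esub> k' = \<kappa>"
    using D sD unfolding \<kappa>_def by simp_all
  have "is_product ?E s s \<kappa> (\<kappa>, k, s) (\<kappa>, k', s)"
  proof -
    have *: "\<exists>!h. h \<in> Hom ?E w \<kappa> \<and> (\<kappa>, k, s) \<cdot>\<^bsub>?E\<^esub> h = a \<and> (\<kappa>, k', s) \<cdot>\<^bsub>?E\<^esub> h = b"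
      if a: "a \<in> Hom ?E w s" and b: "b \<in> Hom ?E w s" for w a b
    proof -
      obtain a' where a': "a = (w, a', s)" "a' \<in> Arr E" "Dom E a' = Dom E w" "Cod E a' = X" "s \<cdot>\<^bsub>E\<^esub> a' = w"
        "w \<in> Arr E" "Cod E w = fobj F B"
        using slice_arrE[of a E "fobj F B" w s] a sD by auto
      obtain b' where b': "b = (w, b', s)" "b' \<in> Arr E" "Dom E b' = Dom E w" "Cod E b' = X" "s \<cdot>\<^bsub>E\<^esub> b' = w"
        using slice_arrE[of b E "fobj F B" w s] b sD by auto
      obtain h where h: "h \<in> Arr E" "Dom E h = Dom E a'" "Cod E h = Dom E k" "k \<cdot>\<^bsub>E\<^esub> h = a'" "k' \<cdot>\<^bsub>E\<^esub> h = b'"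
        by (rule E.is_pullback_pair[OF pb, of a' b']) (use a' b' sD in simp_all)
      have \<kappa>h: "\<kappa> \<cdot>\<^bsub>E\<^esub> h = w"
        using E.reduce[OF \<kappa>(4), of h] h a' D(1-8) sD by simp
      have ex: "(w, h, \<kappa>) \<in> Hom ?E w \<kappa> \<and> (\<kappa>, k, s) \<cdot>\<^bsub>?E\<^esub> (w, h, \<kappa>) = a \<and> (\<kappa>, k', s) \<cdot>\<^bsub>?E\<^esub> (w, h, \<kappa>) = b"
        using h a' b' \<kappa> \<kappa>h by simp
      have "t = (w, h, \<kappa>)" if t: "t \<in> Hom ?E w \<kappa> \<and> (\<kappa>, k, s) \<cdot>\<^bsub>?E\<^esub> t = a \<and> (\<kappa>, k', s) \<cdot>\<^bsub>?E\<^esub> t = b" for t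
      proof -
        obtain t' where t': "t = (w, t', \<kappa>)" "t' \<in> Arr E" "Dom E t' = Dom E w" "Cod E t' = Dom E \<kappa>"
          using slice_arrE[of t E "fobj F B" w \<kappa>] t by auto
        have "t' = h"
          by (rule E.is_pullback_eqI[OF pb]) (use t t' a' b' h \<kappa> in simp_all)
        then show ?thesis using t' by simp
      qed
      with ex show ?thesis by blast
    qed
    show ?thesis unfolding is_product_def
      by (intro conjI allI ballI; (rule *; assumption)?) (use \<kappa> D(1-8) sD in simp_all)
  qed
  from A.F.product_preserved[OF prod this] have pr: "is_product ?S c c (fobj L \<kappa>)
      (farr L (\<kappa>, k, s)) (farr L (\<kappa>, k', s))" using c by simp
  note prD = A.F.D.is_productD[OF pr]
  have \<kappa>O: "\<kappa> \<in> Obj ?E" using \<kappa> by simp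
  obtain d where d: "fobj L \<kappa> = d" "d \<in> Arr S" "Cod S d = B" using A.F.fobj_obj[OF \<kappa>O] by simp
  obtain v where v: "l \<kappa> = (\<kappa>, v, farr F d)" "v \<in> Arr E" "Dom E v = Dom E k" "Cod E v = fobj F (Dom S d)"
    "farr F d \<cdot>\<^bsub>E\<^esub> v = \<kappa>"
    by (rule slice_arrE[of "l \<kappa>" E "fobj F B" \<kappa> "farr F d"])
      (use A.unit_arr[OF \<kappa>O] A.dom_unit[OF \<kappa>O] A.cod_unit[OF \<kappa>O] d \<kappa> in simp_all)
  have B: "B \<in> Obj S" using sD by simp
  \<comment> \<open>Both components are the arrow from the terminal object \<open>Ide S B\<close> of
    the slice to \<open>c\<close>. The pairing is a section of \<open>d\<close>.\<close>
  obtain t where "t \<in> Arr ?S" "Dom ?S t = Ide S B" "Cod ?S t = d"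
    by (rule A.F.D.is_product_pair[OF pr, of "(Ide S B, r, c)" "(Ide S B, r, c)"]) (use d(1) r c cr B in simp_all)
  then obtain w where w: "w \<in> Arr S" "Dom S w = B" "Cod S w = Dom S d" "d \<cdot>\<^bsub>S\<^esub> w = Ide S B"
    using slice_arrE[of t S B "Ide S B" d] B by auto
  have "(d, w \<cdot>\<^bsub>S\<^esub> d, d) \<in> Arr ?S" using w d S.reduce[OF w(4), of d] by simp
  \<comment> \<open>Both are endomorphisms of a product of terminal objects, so their components
    agree.\<close>
  then have "(d, w \<cdot>\<^bsub>S\<^esub> d, d) = Ide ?S d"
    using d prD by - (rule A.F.D.is_product_eqI[OF pr]; (rule A.F.D.is_terminalD[OF terminal])?, simp_all)
  then have wd: "w \<cdot>\<^bsub>S\<^esub> d = Ide S (Dom S d)" by simp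
  have "farr F w \<cdot>\<^bsub>E\<^esub> \<kappa> = v"
    using E.reduce[OF F.farr_eq[OF wd], of v] v w d by simp
  \<comment> \<open>\<open>B \<times> V\<close> with its projection to \<open>B\<close> is the
    object of \<open>S/B\<close> for which arrows over \<open>F B\<close> from
    \<open>\<kappa>\<close> to its image amount to arrows to \<open>F V\<close>.\<close>
  obtain P p q where P: "is_product S B V P p q" using S.product_exists[OF B V] by blast
  note PD = S.is_productD[OF P] and FPD = E.is_productD[OF F_product[OF P]]
  obtain h where h: "h \<in> Arr E" "Dom E h = Dom E k" "Cod E h = fobj F P" "farr F p \<cdot>\<^bsub>E\<^esub> h = \<kappa>" "farr F q \<cdot>\<^bsub>E\<^esub> h = g"
    by (rule E.is_product_pair[OF F_product[OF P], of \<kappa> g]) (use \<kappa> g in simp_all)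
  obtain f where f: "f \<in> Arr ?S" "Dom ?S f = d" "Cod ?S f = p" "farr (slice_functor F) f \<cdot>\<^bsub>?E\<^esub> l \<kappa> = (\<kappa>, h, farr F p)"
    by (rule A.unit_universal_ex[of "(\<kappa>, h, farr F p)" \<kappa> p]) (use \<kappa> h PD d in simp_all)
  then obtain f' where f': "f = (d, f', p)" "f' \<in> Arr S" "Dom S f' = Dom S d" "Cod S f' = P"
    using slice_arrE[of f S B d p] PD by auto
  have "farr F f' \<cdot>\<^bsub>E\<^esub> v = h" using f(4) unfolding f'(1) v(1) by simp
  then have "farr F (q \<cdot>\<^bsub>S\<^esub> f' \<cdot>\<^bsub>S\<^esub> w) \<cdot>\<^bsub>E\<^esub> \<kappa> = g"
    using \<open>farr F w \<cdot>\<^bsub>E\<^esub> \<kappa> = v\<close> h f' w PD \<kappa> by simp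
  then show ?thesis
    using f' w PD unfolding \<kappa>_def by (intro bexI[of _ "q \<cdot>\<^bsub>S\<^esub> f' \<cdot>\<^bsub>S\<^esub> w"]) simp_all
qed

end

section \<open>The slice over the terminal object\<close>

text \<open>Transport from \<open>p/1\<close> to \<open>p\<close>, where an object \<open>X\<close>
  becomes its unique arrow to the terminal object \<open>F 1\<close>. The right adjoint
  \<open>Q\<close> and counit \<open>c\<close> belong to the slice and are not literally induced by
  \<open>G\<close> and \<open>\<beta>\<close>; universality has to relate them.\<close>

locale slice_over_one = left_exact_gm S E F G \<eta> \<beta> tE tS
  for S :: "('so, 'sa) category" and E :: "('eo, 'ea) category"
    and F :: "('so, 'sa, 'eo, 'ea) functor_data" and G :: "('eo, 'ea, 'so, 'sa) functor_data"
    and \<eta> :: "'so \<Rightarrow> 'sa" and \<beta> :: "'eo \<Rightarrow> 'ea" and tE :: 'ea and tS :: 'sa +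
  fixes Q u c
  assumes slice_adjunction: "adjunction (slice S S.one) (slice E (fobj F S.one)) (slice_functor F) Q u c"
    and slice_full_faithful: "fully_faithful (slice S S.one) (slice E (fobj F S.one)) (slice_functor F)"
    and slice_counit_monic: "x \<in> Obj (slice E (fobj F S.one)) \<Longrightarrow> monic (slice E (fobj F S.one)) (c x)"
begin

abbreviation "S1 \<equiv> slice S S.one"
abbreviation "E1 \<equiv> slice E (fobj F S.one)"

lemma adj_slice: "adj S1 E1 (slice_functor F) Q u c"
  by (rule adjI[OF S.is_category_slice E.is_category_slice slice_adjunction])

definition to_one :: "'eo \<Rightarrow> 'ea" where
  "to_one X = (THE f. f \<in> Hom E X (fobj F S.one))"

lemma
  assumes "X \<in> Obj E"
  shows to_one_arr [simp]: "to_one X \<in> Arr E"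
    and dom_to_one [simp]: "Dom E (to_one X) = X"
    and cod_to_one [simp]: "Cod E (to_one X) = fobj F S.one"
proof -
  have "to_one X \<in> Hom E X (fobj F S.one)"
    unfolding to_one_def by (rule theI') (use assms F_one in \<open>simp add: is_terminal_def\<close>)
  then show "to_one X \<in> Arr E" "Dom E (to_one X) = X" "Cod E (to_one X) = fobj F S.one" by simp_all
qed

lemma to_one_unique:
  assumes "x \<in> Arr E" "Cod E x = fobj F S.one"
  shows "x = to_one (Dom E x)"
  by (rule E.is_terminalD[OF F_one]) (use assms in simp_all)

lemma to_one_comp [simp]: "f \<in> Arr E \<Longrightarrow> Cod E f = X \<Longrightarrow> to_one X \<cdot>\<^bsub>E\<^esub> f = to_one (Dom E f)"
  by (rule E.is_terminalD[OF F_one]) auto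

lemma F_bang [simp]: "Z \<in> Obj S \<Longrightarrow> farr F (S.bang Z) = to_one (fobj F Z)"
  by (rule E.is_terminalD[OF F_one]) simp_all

lemma E1_obj: "x \<in> Obj E1 \<Longrightarrow> x = to_one (Dom E x)"
  using to_one_unique by simp

lemma S1_obj: "z \<in> Obj S1 \<Longrightarrow> z = S.bang (Dom S z)"
  using S.bang_unique by simp

text \<open>Every arrow is an arrow over the terminal object, so hom sets in the slices are the
  original ones with the two structure arrows attached.\<close>

lemma full_faithful: "fully_faithful S E F"
proof -
  have bij: "bij_betw (farr F) (Hom S X Y) (Hom E (fobj F X) (fobj F Y))" if XY: "X \<in> Obj S" "Y \<in> Obj S" for X Y
  proof -
    let ?x = "S.bang X" and ?y = "S.bang Y"
    have b: "bij_betw (farr (slice_functor F)) (Hom S1 ?x ?y)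
        (Hom E1 (fobj (slice_functor F) ?x) (fobj (slice_functor F) ?y))"
      using slice_full_faithful[unfolded fully_faithful_def, THEN conjunct2, rule_format, of ?x ?y] XY by simp
    have "inj_on (farr F) (Hom S X Y)"
    proof (rule inj_onI)
      fix f g assume f: "f \<in> Hom S X Y" and g: "g \<in> Hom S X Y" and fg: "farr F f = farr F g"
      have "(?x, f, ?y) = (?x, g, ?y)"
        by (rule inj_onD[OF bij_betw_imp_inj_on[OF b]]) (use f g fg XY in simp_all)
      then show "f = g" by simp
    qed
    moreover have "h \<in> farr F ` Hom S X Y" if h: "h \<in> Hom E (fobj F X) (fobj F Y)" for h
    proof -
      have "(to_one (fobj F X), h, to_one (fobj F Y)) \<in> farr (slice_functor F) ` Hom S1 ?x ?y"
        unfolding bij_betw_imp_surj_on[OF b] using h XY by simp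
      then obtain t where t: "t \<in> Hom S1 ?x ?y" "farr (slice_functor F) t = (to_one (fobj F X), h, to_one (fobj F Y))"
        by auto
      then obtain f where "t = (?x, f, ?y)" "f \<in> Arr S" "Dom S f = X" "Cod S f = Y"
        using slice_arrE[of t S S.one ?x ?y] XY by auto
      then show ?thesis using t by auto
    qed
    moreover have "farr F ` Hom S X Y \<subseteq> Hom E (fobj F X) (fobj F Y)" by auto
    ultimately show ?thesis unfolding bij_betw_def by blast
  qed
  then show ?thesis unfolding fully_faithful_def using F.is_functor by blast
qed

definition mid :: "'x \<times> 'y \<times> 'z \<Rightarrow> 'y" where
  "mid = (\<lambda>(x, h, y). h)"

lemma mid_simp [simp]: "mid (x, h, y) = h"
  by (simp add: mid_def)

text \<open>The adjoint \<open>Q\<close> read on \<open>E\<close> along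
  \<open>X \<mapsto> (X \<rightarrow> F 1)\<close>; \<open>c_arr\<close> is its counit in the same
  reading.\<close>

definition Q_obj :: "'eo \<Rightarrow> 'so" where
  "Q_obj X = Dom S (fobj Q (to_one X))"

definition c_arr :: "'eo \<Rightarrow> 'ea" where
  "c_arr X = mid (c (to_one X))"

lemma
  assumes X: "X \<in> Obj E"
  shows Q_obj [simp]: "Q_obj X \<in> Obj S"
    and Q_to_one: "fobj Q (to_one X) = S.bang (Q_obj X)"
    and c_arr [simp]: "c_arr X \<in> Arr E"
    and dom_c_arr [simp]: "Dom E (c_arr X) = fobj F (Q_obj X)"
    and cod_c_arr [simp]: "Cod E (c_arr X) = X"
    and c_to_one: "c (to_one X) = (to_one (fobj F (Q_obj X)), c_arr X, to_one X)"
    and c_arr_monic: "monic E (c_arr X)"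
proof -
  interpret A: adj S1 E1 "slice_functor F" Q u c by (rule adj_slice)
  have x: "to_one X \<in> Obj E1" using X by simp
  have q: "fobj Q (to_one X) \<in> Obj S1" using A.G.fobj_obj[OF x] .
  then show Q: "Q_obj X \<in> Obj S" unfolding Q_obj_def by simp
  show eq: "fobj Q (to_one X) = S.bang (Q_obj X)" unfolding Q_obj_def by (rule S1_obj[OF q])
  obtain h where h: "c (to_one X) = (to_one (fobj F (Q_obj X)), h, to_one X)" "h \<in> Arr E"
    "Dom E h = fobj F (Q_obj X)" "Cod E h = X"
    by (rule slice_arrE[OF A.counit_arr[OF x] A.dom_counit[OF x] A.cod_counit[OF x]])
      (use eq Q X in simp_all)
  then have hc: "h = c_arr X" unfolding c_arr_def by simp
  then show cX: "c_arr X \<in> Arr E" "Dom E (c_arr X) = fobj F (Q_obj X)" "Cod E (c_arr X) = X"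
    "c (to_one X) = (to_one (fobj F (Q_obj X)), c_arr X, to_one X)" using h by simp_all
  show "monic E (c_arr X)"
  proof (rule E.monicI)
    fix a b assume ab: "a \<in> Arr E" "b \<in> Arr E" "Dom E a = Dom E b" "Cod E a = Dom E (c_arr X)"
      "Cod E b = Dom E (c_arr X)" "c_arr X \<cdot>\<^bsub>E\<^esub> a = c_arr X \<cdot>\<^bsub>E\<^esub> b"
    let ?w = "to_one (Dom E b)" and ?y = "to_one (fobj F (Q_obj X))"
    have "(?w, a, ?y) = (?w, b, ?y)"
      by (rule A.F.D.monicD[OF slice_counit_monic[OF x]]) (use ab cX X Q in simp_all)
    then show "a = b" by simp
  qed (use cX in simp)
qed

text \<open>\<open>\<beta> X\<close> and \<open>c_arr X\<close> are both universal from
  \<open>F\<close> to \<open>X\<close>. Each factors through the other, and the two factorizations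
  are mutually inverse.\<close>

lemma comparison:
  assumes X: "X \<in> Obj E"
  obtains k k' where "k \<in> Arr S" "Dom S k = fobj G X" "Cod S k = Q_obj X"
    "k' \<in> Arr S" "Dom S k' = Q_obj X" "Cod S k' = fobj G X"
    "c_arr X \<cdot>\<^bsub>E\<^esub> farr F k = \<beta> X" "k' \<cdot>\<^bsub>S\<^esub> k = Ide S (fobj G X)" "k \<cdot>\<^bsub>S\<^esub> k' = Ide S (Q_obj X)"
proof -
  interpret A: adj S1 E1 "slice_functor F" Q u c by (rule adj_slice)
  have x: "to_one X \<in> Obj E1" using X by simp
  have GX: "fobj G X \<in> Obj S" using X by simp
  let ?\<beta> = "(to_one (fobj F (fobj G X)), \<beta> X, to_one X)"
  obtain f where f: "f \<in> Arr S1" "Dom S1 f = S.bang (fobj G X)" "Cod S1 f = fobj Q (to_one X)"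
    "c (to_one X) \<cdot>\<^bsub>E1\<^esub> farr (slice_functor F) f = ?\<beta>"
    by (rule A.counit_universal_ex[of "S.bang (fobj G X)" ?\<beta> "to_one X"]) (use X GX in simp_all)
  obtain k where k: "f = (S.bang (fobj G X), k, S.bang (Q_obj X))" "k \<in> Arr S" "Dom S k = fobj G X" "Cod S k = Q_obj X"
    by (rule slice_arrE[OF f(1-3)]) (use X GX Q_to_one in simp_all)
  have ck: "c_arr X \<cdot>\<^bsub>E\<^esub> farr F k = \<beta> X"
    using f(4) unfolding k(1) c_to_one[OF X] by simp
  obtain k' where k': "k' \<in> Arr S" "Dom S k' = Q_obj X" "Cod S k' = fobj G X" "\<beta> X \<cdot>\<^bsub>E\<^esub> farr F k' = c_arr X"
    by (rule counit_universal_ex[of "Q_obj X" "c_arr X" X]) (use X in simp_all)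
  have "k' \<cdot>\<^bsub>S\<^esub> k = Ide S (fobj G X)"
    by (rule counit_universal_eq[of _ _ X]) (use k(2-4) k' ck X E.reduce[OF k'(4), of "farr F k"] in simp_all)
  moreover have "k \<cdot>\<^bsub>S\<^esub> k' = Ide S (Q_obj X)"
  proof -
    let ?q = "S.bang (Q_obj X)"
    have "(?q, k \<cdot>\<^bsub>S\<^esub> k', ?q) = (?q, Ide S (Q_obj X), ?q)"
    proof (rule A.counit_universal_eq[of _ _ "to_one X"])
      show "c (to_one X) \<cdot>\<^bsub>E1\<^esub> farr (slice_functor F) (?q, k \<cdot>\<^bsub>S\<^esub> k', ?q)
        = c (to_one X) \<cdot>\<^bsub>E1\<^esub> farr (slice_functor F) (?q, Ide S (Q_obj X), ?q)"
        unfolding c_to_one[OF X] using k(2-4) k' ck X E.reduce[OF ck, of "farr F k'"] by simp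
    qed (use k(2-4) k'(1-3) X Q_to_one in simp_all)
    then show ?thesis by simp
  qed
  ultimately show ?thesis using that k(2-4) k'(1-3) ck by blast
qed

lemma counit_monic:
  assumes X: "X \<in> Obj E" shows "monic E (\<beta> X)"
proof -
  obtain k k' where k: "k \<in> Arr S" "Dom S k = fobj G X" "Cod S k = Q_obj X"
    "k' \<in> Arr S" "Dom S k' = Q_obj X" "Cod S k' = fobj G X"
    "c_arr X \<cdot>\<^bsub>E\<^esub> farr F k = \<beta> X" "k' \<cdot>\<^bsub>S\<^esub> k = Ide S (fobj G X)"
    by (rule comparison[OF X])
  have "monic E (farr F k)"
    by (rule E.split_monic[of "farr F k'"]) (use k X F.farr_eq[OF k(8)] in simp_all)
  from E.monic_comp[OF this c_arr_monic[OF X]] show ?thesis using k X by simp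
qed

text \<open>The middle component of the slice unit at \<open>X \<rightarrow> F 1\<close> is the
  universal arrow, as any \<open>g : X \<rightarrow> F Z\<close> is an arrow over
  \<open>F 1\<close>.\<close>

lemma reflection_if_slice:
  assumes adj: "adjunction E1 S1 L (slice_functor F) l m" and X: "X \<in> Obj E"
  shows "\<exists>B s. universal S E F X B s"
proof -
  interpret A: adj E1 S1 L "slice_functor F" l m
    by (rule adjI[OF E.is_category_slice S.is_category_slice adj])
  have x: "to_one X \<in> Obj E1" using X by simp
  define B where "B = Dom S (fobj L (to_one X))"
  have L: "fobj L (to_one X) = S.bang B" and B: "B \<in> Obj S"
    using S1_obj[OF A.F.fobj_obj[OF x]] A.F.fobj_obj[OF x] unfolding B_def by simp_all
  obtain s where s: "l (to_one X) = (to_one X, s, to_one (fobj F B))" "s \<in> Arr E" "Dom E s = X" "Cod E s = fobj F B"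
    by (rule slice_arrE[OF A.unit_arr[OF x] A.dom_unit[OF x] A.cod_unit[OF x]]) (use L B X in simp_all)
  have "\<exists>!f. f \<in> Hom S B Z \<and> farr F f \<cdot>\<^bsub>E\<^esub> s = g" if Z: "Z \<in> Obj S" and g: "g \<in> Hom E X (fobj F Z)" for Z g
  proof -
    let ?g = "(to_one X, g, to_one (fobj F Z))"
    obtain t where t: "t \<in> Arr S1" "Dom S1 t = fobj L (to_one X)" "Cod S1 t = S.bang Z"
      "farr (slice_functor F) t \<cdot>\<^bsub>E1\<^esub> l (to_one X) = ?g"
      by (rule A.unit_universal_ex[of ?g "to_one X" "S.bang Z"]) (use Z g X in simp_all)
    obtain f where f: "t = (S.bang B, f, S.bang Z)" "f \<in> Arr S" "Dom S f = B" "Cod S f = Z"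
      by (rule slice_arrE[OF t(1-3)]) (use L B Z in simp_all)
    have fs: "farr F f \<cdot>\<^bsub>E\<^esub> s = g" using t(4) unfolding f(1) s(1) by simp
    have "f' = f" if f': "f' \<in> Hom S B Z" "farr F f' \<cdot>\<^bsub>E\<^esub> s = g" for f'
    proof -
      have "(S.bang B, f', S.bang Z) = (S.bang B, f, S.bang Z)"
        by (rule A.unit_universal_eq[of _ _ "to_one X"]) (use f f' fs s L B Z X in simp_all)
      then show ?thesis by simp
    qed
    moreover have "f \<in> Hom S B Z" using f by simp
    ultimately show ?thesis using fs by blast
  qed
  then show ?thesis using s B unfolding universal_def by (intro exI[of _ B] exI[of _ s]) simp
qed

text \<open>After \<open>F\<close>, both sides composed with \<open>c_arr Y\<close> give
  \<open>f\<close> after \<open>\<beta> X\<close>, and this composite determines an arrow into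
  \<open>Q_obj Y\<close>.\<close>

lemma comparison_natural:
  assumes X: "X \<in> Obj E" and Y: "Y \<in> Obj E" and f: "f \<in> Arr E" "Dom E f = X" "Cod E f = Y"
    and k: "k \<in> Arr S" "Dom S k = fobj G X" "Cod S k = Q_obj X" "c_arr X \<cdot>\<^bsub>E\<^esub> farr F k = \<beta> X"
    and l: "l \<in> Arr S" "Dom S l = fobj G Y" "Cod S l = Q_obj Y" "c_arr Y \<cdot>\<^bsub>E\<^esub> farr F l = \<beta> Y"
    and f': "farr Q (to_one X, f, to_one Y) = (S.bang (Q_obj X), f', S.bang (Q_obj Y))"
      "f' \<in> Arr S" "Dom S f' = Q_obj X" "Cod S f' = Q_obj Y"
  shows "l \<cdot>\<^bsub>S\<^esub> farr G f = f' \<cdot>\<^bsub>S\<^esub> k"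
proof -
  interpret A: adj S1 E1 "slice_functor F" Q u c by (rule adj_slice)
  let ?x = "S.bang (fobj G X)" and ?y = "S.bang (Q_obj Y)"
  have fA: "(to_one X, f, to_one Y) \<in> Arr E1" using X Y f by simp
  have n: "f \<cdot>\<^bsub>E\<^esub> c_arr X = c_arr Y \<cdot>\<^bsub>E\<^esub> farr F f'"
    using A.counit_natural[OF fA] X Y unfolding f'(1) by (simp add: c_to_one)
  have "c_arr Y \<cdot>\<^bsub>E\<^esub> farr F (l \<cdot>\<^bsub>S\<^esub> farr G f) = f \<cdot>\<^bsub>E\<^esub> \<beta> X"
    using E.reduce[OF l(4), of "farr F (farr G f)"] l(1-3) counit_natural[OF f(1)] f X Y by simp
  also have "\<dots> = c_arr Y \<cdot>\<^bsub>E\<^esub> farr F (f' \<cdot>\<^bsub>S\<^esub> k)"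
    using E.reduce[OF n, of "farr F k"] k f f' X Y by simp
  finally have "c_arr Y \<cdot>\<^bsub>E\<^esub> farr F (l \<cdot>\<^bsub>S\<^esub> farr G f) = c_arr Y \<cdot>\<^bsub>E\<^esub> farr F (f' \<cdot>\<^bsub>S\<^esub> k)" .
  then have "(?x, l \<cdot>\<^bsub>S\<^esub> farr G f, ?y) = (?x, f' \<cdot>\<^bsub>S\<^esub> k, ?y)"
    by - (rule A.counit_universal_eq[of _ _ "to_one Y"],
      use X Y f k(1-3) l(1-3) f'(2-4) in \<open>simp_all add: Q_to_one c_to_one\<close>)
  then show ?thesis by simp
qed

text \<open>The universal arrow at \<open>Z\<close> is
  \<open>G Y \<cong> Q_obj Y \<rightarrow> Z\<close>, where \<open>Y\<close> is the domain of
  \<open>R (Z \<rightarrow> 1)\<close> and the second arrow comes from the counit of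
  \<open>Q \<stileturn> R\<close>. Naturality of the comparison carries the universal property from
  \<open>Q\<close> to \<open>G\<close>.\<close>

lemma right_adjoint_if_slice:
  assumes adj: "adjunction E1 S1 Q R \<theta> e"
  shows "\<exists>R. left_adjoint E S G R"
proof (rule G.right_adjoint_exists)
  fix Z assume Z: "Z \<in> Obj S"
  interpret A: adj E1 S1 Q R \<theta> e
    by (rule adjI[OF E.is_category_slice S.is_category_slice adj])
  have z: "S.bang Z \<in> Obj S1" using Z by simp
  define Y where "Y = Dom E (fobj R (S.bang Z))"
  have R: "fobj R (S.bang Z) = to_one Y" and Y: "Y \<in> Obj E"
    using E1_obj[OF A.G.fobj_obj[OF z]] A.G.fobj_obj[OF z] unfolding Y_def by simp_all
  obtain d where d: "e (S.bang Z) = (S.bang (Q_obj Y), d, S.bang Z)" "d \<in> Arr S" "Dom S d = Q_obj Y" "Cod S d = Z"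
    by (rule slice_arrE[OF A.counit_arr[OF z] A.dom_counit[OF z] A.cod_counit[OF z]])
      (use R Y Z in \<open>simp_all add: Q_to_one\<close>)
  obtain l where l: "l \<in> Arr S" "Dom S l = fobj G Y" "Cod S l = Q_obj Y" "c_arr Y \<cdot>\<^bsub>E\<^esub> farr F l = \<beta> Y"
    by (rule comparison[OF Y])
  have Qf: "\<exists>f'\<in>Arr S. farr Q (to_one X, f, to_one Y) = (S.bang (Q_obj X), f', S.bang (Q_obj Y)) \<and>
      Dom S f' = Q_obj X \<and> Cod S f' = Q_obj Y" if f: "f \<in> Hom E X Y" and X: "X \<in> Obj E" for f X
  proof -
    have fA: "(to_one X, f, to_one Y) \<in> Arr E1" using X Y f by simp
    obtain f' where "farr Q (to_one X, f, to_one Y) = (S.bang (Q_obj X), f', S.bang (Q_obj Y))"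
      "f' \<in> Arr S" "Dom S f' = Q_obj X" "Cod S f' = Q_obj Y"
      by (rule slice_arrE[OF A.F.farr_arr[OF fA] A.F.dom_farr[OF fA] A.F.cod_farr[OF fA]])
        (use X Y in \<open>simp_all add: Q_to_one\<close>)
    then show ?thesis by blast
  qed
  have "\<exists>!f. f \<in> Hom E X Y \<and> (d \<cdot>\<^bsub>S\<^esub> l) \<cdot>\<^bsub>S\<^esub> farr G f = g"
    if X: "X \<in> Obj E" and g: "g \<in> Hom S (fobj G X) Z" for X g
  proof -
    obtain k k' where k: "k \<in> Arr S" "Dom S k = fobj G X" "Cod S k = Q_obj X"
      "k' \<in> Arr S" "Dom S k' = Q_obj X" "Cod S k' = fobj G X"
      "c_arr X \<cdot>\<^bsub>E\<^esub> farr F k = \<beta> X" "k' \<cdot>\<^bsub>S\<^esub> k = Ide S (fobj G X)" "k \<cdot>\<^bsub>S\<^esub> k' = Ide S (Q_obj X)"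
      by (rule comparison[OF X])
    have nat: "(d \<cdot>\<^bsub>S\<^esub> l) \<cdot>\<^bsub>S\<^esub> farr G f = d \<cdot>\<^bsub>S\<^esub> f' \<cdot>\<^bsub>S\<^esub> k" if f: "f \<in> Hom E X Y"
      "farr Q (to_one X, f, to_one Y) = (S.bang (Q_obj X), f', S.bang (Q_obj Y))"
      "f' \<in> Arr S" "Dom S f' = Q_obj X" "Cod S f' = Q_obj Y" for f f'
      using comparison_natural[OF X Y _ _ _ k(1-3,7) l f(2-5)] f(1) d(2-4) l(1-3) k(1-3) f(3-5) Y X by simp
    \<comment> \<open>To use the universal property of \<open>Q\<close>, \<open>g\<close> is moved
      to \<open>Q_obj X\<close> along the inverse comparison \<open>k'\<close>.\<close>
    let ?g = "(S.bang (Q_obj X), g \<cdot>\<^bsub>S\<^esub> k', S.bang Z)"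
    obtain t where t: "t \<in> Arr E1" "Dom E1 t = to_one X" "Cod E1 t = fobj R (S.bang Z)"
      "e (S.bang Z) \<cdot>\<^bsub>S1\<^esub> farr Q t = ?g"
      by (rule A.counit_universal_ex[of "to_one X" ?g "S.bang Z"])
        (use X Z g k in \<open>simp_all add: Q_to_one\<close>)
    obtain f where f: "t = (to_one X, f, to_one Y)" "f \<in> Hom E X Y"
      by (rule slice_arrE[OF t(1-3)]) (use R X Y in simp_all)
    obtain f' where f': "f' \<in> Arr S" "farr Q t = (S.bang (Q_obj X), f', S.bang (Q_obj Y))"
      "Dom S f' = Q_obj X" "Cod S f' = Q_obj Y" using Qf[OF f(2) X] unfolding f(1) by blast
    have df: "d \<cdot>\<^bsub>S\<^esub> f' = g \<cdot>\<^bsub>S\<^esub> k'" using t(4) unfolding f'(2) d(1) by simp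
    have "(d \<cdot>\<^bsub>S\<^esub> l) \<cdot>\<^bsub>S\<^esub> farr G f = g"
      using nat[OF f(2) f'(2)[unfolded f(1)] f'(1,3,4)] S.reduce[OF df, of k] f'(1,3,4) d(2-4) k g by simp
    moreover have "f2 = f" if f2: "f2 \<in> Hom E X Y" "(d \<cdot>\<^bsub>S\<^esub> l) \<cdot>\<^bsub>S\<^esub> farr G f2 = g" for f2
    proof -
      obtain f2' where f2': "f2' \<in> Arr S" "farr Q (to_one X, f2, to_one Y) = (S.bang (Q_obj X), f2', S.bang (Q_obj Y))"
        "Dom S f2' = Q_obj X" "Cod S f2' = Q_obj Y" using Qf[OF f2(1) X] by blast
      have "d \<cdot>\<^bsub>S\<^esub> f2' \<cdot>\<^bsub>S\<^esub> k = g" using nat[OF f2(1) f2'(2,1,3,4)] f2(2) by simp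
      then have "(d \<cdot>\<^bsub>S\<^esub> f2' \<cdot>\<^bsub>S\<^esub> k) \<cdot>\<^bsub>S\<^esub> k' = g \<cdot>\<^bsub>S\<^esub> k'" by simp
      then have "d \<cdot>\<^bsub>S\<^esub> f2' = d \<cdot>\<^bsub>S\<^esub> f'" using k f2'(1,3,4) d(2-4) df by simp
      then have "(to_one X, f2, to_one Y) = t"
        by - (rule A.counit_universal_eq[of _ _ "S.bang Z"],
          use f2(1) f2'(2) f'(2) f t(1) R X Y Z d(1) in simp_all)
      then show ?thesis using f(1) by simp
    qed
    ultimately show ?thesis using f(2) by blast
  qed
  then have "couniversal E S G Z Y (d \<cdot>\<^bsub>S\<^esub> l)"
    unfolding couniversal_def using Y d l by simp
  then show "\<exists>R e. couniversal E S G Z R e" by blast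
qed

end

section \<open>Assembly of the adjoint opposites\<close>

context precohesive
begin

lemma unity_and_identity_of_opposites:
  "unity_and_identity (Dec E) (Sh_dn E) E S inclusion inclusion G
    \<and> fully_faithful S E F
    \<and> (\<exists>R. left_adjoint E S G R)
    \<and> (\<exists>U V. quasi_inverse (Dec E) S (G \<odot> inclusion) U
         \<and> quasi_inverse (Sh_dn E) S (G \<odot> inclusion) V
         \<and> adjointly_opposite_via S E (inclusion \<odot> U) (inclusion \<odot> V) G
         \<and> is_equivalence S (Dec E) U
         \<and> nat_isomorphic S E F (inclusion \<odot> U)
         \<and> is_equivalence S (Sh_dn E) V
         \<and> (\<forall>R. left_adjoint E S G R \<longrightarrow> nat_isomorphic S E R (inclusion \<odot> V)))
    \<and> essential_image S E F = {X \<in> Obj E. decidable E X}"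
proof -
  \<comment> \<open>The clause about an arbitrary right adjoint reduces to the fixed
    \<open>R\<close> by uniqueness of adjoints.\<close>
  have "nat_isomorphic S E R' R" if "left_adjoint E S G R'" for R'
  proof -
    obtain \<theta>' \<epsilon>' where "adjunction E S G R' \<theta>' \<epsilon>'" using \<open>left_adjoint E S G R'\<close> unfolding left_adjoint_def by blast
    then have "adj E S G R' \<theta>' \<epsilon>'" by (rule adjI[OF E.cat S.cat])
    then show ?thesis by (rule right_adjoint_unique[OF R.adj_axioms])
  qed
  moreover have "left_adjoint S E F G" "left_adjoint E S G R"
    using adjunction R.adjunction unfolding left_adjoint_def by blast+
  moreover have "quasi_inverse (Dec E) S G F" "quasi_inverse S (Sh_dn E) R G"
    using quasi_inverse_sym[OF S.cat is_category_Dec quasi_inverse_decidable]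
      quasi_inverse_sym[OF is_category_Sh_dn S.cat quasi_inverse_sheaves] by blast+
  moreover have "nat_isomorphic S E F F" using nat_isomorphic_refl E.cat F.is_functor by blast
  \<comment> \<open>The witnesses are \<open>U = F\<close> and \<open>V = R\<close>; composing with
    an inclusion leaves the data of a functor unchanged.\<close>
  ultimately show ?thesis
    using unity_and_identity full_faithful essential_image_F quasi_inverse_decidable quasi_inverse_sheaves
    unfolding comp_id_functor adjointly_opposite_via_def is_equivalence_def by blast
qed

end

theorem corollary2p6:
  fixes E :: "('eo, 'ea) category"
    and S :: "('so, 'sa) category"
    and p :: "('eo, 'ea, 'so, 'sa) geom"
  assumes "boolean_topos S"
    and "elementary_topos E"
    and "geometric_morphism E S p"
    and "stably_pre_cohesive E S p"
  shows "unity_and_identity (Dec E) (Sh_dn E) E S inclusion inclusion (dir_im p)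
    \<and> fully_faithful S E (inv_im p)
    \<and> (\<exists>R. left_adjoint E S (dir_im p) R)
    \<and> (\<exists>U V. quasi_inverse (Dec E) S (dir_im p \<odot> inclusion) U
         \<and> quasi_inverse (Sh_dn E) S (dir_im p \<odot> inclusion) V
         \<and> adjointly_opposite_via S E (inclusion \<odot> U) (inclusion \<odot> V) (dir_im p)
         \<and> is_equivalence S (Dec E) U
         \<and> nat_isomorphic S E (inv_im p) (inclusion \<odot> U)
         \<and> is_equivalence S (Sh_dn E) V
         \<and> (\<forall>R. left_adjoint E S (dir_im p) R \<longrightarrow> nat_isomorphic S E R (inclusion \<odot> V)))
    \<and> essential_image S E (inv_im p) = {X \<in> Obj E. decidable E X}
    \<and> (\<forall>R. left_adjoint E S (dir_im p) R \<longrightarrow>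
         fully_faithful S E R \<and> essential_image S E R = {X \<in> Obj E. dn_sheaf E X})"
proof -
  let ?F = "inv_im p" and ?G = "dir_im p"
  obtain tE where tE: "subobject_classifier E tE" using assms(2) unfolding elementary_topos_def by blast
  have S: "elementary_topos S" using assms(1) unfolding boolean_topos_def by blast
  then obtain tS where tS: "subobject_classifier S tS" unfolding elementary_topos_def by blast
  have catE: "is_category E" and catS: "is_category S"
    using assms(2) S unfolding elementary_topos_def by blast+
  have adj: "adj S E ?F ?G (gunit p) (gcounit p)" and lim: "preserves_finite_limits S E ?F"
    using assms(3) adjI[OF catS catE] unfolding geometric_morphism_def by blast+
  interpret S: topos S tS by unfold_locales (fact catS S tS)+
  interpret E: topos E tE by unfold_locales (fact catE assms(2) tE)+
  interpret A: adj S E ?F ?G "gunit p" "gcounit p" by (fact adj)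
  interpret P: left_exact_gm S E ?F ?G "gunit p" "gcounit p" tE tS by unfold_locales (fact lim)
  have slice: "\<exists>q. adjunction (slice S B) (slice E (fobj ?F B)) (slice_functor ?F) (dir_im q) (gunit q) (gcounit q)
      \<and> pre_cohesive (slice E (fobj ?F B)) (slice S B) q \<and> inv_im q = slice_functor ?F"
    if B: "B \<in> Obj S" for B
  proof -
    obtain q where q: "is_slice_geom E S p B q" "pre_cohesive (slice E (fobj ?F B)) (slice S B) q"
      using assms(4) B unfolding stably_pre_cohesive_def by blast
    then have "inv_im q = slice_functor ?F" unfolding is_slice_geom_def by simp
    with q show ?thesis
      unfolding is_slice_geom_def geometric_morphism_def by (intro exI[of _ q]) simp
  qed
  have "S.one \<in> Obj S" by simp
  \<comment> \<open>This is \<open>p/1\<close>, the source of full faithfulness of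
    \<open>?F\<close>, of the monic counit, of the reflections and of a right adjoint of
    \<open>?G\<close>.\<close>
  from slice[OF this] obtain q where
    q: "adjunction (slice S S.one) (slice E (fobj ?F S.one)) (slice_functor ?F) (dir_im q) (gunit q) (gcounit q)"
    and pc: "pre_cohesive (slice E (fobj ?F S.one)) (slice S S.one) q" and qF: "inv_im q = slice_functor ?F"
    by blast
  have hyper: "fully_faithful (slice S S.one) (slice E (fobj ?F S.one)) (slice_functor ?F)"
    "\<forall>x\<in>Obj (slice E (fobj ?F S.one)). monic (slice E (fobj ?F S.one)) (gcounit q x)"
    using pc qF unfolding pre_cohesive_def hyperconnected_def is_connected_def by simp_all
  interpret P1: slice_over_one S E ?F ?G "gunit p" "gcounit p" tE tS "dir_im q" "gunit q" "gcounit q"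
    using q hyper by unfold_locales blast+
  interpret H: hyperconnected_gm S E ?F ?G "gunit p" "gcounit p" tE tS
    by unfold_locales (fact P1.full_faithful P1.counit_monic)+
  interpret H: stable_reflection S E ?F ?G "gunit p" "gcounit p" tE tS
  proof unfold_locales
    fix X assume "X \<in> Obj E"
    moreover obtain L l m where
      "adjunction (slice E (fobj ?F S.one)) (slice S S.one) L (slice_functor ?F) l m"
      using pc qF unfolding pre_cohesive_def pressential_def left_adjoint_def by auto
    ultimately show "\<exists>B s. universal S E ?F X B s" using P1.reflection_if_slice by blast
  next
    fix X B s k k' V g
    assume s: "universal S E ?F X B s" and *: "is_pullback E k k' s s" "V \<in> Obj S"
      "g \<in> Arr E" "Dom E g = Dom E k" "Cod E g = fobj ?F V"
    have "B \<in> Obj S" using s unfolding universal_def by simp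
    \<comment> \<open>The slice over the target \<open>B\<close> of the reflection is the one in
      which the kernel pair of \<open>s\<close> is a product.\<close>
    from slice[OF this] obtain L l m where
      "adjunction (slice E (fobj ?F B)) (slice S B) L (slice_functor ?F) l m"
      "preserves_finite_products (slice E (fobj ?F B)) (slice S B) L"
      unfolding pre_cohesive_def pressential_def left_adjoint_def by auto
    from H.kernel_pair_reflection_if_slice[OF s *(1) this *(2-)]
    show "\<exists>f\<in>Arr S. Dom S f = B \<and> Cod S f = V \<and> farr ?F f \<cdot>\<^bsub>E\<^esub> s \<cdot>\<^bsub>E\<^esub> k = g" .
  qed
  \<comment> \<open>Kept general in \<open>R\<close>, since the last clause of the theorem ranges
    over all right adjoints of \<open>?G\<close>.\<close>
  have precohesive: "precohesive S E ?F ?G (gunit p) (gcounit p) tE tS R \<theta> \<epsilon>" if "adjunction E S ?G R \<theta> \<epsilon>" for R \<theta> \<epsilon>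
    using H.stable_reflection_axioms adjI[OF catE catS that] assms(1)
    by (rule precohesive.intro[OF _ _ precohesive_axioms.intro])
  obtain Q \<theta> e where "adjunction (slice E (fobj ?F S.one)) (slice S S.one) (dir_im q) Q \<theta> e"
    using pc unfolding pre_cohesive_def is_local_def left_adjoint_def by blast
  then have "\<exists>R. left_adjoint E S ?G R" by (rule P1.right_adjoint_if_slice)
  then obtain R \<theta> \<epsilon> where "adjunction E S ?G R \<theta> \<epsilon>" unfolding left_adjoint_def by blast
  then interpret R: precohesive S E ?F ?G "gunit p" "gcounit p" tE tS R \<theta> \<epsilon> by (rule precohesive)
  have "fully_faithful S E R' \<and> essential_image S E R' = {X \<in> Obj E. dn_sheaf E X}"
    if "left_adjoint E S ?G R'" for R'
  proof -
    obtain \<theta>' \<epsilon>' where "adjunction E S ?G R' \<theta>' \<epsilon>'"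
      using \<open>left_adjoint E S ?G R'\<close> unfolding left_adjoint_def by blast
    then interpret R': precohesive S E ?F ?G "gunit p" "gcounit p" tE tS R' \<theta>' \<epsilon>' by (rule precohesive)
    show ?thesis using R'.R_fully_faithful R'.essential_image_R by blast
  qed
  then show ?thesis using R.unity_and_identity_of_opposites by blast
qed

end
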